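(* Let $p$ be an odd prime and $x\in\mathbb Z_p$ with $x\not\equiv0\pmod p$. Put $T(x)=\dfrac{B_{p^2(p-1)}(-x)-B_{p^2(p-1)}}{p^2(p-1)}$. Then $$G_p(x)\equiv1-\binom xp\binom{-1-x}p+2pT(x)+2p^2T(x)^2+p^2(-1)^{\langle x\rangle_p}E_{p-3}(-x)\pmod{p^3}.$$ Consequently, for every prime $p>3$: $$G_p\equiv12+64(-1)^{\frac{p-1}2}p^2E_{p-3}\pmod{p^3},\qquad G_p^{(3)}\equiv21+243(-1)^{[p/3]}p^2U_{p-3}\pmod{p^3},$$ $$G_p^{(4)}\equiv52+1024(-1)^{[p/4]}p^2s_{p-3}\pmod{p^3},\qquad G_p^{(6)}\equiv372+8640(-1)^{\frac{p-1}2}p^2E_{p-3}\pmod{p^3}.$$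
   Context: For real $x$ and integer $k\ge0$, $\binom xk=x(x-1)\cdots(x-k+1)/k!$; $G_n(x)=\sum_{k=0}^n\binom nk(-1)^k\binom xk\binom{-1-x}k$. For a prime $p$, $\mathbb Z_p$ is the set of rationals with denominator prime to $p$; congruences modulo powers of $p$ are in $\mathbb Z_p$; for $x\in\mathbb Z_p$, $\langle x\rangle_p\in\{0,\ldots,p-1\}$ with $x\equiv\langle x\rangle_p\pmod p$. $[y]$ is the floor of $y$. Bernoulli numbers: $B_0=1$, $\sum_{k=0}^{n-1}\binom nkB_k=0$ ($n\ge2$); $B_n(x)=\sum_{k=0}^n\binom nkB_kx^{n-k}$. Euler numbers: $E_{2n-1}=0$, $E_0=1$, $E_{2n}=-\sum_{k=1}^n\binom{2n}{2k}E_{2n-2k}$; $E_n(x)=2^{-n}\sum_{k=0}^n\binom nk(2x-1)^{n-k}E_k$. $U_{2n-1}=0$, $U_0=1$, $U_{2n}=-2\sum_{k=1}^n\binom{2n}{2k}U_{2n-2k}$. $s_0=1$, $s_n=1-\sum_{k=0}^{n-1}\binom nk2^{2n-1-2k}s_k$ ($n\ge1$). $G_n=16^nG_n(-\tfrac12)$, $G_n^{(3)}=27^nG_n(-\tfrac13)$, $G_n^{(4)}=64^nG_n(-\tfrac14)$, $G_n^{(6)}=432^nG_n(-\tfrac16)$.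
   Formalization: The first congruence is proved for primes p > 3 only: at p = 3 it is false as printed (for x = 1 the left side is 7 and the right side is 16, which differ by 9, not divisible by 27). The four consequences for p > 3 are unchanged. *)

theory Defs
  imports Complex_Main "HOL-Computational_Algebra.Primes"
begin

definition zloc :: "nat \<Rightarrow> rat set" where
  "zloc p = {x. coprime (snd (quotient_of x)) (int p)}"

text \<open>Congruence of \<open>a\<close> and \<open>b\<close> modulo \<open>m\<close> in the ring \<open>zloc p\<close>; in particular
  both sides have to lie in that ring.\<close>

definition loc_cong :: "nat \<Rightarrow> rat \<Rightarrow> rat \<Rightarrow> nat \<Rightarrow> bool" where
  "loc_cong p a b m \<longleftrightarrow>
     a \<in> zloc p \<and> b \<in> zloc p \<and> (\<exists>c\<in>zloc p. a - b = of_nat m * c)"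

definition residue :: "nat \<Rightarrow> rat \<Rightarrow> nat" where
  "residue p x = (THE r. r < p \<and> loc_cong p x (of_nat r) p)"

definition G :: "nat \<Rightarrow> rat \<Rightarrow> rat" where
  "G n x = (\<Sum>k=0..n. of_nat (n choose k) * (-1) ^ k * (x gchoose k) * ((-1 - x) gchoose k))"

definition G2 :: "nat \<Rightarrow> rat" where "G2 n = 16 ^ n * G n (-1/2)"
definition G3 :: "nat \<Rightarrow> rat" where "G3 n = 27 ^ n * G n (-1/3)"
definition G4 :: "nat \<Rightarrow> rat" where "G4 n = 64 ^ n * G n (-1/4)"
definition G6 :: "nat \<Rightarrow> rat" where "G6 n = 432 ^ n * G n (-1/6)"

text \<open>The recurrence for the Bernoulli numbers, solved for the last term; the
  implicit form is \<open>bernoulli_rec\<close> below.\<close>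

fun bernoulli :: "nat \<Rightarrow> rat" where
  "bernoulli n = (if n = 0 then 1
     else - (\<Sum>k<n. of_nat ((n + 1) choose k) * bernoulli k) / of_nat (n + 1))"
declare bernoulli.simps [simp del]

lemma bernoulli_0: "bernoulli 0 = 1"
  by (simp add: bernoulli.simps)

lemma bernoulli_rec:
  assumes "n \<ge> 2"
  shows "(\<Sum>k=0..n-1. of_nat (n choose k) * bernoulli k) = 0"
proof -
  obtain m where m: "n = Suc m" "m > 0" using assms by (cases n) auto
  have "bernoulli m = - (\<Sum>k<m. of_nat (Suc m choose k) * bernoulli k) / of_nat (Suc m)"
    using m by (subst bernoulli.simps) simp
  hence "of_nat (Suc m) * bernoulli m = - (\<Sum>k<m. of_nat (Suc m choose k) * bernoulli k)"
    by (simp del: of_nat_Suc)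
  moreover have "{0..n-1} = insert m {..<m}" using m by auto
  ultimately show ?thesis using m by (simp del: of_nat_Suc)
qed

definition bernpoly :: "nat \<Rightarrow> rat \<Rightarrow> rat" where
  "bernpoly n x = (\<Sum>k=0..n. of_nat (n choose k) * bernoulli k * x ^ (n - k))"

fun euler_num :: "nat \<Rightarrow> int" where
  "euler_num m = (if odd m then 0 else if m = 0 then 1
     else - (\<Sum>k=1..m div 2. int (m choose (2 * k)) * euler_num (m - 2 * k)))"
declare euler_num.simps [simp del]

lemma euler_num_rec:
  "euler_num 0 = 1"
  "n \<ge> 1 \<Longrightarrow> euler_num (2 * n - 1) = 0"
  "n \<ge> 1 \<Longrightarrow> euler_num (2 * n) =
     - (\<Sum>k=1..n. int ((2 * n) choose (2 * k)) * euler_num (2 * n - 2 * k))"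
  by (subst euler_num.simps; simp)+

definition eulerpoly :: "nat \<Rightarrow> rat \<Rightarrow> rat" where
  "eulerpoly n x =
     (\<Sum>k=0..n. of_nat (n choose k) * (2 * x - 1) ^ (n - k) * of_int (euler_num k)) / 2 ^ n"

fun U :: "nat \<Rightarrow> int" where
  "U m = (if odd m then 0 else if m = 0 then 1
     else - 2 * (\<Sum>k=1..m div 2. int (m choose (2 * k)) * U (m - 2 * k)))"
declare U.simps [simp del]

lemma U_rec:
  "U 0 = 1"
  "n \<ge> 1 \<Longrightarrow> U (2 * n - 1) = 0"
  "n \<ge> 1 \<Longrightarrow> U (2 * n) = - 2 * (\<Sum>k=1..n. int ((2 * n) choose (2 * k)) * U (2 * n - 2 * k))"
  by (subst U.simps; simp)+

text \<open>For \<open>k < n\<close> the exponent \<open>2 * n - 1 - 2 * k\<close> is positive, so nothing is truncated.\<close>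

fun s :: "nat \<Rightarrow> int" where
  "s n = (if n = 0 then 1
     else 1 - (\<Sum>k<n. int (n choose k) * 2 ^ (2 * n - 1 - 2 * k) * s k))"
declare s.simps [simp del]

lemma s_rec:
  "s 0 = 1"
  "n \<ge> 1 \<Longrightarrow> s n = 1 - (\<Sum>k=0..n-1. int (n choose k) * 2 ^ (2 * n - 1 - 2 * k) * s k)"
proof -
  show "s 0 = 1" by (subst s.simps) simp
  assume "n \<ge> 1"
  hence "{0..n-1} = {..<n}" by auto
  with \<open>n \<ge> 1\<close> show "s n = 1 - (\<Sum>k=0..n-1. int (n choose k) * 2 ^ (2 * n - 1 - 2 * k) * s k)"
    by (subst s.simps) simp
qed

definition T :: "nat \<Rightarrow> rat \<Rightarrow> rat" where
  "T p x = (bernpoly (p\<^sup>2 * (p - 1)) (- x) - bernoulli (p\<^sup>2 * (p - 1)))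
             / of_nat (p\<^sup>2 * (p - 1))"

text \<open>The congruence modulo \<open>p ^ 3\<close> between \<open>G p x\<close> and its expression through \<open>T p x\<close> fails for
  \<open>p = 3\<close>: for \<open>x = 1\<close> the two sides are \<open>7\<close> and \<open>16\<close>.\<close>

lemma zloc_3_third:
  assumes "3 * c = 1 \<or> 3 * c = -1"
  shows "c \<notin> zloc 3"
proof -
  have "Fract 1 3 = 1/3" "Fract (-1) 3 = -1/3"
    by (simp_all add: Fract_of_int_quotient)
  hence "c = Fract 1 3 \<or> c = Fract (-1) 3"
    using assms by auto
  moreover have "snd (quotient_of (Fract 1 3)) = 3" "snd (quotient_of (Fract (-1) 3)) = 3"
    by (simp_all add: quotient_of_Fract Rat.normalize_def Let_def gcd_non_0_int)
  ultimately show ?thesis by (auto simp: zloc_def)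
qed

lemma counterexample_3:
  "1 \<in> zloc 3" "\<not> loc_cong 3 1 0 3"
  "\<not> loc_cong 3 (G 3 1)
     (1 - (1 gchoose 3) * ((-1 - 1) gchoose 3)
      + 2 * of_nat 3 * T 3 1 + 2 * of_nat 3 ^ 2 * T 3 1 ^ 2
      + of_nat 3 ^ 2 * (-1) ^ residue 3 1 * eulerpoly (3 - 3) (- 1))
     (3 ^ 3)"
proof -
  note ev = lessThan_Suc lessThan_nat_numeral binomial_fact fact_numeral bernoulli_0
  have b1: "bernoulli 1 = -1/2"
    by (subst bernoulli.simps) (simp add: ev)
  note b1 [unfolded One_nat_def, simp]
  have b2 [simp]: "bernoulli 2 = 1/6"
    by (subst bernoulli.simps) (simp add: ev)
  have b3 [simp]: "bernoulli 3 = 0"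
    by (subst bernoulli.simps) (simp add: ev)
  have b4 [simp]: "bernoulli 4 = -1/30"
    by (subst bernoulli.simps) (simp add: ev)
  have b5 [simp]: "bernoulli 5 = 0"
    by (subst bernoulli.simps) (simp add: ev)
  have b6 [simp]: "bernoulli 6 = 1/42"
    by (subst bernoulli.simps) (simp add: ev)
  have b7 [simp]: "bernoulli 7 = 0"
    by (subst bernoulli.simps) (simp add: ev)
  have b8 [simp]: "bernoulli 8 = -1/30"
    by (subst bernoulli.simps) (simp add: ev)
  have b9 [simp]: "bernoulli 9 = 0"
    by (subst bernoulli.simps) (simp add: ev)
  have b10 [simp]: "bernoulli 10 = 5/66"
    by (subst bernoulli.simps) (simp add: ev)
  have b11 [simp]: "bernoulli 11 = 0"
    by (subst bernoulli.simps) (simp add: ev)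
  have b12 [simp]: "bernoulli 12 = -691/2730"
    by (subst bernoulli.simps) (simp add: ev)
  have b13 [simp]: "bernoulli 13 = 0"
    by (subst bernoulli.simps) (simp add: ev)
  have b14 [simp]: "bernoulli 14 = 7/6"
    by (subst bernoulli.simps) (simp add: ev)
  have b15 [simp]: "bernoulli 15 = 0"
    by (subst bernoulli.simps) (simp add: ev)
  have b16 [simp]: "bernoulli 16 = -3617/510"
    by (subst bernoulli.simps) (simp add: ev)
  have b17 [simp]: "bernoulli 17 = 0"
    by (subst bernoulli.simps) (simp add: ev)
  have T: "T 3 1 = 1"
    by (simp add: T_def bernpoly_def atLeast0AtMost atMost_Suc atMost_nat_numeral ev)
  have z0: "0 \<in> zloc 3" and z1: "1 \<in> zloc 3"
    by (simp_all add: zloc_def)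
  have res: "residue 3 1 = 1"
    unfolding residue_def
  proof (rule the_equality)
    show "1 < (3::nat) \<and> loc_cong 3 1 (of_nat 1) 3"
      using z0 z1 by (auto simp: loc_cong_def)
  next
    fix r :: nat assume r: "r < 3 \<and> loc_cong 3 1 (of_nat r) 3"
    then obtain c where c: "c \<in> zloc 3" "1 - of_nat r = 3 * c" by (auto simp: loc_cong_def)
    have "c = (1 - of_nat r) / 3" using c(2) by simp
    moreover have "r = 0 \<or> r = 1 \<or> r = 2" using r by auto
    ultimately show "r = 1" using c zloc_3_third[of c] by auto
  qed
  have G: "G 3 1 = 7"
    by (simp add: G_def gbinomial_prod_rev fact_numeral numeral_eq_Suc)
  have g: "(1 gchoose 3 :: rat) = 0"
    by (simp add: gbinomial_prod_rev numeral_eq_Suc)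
  have E: "eulerpoly (3 - 3) (-1) = 1"
    by (simp add: eulerpoly_def euler_num_rec)
  have "c \<notin> zloc 3" if "7 - 16 = 27 * c" for c :: rat
    using that by (intro zloc_3_third) simp
  thus "\<not> loc_cong 3 (G 3 1)
     (1 - (1 gchoose 3) * ((-1 - 1) gchoose 3)
      + 2 * of_nat 3 * T 3 1 + 2 * of_nat 3 ^ 2 * T 3 1 ^ 2
      + of_nat 3 ^ 2 * (-1) ^ residue 3 1 * eulerpoly (3 - 3) (- 1))
     (3 ^ 3)"
    unfolding T res G g E by (auto simp: loc_cong_def)
  show "1 \<in> zloc 3" by (fact z1)
  show "\<not> loc_cong 3 1 0 3" using zloc_3_third by (auto simp: loc_cong_def)
qed

end

theory Submission
  imports Defs "HOL-Number_Theory.Residues" "HOL-Computational_Algebra.Formal_Power_Series"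
begin

text \<open>
  Write \<open>x = a + p t\<close> with \<open>0 \<le> a < p\<close>. Up to its last term, \<open>G p x\<close> is \<open>1 + p f(x)\<close> with a polynomial
  \<open>f\<close> over the local ring, so modulo \<open>p\<^sup>3\<close> it is affine in \<open>t\<close>; it is invariant under \<open>x \<mapsto> -1 - x\<close>,
  which relates \<open>t = -1\<close> to the residue \<open>p - 1 - a\<close>. Hence only \<open>x = n \<in> {0..<p}\<close> matters. There
  the sum is a Hahn polynomial in \<open>p\<close>, and its three-term recurrence in \<open>n\<close> yields its expansion up
  to \<open>p\<^sup>2\<close> in harmonic sums. On natural numbers \<open>T p n\<close> is \<open>\<Sum>k\<le>n. k ^ (N - 1)\<close> with
  \<open>N = p\<^sup>2 (p - 1)\<close>, a harmonic sum without the multiples of \<open>p\<close>, and \<open>T p\<close> is \<open>p\<close>-adically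
  continuous; the values of the Euler polynomial are alternating harmonic sums modulo \<open>p\<close>.

  For \<open>x = -1/m\<close> the multiplication theorem for Bernoulli polynomials and \<open>p B_N \<equiv> p - 1\<close> modulo
  \<open>p\<^sup>2\<close> turn \<open>T p x\<close> into Fermat quotients, which cancel against \<open>16 ^ p\<close>, \<open>27 ^ p\<close>, \<open>64 ^ p\<close>, \<open>432 ^ p\<close>,
  and the product of binomial coefficients becomes a multinomial coefficient, known modulo \<open>p\<^sup>3\<close> by
  a Jacobsthal-type congruence.
\<close>


section \<open>The local ring and its congruences\<close>

text \<open>The exponent N is the totient of \<open>p ^ 3\<close>: hence k^(N - 1) is 1/k modulo p^3
  when p does not divide k, and 0 otherwise. In the congruence T is multiplied by p, so it matters
  modulo p^2 and depends on t there; the Euler polynomial is multiplied by p^2 and sees only the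
  residue a. The prime 3 drops out because the sum of 1/i^2 over 0 < i < p vanishes modulo p only
  for p > 3. The cancellation has a reason: 1 + 2 p T + 2 p^2 T^2 is the exponential of 2 p T to
  second order. For x = -1/m, 2 T is -L modulo p^2 with p L = log (M ^ (p - 1)), M = 16, 27, 64,
  432; so M ^ p times that exponential is M modulo p^3. The multinomial coefficients are, modulo
  p^3, the ones with p replaced by 1: (2 choose 1)^2 = 4, 3! = 6, 4!/2! = 12, 6!/(3! 2!) = 60. This
  gives the constants 12 = 16 - 4, 21 = 27 - 6, 52 = 64 - 12 and 372 = 432 - 60. The coefficients of
  the p^2 terms are M m^2 for m = 2, 3, 4, where m^2 is 1/m^(p - 3) modulo p, by Fermat.\<close>

locale local_ring =
  fixes p :: nat
  assumes prime_p: "prime p"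
begin

abbreviation P :: rat where "P \<equiv> of_nat p"

lemma p_pos [simp]: "p > 0" "p \<noteq> 0"
  using prime_gt_0_nat[OF prime_p] by simp_all

lemma P_nonzero [simp]: "P \<noteq> 0"
  using p_pos by simp

text \<open>\<open>zloc\<close> is defined through the reduced fraction; admitting any denominator
  prime to p makes the ring operations immediate.\<close>

lemma zloc_iff: "x \<in> zloc p \<longleftrightarrow> (\<exists>a b. x = of_int a / of_int b \<and> \<not> int p dvd b)"
proof -
  obtain c d where cd: "quotient_of x = (c, d)"
    by force
  note x = quotient_of_div[OF cd]
  have pos: "d > 0" and cop: "coprime c d"
    using cd by (rule quotient_of_denom_pos, rule quotient_of_coprime)
  have "prime (int p)"
    using prime_p by simp
  then have *: "x \<in> zloc p \<longleftrightarrow> \<not> int p dvd d"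
  proof -
    have "x \<in> zloc p \<longleftrightarrow> coprime (int p) d"
      unfolding zloc_def mem_Collect_eq cd snd_conv by (rule coprime_commute)
    also have "\<dots> \<longleftrightarrow> \<not> int p dvd d"
      using \<open>prime (int p)\<close> prime_imp_coprime[of "int p" d] coprime_absorb_left[of "int p" d]
        not_prime_unit[of "int p"] by argo
    finally show ?thesis .
  qed
  show ?thesis
  proof
    assume "x \<in> zloc p"
    then show "\<exists>a b. x = of_int a / of_int b \<and> \<not> int p dvd b"
      using * x by blast
  next
    assume "\<exists>a b. x = of_int a / of_int b \<and> \<not> int p dvd b"
    then obtain a b where ab: "x = of_int a / of_int b" "\<not> int p dvd b"
      by blast
    then have "b \<noteq> 0"
      by auto
    then have "(of_int (c * b) :: rat) = of_int (a * d)"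
      using ab x pos by (simp add: field_simps)
    then have "c * b = a * d"
      by linarith
    then have "d dvd b"
      using cop by (metis coprime_commute coprime_dvd_mult_right_iff dvd_triv_right)
    then show "x \<in> zloc p"
      using * ab dvd_trans by blast
  qed
qed

lemma zloc_divideI: "\<not> int p dvd b \<Longrightarrow> of_int a / of_int b \<in> zloc p"
  using zloc_iff by blast

lemma zloc_of_int [simp, intro]: "of_int a \<in> zloc p"
proof -
  have "\<not> int p dvd 1"
    using prime_p by (metis int_dvd_int_iff nat_dvd_1_iff_1 not_prime_1 of_nat_1)
  from zloc_divideI[OF this, of a] show ?thesis by simp
qed

lemma zloc_of_nat [simp, intro]: "of_nat a \<in> zloc p"
  using zloc_of_int[of "int a"] by simp

lemma zloc_numeral [simp, intro]: "numeral a \<in> zloc p" "0 \<in> zloc p" "1 \<in> zloc p"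
  using zloc_of_int[of "numeral a"] zloc_of_int[of 0] zloc_of_int[of 1] by simp_all

lemma int_dvd_multD: "int p dvd a * b \<Longrightarrow> int p dvd a \<or> int p dvd b"
  using prime_p by (simp add: prime_dvd_mult_iff)

lemma zloc_add [simp, intro]:
  assumes "x \<in> zloc p" "y \<in> zloc p" shows "x + y \<in> zloc p"
proof -
  obtain a b c d where "x = of_int a / of_int b" "\<not> int p dvd b" "y = of_int c / of_int d" "\<not> int p dvd d"
    using assms unfolding zloc_iff by blast
  note xy = this
  have bd: "b \<noteq> 0" "d \<noteq> 0"
    using xy by auto
  have "\<not> int p dvd b * d"
    using xy int_dvd_multD by blast
  moreover have "x + y = of_int (a * d + c * b) / of_int (b * d)"
    unfolding xy(1,3) using bd by (simp add: add_frac_eq)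
  ultimately show ?thesis using zloc_divideI by metis
qed

lemma zloc_mult [simp, intro]:
  assumes "x \<in> zloc p" "y \<in> zloc p" shows "x * y \<in> zloc p"
proof -
  obtain a b c d where "x = of_int a / of_int b" "\<not> int p dvd b" "y = of_int c / of_int d" "\<not> int p dvd d"
    using assms unfolding zloc_iff by blast
  then have "x * y = of_int (a * c) / of_int (b * d)" "\<not> int p dvd b * d"
    using int_dvd_multD[of b d] by auto
  then show ?thesis using zloc_divideI by metis
qed

lemma zloc_minus [simp, intro]: "x \<in> zloc p \<Longrightarrow> - x \<in> zloc p"
  using zloc_mult[of "of_int (-1)" x] zloc_of_int by (metis mult_minus1 of_int_1 of_int_minus)

lemma zloc_diff [simp, intro]: "x \<in> zloc p \<Longrightarrow> y \<in> zloc p \<Longrightarrow> x - y \<in> zloc p"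
  using zloc_add[of x "- y"] by simp

lemma zloc_power [simp, intro]: "x \<in> zloc p \<Longrightarrow> x ^ n \<in> zloc p"
  by (induction n) auto

lemma zloc_sum [simp, intro]: "(\<And>i. i \<in> I \<Longrightarrow> f i \<in> zloc p) \<Longrightarrow> sum f I \<in> zloc p"
  by (induction I rule: infinite_finite_induct) auto

lemma zloc_prod [simp, intro]: "(\<And>i. i \<in> I \<Longrightarrow> f i \<in> zloc p) \<Longrightarrow> prod f I \<in> zloc p"
  by (induction I rule: infinite_finite_induct) auto

lemma zloc_inverse_int: "\<not> int p dvd b \<Longrightarrow> 1 / of_int b \<in> zloc p"
  using zloc_divideI[of b 1] by simp

lemma zloc_inverse_nat: "\<not> p dvd b \<Longrightarrow> 1 / of_nat b \<in> zloc p"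
  using zloc_inverse_int[of "int b"] by simp

lemma not_dvd_less: "0 < i \<Longrightarrow> i < p \<Longrightarrow> \<not> p dvd i"
  using nat_dvd_not_less by blast

lemma zloc_inverse_less: "i < p \<Longrightarrow> 1 / of_nat i \<in> zloc p"
  using zloc_inverse_nat[of i] not_dvd_less[of i] by (cases "i = 0") auto

lemma zloc_divide_nat: "x \<in> zloc p \<Longrightarrow> \<not> p dvd b \<Longrightarrow> x / of_nat b \<in> zloc p"
  using zloc_mult[OF _ zloc_inverse_nat, of x b] by simp

text \<open>Unlike \<open>loc_cong\<close>, this does not ask \<open>a\<close> and \<open>b\<close>
  to be p-integral, so it chains through values such as \<open>T p x\<close> before their
  integrality is known. Integrality is recovered at the end by \<open>pcong_zloc\<close>.\<close>

definition pcong :: "nat \<Rightarrow> rat \<Rightarrow> rat \<Rightarrow> bool" where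
  "pcong k a b \<longleftrightarrow> (\<exists>c\<in>zloc p. a = b + P ^ k * c)"

lemma pcongI: "a = b + P ^ k * c \<Longrightarrow> c \<in> zloc p \<Longrightarrow> pcong k a b"
  unfolding pcong_def by blast

lemma pcongE:
  assumes "pcong k a b"
  obtains c where "c \<in> zloc p" "a = b + P ^ k * c"
  using assms unfolding pcong_def by blast

lemma loc_cong_iff: "loc_cong p a b (p ^ k) \<longleftrightarrow> a \<in> zloc p \<and> b \<in> zloc p \<and> pcong k a b"
  unfolding loc_cong_def pcong_def by (auto simp: algebra_simps)

lemma pcong_refl [simp, intro]: "pcong k a a"
  by (rule pcongI[where c = 0]) auto

lemma pcong_sym: "pcong k a b \<Longrightarrow> pcong k b a"
  by (erule pcongE, rule pcongI[where c = "- _"]) auto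

lemma pcong_trans [trans]: "pcong k a b \<Longrightarrow> pcong k b c \<Longrightarrow> pcong k a c"
  by (elim pcongE, rule pcongI[where c = "_ + _"]) (auto simp: algebra_simps)

lemma pcong_add: "pcong k a b \<Longrightarrow> pcong k c d \<Longrightarrow> pcong k (a + c) (b + d)"
  by (elim pcongE, rule pcongI[where c = "_ + _"]) (auto simp: algebra_simps)

lemma pcong_minus: "pcong k a b \<Longrightarrow> pcong k (- a) (- b)"
  by (elim pcongE, rule pcongI[where c = "- _"]) (auto simp: algebra_simps)

lemma pcong_diff: "pcong k a b \<Longrightarrow> pcong k c d \<Longrightarrow> pcong k (a - c) (b - d)"
  using pcong_add[OF _ pcong_minus, of k a b c d] by simp

lemma pcong_mult_left: "pcong k a b \<Longrightarrow> c \<in> zloc p \<Longrightarrow> pcong k (c * a) (c * b)"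
  by (elim pcongE, rule pcongI[where c = "c * _"]) (auto simp: algebra_simps)

lemma pcong_mult_right: "pcong k a b \<Longrightarrow> c \<in> zloc p \<Longrightarrow> pcong k (a * c) (b * c)"
  using pcong_mult_left[of k a b c] by (simp add: mult.commute)

lemma pcong_zloc: "pcong k a b \<Longrightarrow> b \<in> zloc p \<Longrightarrow> a \<in> zloc p"
  by (elim pcongE) auto

lemma pcong_mult:
  assumes "pcong k a b" "pcong k c d" "b \<in> zloc p" "d \<in> zloc p"
  shows "pcong k (a * c) (b * d)"
proof -
  have "pcong k (a * c) (b * c)"
    using assms pcong_zloc by (intro pcong_mult_right) auto
  also have "pcong k (b * c) (b * d)"
    using assms by (intro pcong_mult_left) auto
  finally show ?thesis .
qed

lemma pcong_power: "pcong k a b \<Longrightarrow> b \<in> zloc p \<Longrightarrow> pcong k (a ^ n) (b ^ n)"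
  by (induction n) (auto intro: pcong_mult)

lemma pcong_sum: "(\<And>i. i \<in> I \<Longrightarrow> pcong k (f i) (g i)) \<Longrightarrow> pcong k (sum f I) (sum g I)"
  by (induction I rule: infinite_finite_induct) (auto intro: pcong_add)

lemma pcong_mono: "pcong k a b \<Longrightarrow> j \<le> k \<Longrightarrow> pcong j a b"
  by (elim pcongE, rule pcongI[where c = "P ^ (k - j) * _"])
    (auto simp: mult.assoc[symmetric] power_add[symmetric])

lemma pcong_shift: "pcong k a b \<longleftrightarrow> pcong (j + k) (P ^ j * a) (P ^ j * b)"
proof -
  have "P ^ j * b + P ^ (j + k) * c = P ^ j * (b + P ^ k * c)" for c
    by (simp add: power_add algebra_simps)
  moreover have "P ^ j * u = P ^ j * v \<longleftrightarrow> u = v" for u v :: rat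
    by simp
  ultimately show ?thesis
    unfolding pcong_def by (simp only:)
qed

lemma pcong_cancel:
  assumes "pcong k (u * a) (u * b)" "u \<noteq> 0" "1 / u \<in> zloc p"
  shows "pcong k a b"
  using pcong_mult_left[OF assms(1,3)] assms(2) by simp

lemma pcong_of_int:
  assumes "[a = b] (mod (int p ^ k))" shows "pcong k (of_int a) (of_int b)"
proof -
  obtain c where "a = b + int p ^ k * c"
    using assms by (metis cong_iff_lin cong_sym mult.commute)
  then show ?thesis
    by (intro pcongI[where c = "of_int c"]) auto
qed

lemma pcong_of_nat:
  assumes "[a = b] (mod (p ^ k))" shows "pcong k (of_nat a) (of_nat b)"
  using pcong_of_int[of "int a" "int b" k] assms by (simp add: cong_int_iff[symmetric])

lemma pcong_of_intD:
  assumes "pcong k (of_int a) (of_int b)" shows "[a = b] (mod (int p ^ k))"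
proof -
  obtain c where c: "c \<in> zloc p" "of_int a = (of_int b :: rat) + P ^ k * c"
    using assms by (elim pcongE)
  then obtain u v where uv: "c = of_int u / of_int v" "\<not> int p dvd v"
    using zloc_iff by blast
  then have "v \<noteq> 0" by auto
  with uv c have "(of_int ((a - b) * v) :: rat) = of_int (int p ^ k * u)"
    by (simp add: field_simps)
  then have "(a - b) * v = int p ^ k * u"
    by linarith
  then have "int p ^ k dvd (a - b) * v"
    by simp
  moreover have "coprime (int p ^ k) v"
    using uv prime_p by (simp add: prime_imp_coprime)
  ultimately have "int p ^ k dvd a - b"
    by (simp add: coprime_dvd_mult_left_iff)
  then show ?thesis by (simp add: cong_iff_dvd_diff)
qed

lemma pcong_of_natD:
  "pcong k (of_nat a) (of_nat b) \<Longrightarrow> [a = b] (mod (p ^ k))"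
  using pcong_of_intD[of k "int a" "int b"] by (simp add: cong_int_iff[symmetric])

text \<open>The natural numbers are p-adically dense in the local ring: the denominator is inverted
  modulo \<open>p ^ k\<close> and the result reduced to a nonnegative representative.\<close>

lemma zloc_approx_nat:
  assumes "x \<in> zloc p"
  obtains n :: nat where "pcong k x (of_nat n)"
proof -
  obtain a b where x: "x = of_int a / of_int b" "\<not> int p dvd b"
    using assms zloc_iff by blast
  then have b0: "b \<noteq> 0" by auto
  have "coprime b (int p ^ k)"
    using x prime_p prime_imp_coprime[of "int p" b] coprime_commute[of b "int p"] by simp
  then obtain y where y: "[b * y = 1] (mod (int p ^ k))"
    using cong_solve_coprime_int by blast
  have "pcong k (of_int b * x) (of_int b * of_int (a * y))"
  proof -
    have "pcong k (of_int (a * 1)) (of_int (a * (b * y)))"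
      using pcong_of_int[OF cong_sym[OF cong_scalar_left[OF y, of a]]] .
    moreover have "of_int b * x = of_int (a * 1)"
      using x b0 by simp
    moreover have "a * (b * y) = b * (a * y)"
      by simp
    ultimately show ?thesis
      by (simp only: of_int_mult)
  qed
  then have *: "pcong k x (of_int (a * y))"
    by (rule pcong_cancel) (use b0 zloc_inverse_int[OF x(2)] in auto)
  have "[a * y = (a * y) mod (int p ^ k)] (mod (int p ^ k))"
    by (simp add: cong_def)
  moreover have "(a * y) mod (int p ^ k) \<ge> 0"
    using p_pos by simp
  ultimately have "[a * y = int (nat ((a * y) mod (int p ^ k)))] (mod (int p ^ k))"
    by simp
  from pcong_trans[OF * pcong_of_int[OF this]] show thesis
    unfolding of_int_of_nat_eq by (rule that)
qed

lemma residueI: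
  assumes "x \<in> zloc p" "a < p" "pcong 1 x (of_nat a)"
  shows "residue p x = a"
  unfolding residue_def
proof (rule the_equality)
  show "a < p \<and> loc_cong p x (of_nat a) p"
    using assms loc_cong_iff[of _ _ 1] by simp
next
  fix r assume r: "r < p \<and> loc_cong p x (of_nat r) p"
  then have "pcong 1 x (of_nat r)"
    using loc_cong_iff[of _ _ 1] by simp
  then have "[r = a] (mod p)"
    using assms pcong_of_natD[of 1 r a] pcong_trans pcong_sym by (metis power_one_right)
  then show "r = a"
    using r assms by (simp add: cong_def)
qed

lemma residue:
  assumes "x \<in> zloc p"
  shows "residue p x < p" "pcong 1 x (of_nat (residue p x))"
proof -
  obtain n where n: "pcong 1 x (of_nat n)"
    using zloc_approx_nat assms by blast
  have "[n = n mod p] (mod (p ^ 1))"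
    by (simp add: cong_def)
  with n have *: "pcong 1 x (of_nat (n mod p))"
    using pcong_of_nat pcong_trans by blast
  then have "residue p x = n mod p"
    using assms p_pos by (intro residueI) auto
  then show "residue p x < p" "pcong 1 x (of_nat (residue p x))"
    using * p_pos by auto
qed

end

section \<open>The recurrence in \<open>n\<close>\<close>

text \<open>At a natural number n this is (n choose k) (n + k choose k), up to sign the coefficient
  of a shifted Legendre polynomial.\<close>

definition legW :: "nat \<Rightarrow> rat \<Rightarrow> rat" where
  "legW k x = (-1) ^ k * (x gchoose k) * ((-1 - x) gchoose k)"

lemma G_legW: "G n x = (\<Sum>k=0..n. of_nat (n choose k) * legW k x)"
  by (simp add: G_def legW_def mult.assoc)

lemma legW_reflect: "legW k (-1 - x) = legW k x"
  by (simp add: legW_def)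

lemma legW_of_nat: "legW k (of_nat n) = of_nat ((n choose k) * ((n + k) choose k))"
proof -
  have "((-1 - of_nat n) gchoose k :: rat) = (-1) ^ k * (of_nat (n + k) gchoose k)"
    using gbinomial_minus[of "of_nat n + 1 :: rat" k] by (simp add: algebra_simps)
  then show ?thesis
    by (simp add: legW_def binomial_gbinomial mult_ac flip: power_mult_distrib)
qed

lemma legW_prod:
  "legW k x = (\<Prod>i=0..<k. - (x - of_nat i) * (-1 - x - of_nat i)) / (fact k)\<^sup>2"
proof -
  have "(\<Prod>i=0..<k. - (x - of_nat i) * (-1 - x - of_nat i)) =
      (-1) ^ k * (\<Prod>i=0..<k. x - of_nat i) * (\<Prod>i=0..<k. -1 - x - of_nat i)"
    by (simp only: prod.distrib prod_uminus card_atLeastLessThan diff_zero)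
  then show ?thesis
    by (simp add: legW_def gbinomial_prod_rev power2_eq_square)
qed

text \<open>The hypergeometric sum 3F2(-n, n + 1, -X; 1, 1; 1). Compared with \<open>G\<close>, the
  upper index of the binomial coefficient has become a variable, and the former argument, now a
  natural number, bounds the sum.\<close>

definition legQ :: "nat \<Rightarrow> rat \<Rightarrow> rat" where
  "legQ n X = (\<Sum>k\<le>n. (X gchoose k) * legW k (of_nat n))"

lemma legW_fact:
  assumes "k \<le> n"
  shows "legW k (of_nat n) = fact (n + k) / (fact (n - k) * (fact k)\<^sup>2)"
  using assms by (simp add: legW_of_nat binomial_fact power2_eq_square)

lemma legW_eq_0: "n < k \<Longrightarrow> legW k (of_nat n) = 0"
  by (simp add: legW_of_nat)

lemma legQ_extend:
  assumes "n \<le> m"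
  shows "legQ n X = (\<Sum>k\<le>m. (X gchoose k) * legW k (of_nat n))"
  unfolding legQ_def
  using assms by (intro sum.mono_neutral_left) (auto simp: legW_eq_0)

text \<open>Here \<open>h k\<close> stands for the shifted term \<open>g (Suc k)\<close>, but the
  two need not agree at \<open>k = M\<close>. In the application they do not: there truncated
  subtraction spoils \<open>g (Suc M)\<close>, while \<open>h M\<close> is 0.\<close>

lemma sum_telescope_shift:
  fixes g h :: "nat \<Rightarrow> 'a::ab_group_add"
  assumes "g 0 = 0" "\<And>k. k < M \<Longrightarrow> g (Suc k) = h k"
  shows "(\<Sum>k\<le>M. h k - g k) = h M"
  using assms by (induction M) auto

text \<open>The certificate \<open>g\<close>, \<open>h\<close> is the output of Zeilberger's algorithm.\<close>

lemma legQ_rec: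
  "of_nat (m + 2) ^ 2 * legQ (m + 2) X =
     of_nat (2 * m + 3) * (2 * X + 1) * legQ (m + 1) X + of_nat (m + 1) ^ 2 * legQ m X"
proof -
  \<comment> \<open>\<open>u\<close> is the common factor of the three values of \<open>legW\<close>
    for \<open>m\<close>, \<open>m + 1\<close>, \<open>m + 2\<close>: each is \<open>u k\<close>
    times a quadratic polynomial in k, whose zeros account for the indices beyond the ends of the
    shorter sums.\<close>
  define u :: "nat \<Rightarrow> rat" where "u k = fact (m + k) / (fact (m + 2 - k) * (fact k)\<^sup>2)" for k
  let ?m = "of_nat m :: rat"
  define g where "g k = - 2 * (2 * ?m + 3) * of_nat k ^ 3 * (X gchoose k) * u k" for k
  define h where "h k = - 2 * (2 * ?m + 3) * (X - of_nat k) * (X gchoose k) *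
      ((?m + 1 + of_nat k) * (?m + 2 - of_nat k) * u k)" for k
  have w2: "legW k (of_nat (m + 2)) = (?m + 2 + of_nat k) * (?m + 1 + of_nat k) * u k"
    if "k \<le> m + 2" for k
  proof -
    have a: "m + 2 + k = Suc (m + 1 + k)" "m + 1 + k = Suc (m + k)"
      by simp_all
    have "(fact (m + 2 + k) :: rat) = of_nat (m + 2 + k) * (of_nat (m + 1 + k) * fact (m + k))"
      by (simp only: a fact_Suc)
    then show ?thesis
      unfolding legW_fact[OF that] u_def by (simp add: add_ac)
  qed
  have w1: "legW k (of_nat (m + 1)) = (?m + 1 + of_nat k) * (?m + 2 - of_nat k) * u k"
    if "k \<le> m + 2" for k
  proof (cases "k = m + 2")
    case False
    then have "m + 1 = k + (m + 1 - k)"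
      using that by simp
    then obtain j where "m + 1 = k + j"
      by blast
    then have j: "m + 2 - k = Suc j" "m + 1 - k = j" "?m + 1 = of_nat k + of_nat j" "k \<le> m + 1"
      by (auto simp flip: of_nat_add of_nat_Suc)
    have "legW k (of_nat (m + 1)) = (?m + 1 + of_nat k) * fact (m + k) / (fact j * (fact k)\<^sup>2)"
    proof -
      have "(fact (m + 1 + k) :: rat) = (?m + 1 + of_nat k) * fact (m + k)"
        using fact_Suc[of "m + k", where 'a = rat] by (simp add: add_ac)
      then show ?thesis
        unfolding legW_fact[OF j(4)] j(2) by simp
    qed
    also have "\<dots> = (?m + 1 + of_nat k) * of_nat (Suc j) * u k"
      unfolding u_def j(1) fact_Suc by (simp del: of_nat_Suc)
    also have "(of_nat (Suc j) :: rat) = ?m + 2 - of_nat k"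
      using j by simp
    finally show ?thesis .
  next
    case True
    then show ?thesis
      using legW_eq_0[of "m + 1" k] by simp
  qed
  have w0: "legW k (of_nat m) = (?m + 2 - of_nat k) * (?m + 1 - of_nat k) * u k"
    if "k \<le> m + 2" for k
  proof (cases "k \<le> m")
    case True
    then obtain j where mj: "m = k + j"
      using less_eqE by blast
    have "m - k = j"
      using mj by simp
    then have "legW k (of_nat m) = fact (m + k) / (fact j * (fact k)\<^sup>2)"
      using legW_fact[OF True] by simp
    also have "\<dots> = of_nat (Suc (Suc j)) * of_nat (Suc j) * u k"
    proof -
      have "m + 2 - k = Suc (Suc j)"
        using mj by simp
      then show ?thesis
        unfolding u_def by (simp only: fact_Suc) (simp del: of_nat_Suc)
    qed
    finally show ?thesis
      by (simp add: mj add.commute)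
  next
    case False
    then have "k = m + 1 \<or> k = m + 2"
      using that by auto
    then show ?thesis
      using legW_eq_0[of m k] by auto
  qed
  have u_Suc: "of_nat (Suc k) ^ 2 * u (Suc k) = (?m + 1 + of_nat k) * (?m + 2 - of_nat k) * u k"
    if "k < m + 2" for k
  proof -
    have "m + 1 = k + (m + 1 - k)"
      using that by simp
    then obtain j where mj: "m + 1 = k + j"
      by blast
    then have j: "m + 2 - k = Suc j" "m + 2 - Suc k = j"
      by auto
    have "of_nat (Suc k) ^ 2 * u (Suc k) = (?m + 1 + of_nat k) * fact (m + k) / (fact j * (fact k)\<^sup>2)"
    proof -
      have "(fact (m + Suc k) :: rat) = (?m + 1 + of_nat k) * fact (m + k)"
        using fact_Suc[of "m + k", where 'a = rat] by (simp add: add_ac)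
      then show ?thesis
        unfolding u_def j(2) by (simp add: power_mult_distrib del: of_nat_Suc)
    qed
    also have "\<dots> = (?m + 1 + of_nat k) * of_nat (Suc j) * u k"
      unfolding u_def j(1) fact_Suc by (simp del: of_nat_Suc)
    also have "of_nat (Suc j) = ?m + 2 - of_nat k"
      using arg_cong[OF mj, of "of_nat :: nat \<Rightarrow> rat"] by simp
    finally show ?thesis .
  qed
  have g_Suc: "g (Suc k) = h k" if "k < m + 2" for k
  proof -
    have gb: "of_nat (Suc k) * (X gchoose Suc k) = (X - of_nat k) * (X gchoose k)"
      using gbinomial_absorption[of k X] gbinomial_absorb_comp[of X k] by simp
    have "g (Suc k) = - 2 * (2 * ?m + 3) * (of_nat (Suc k) * (X gchoose Suc k)) * (of_nat (Suc k) ^ 2 * u (Suc k))"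
      by (simp add: g_def power3_eq_cube power2_eq_square)
    also have "\<dots> = h k"
      unfolding gb u_Suc[OF that] h_def by simp
    finally show ?thesis .
  qed
  have Q: "c * legQ n X = (\<Sum>k\<le>m + 2. c * ((X gchoose k) * legW k (of_nat n)))" if "n \<le> m + 2" for c n
    unfolding legQ_extend[OF that] by (rule sum_distrib_left)
  have "of_nat (m + 2) ^ 2 * legQ (m + 2) X - of_nat (2 * m + 3) * (2 * X + 1) * legQ (m + 1) X
      - of_nat (m + 1) ^ 2 * legQ m X =
    (\<Sum>k\<le>m + 2. of_nat (m + 2) ^ 2 * ((X gchoose k) * legW k (of_nat (m + 2)))
      - of_nat (2 * m + 3) * (2 * X + 1) * ((X gchoose k) * legW k (of_nat (m + 1)))
      - of_nat (m + 1) ^ 2 * ((X gchoose k) * legW k (of_nat m)))"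
    unfolding sum_subtractf by (intro arg_cong2[where f = "(-)"] Q) simp_all
  also have "\<dots> = (\<Sum>k\<le>m + 2. h k - g k)"
  proof (intro sum.cong refl)
    fix k assume "k \<in> {..m + 2}"
    then have k: "k \<le> m + 2" by simp
    show "of_nat (m + 2) ^ 2 * ((X gchoose k) * legW k (of_nat (m + 2)))
      - of_nat (2 * m + 3) * (2 * X + 1) * ((X gchoose k) * legW k (of_nat (m + 1)))
      - of_nat (m + 1) ^ 2 * ((X gchoose k) * legW k (of_nat m)) = h k - g k"
      unfolding w0[OF k] w1[OF k] w2[OF k]
      unfolding g_def h_def of_nat_add of_nat_mult of_nat_numeral of_nat_1
      by (simp add: algebra_simps power2_eq_square power3_eq_cube)
  qed
  also have "\<dots> = h (m + 2)"
    using g_Suc by (intro sum_telescope_shift) (auto simp: g_def)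
  also have "\<dots> = 0"
    by (simp add: h_def)
  finally show ?thesis
    by simp
qed

section \<open>Harmonic sums and the expansion of \<open>legQ\<close> at p\<close>

definition harm1 :: "nat \<Rightarrow> rat" where "harm1 n = (\<Sum>i=1..n. 1 / of_nat i)"
definition harm2 :: "nat \<Rightarrow> rat" where "harm2 n = (\<Sum>i=1..n. 1 / of_nat i ^ 2)"
definition altharm2 :: "nat \<Rightarrow> rat" where "altharm2 n = (\<Sum>i=1..n. (-1) ^ i / of_nat i ^ 2)"

text \<open>The algebra of the induction step below: \<open>h0\<close>, \<open>h\<close>,
  \<open>h2\<close> and \<open>a0\<close>, \<open>a\<close>, \<open>a2\<close> stand for harmonic
  and alternating sums up to n, n + 1, n + 2, and \<open>e\<close> for the sign (-1)^n. The
  quadratic expansion satisfies the recurrence exactly up to one term in X^3; denominators are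
  cleared so that both sides can be compared as polynomials.\<close>

lemma legQ_expansion_rec:
  fixes n X h h0 h2 a a0 a2 e :: rat
  assumes "(n + 2) * h2 = (n + 2) * h + 1" "(n + 1) * h0 = (n + 1) * h - 1"
    and "(n + 2) ^ 2 * a2 = (n + 2) ^ 2 * a + e" "(n + 1) ^ 2 * a0 = (n + 1) ^ 2 * a + e"
  shows "(n + 2) ^ 2 * (1 + 2 * X * h2 + 2 * X ^ 2 * (h2 ^ 2 + a2)) =
    (2 * n + 3) * (2 * X + 1) * (1 + 2 * X * h + 2 * X ^ 2 * (h ^ 2 + a))
    + (n + 1) ^ 2 * (1 + 2 * X * h0 + 2 * X ^ 2 * (h0 ^ 2 + a0))
    - X ^ 3 * (4 * (2 * n + 3) * (h ^ 2 + a))"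
proof -
  have "(n + 2) ^ 2 * (1 + 2 * X * h2 + 2 * X ^ 2 * (h2 ^ 2 + a2)) =
      (n + 2) ^ 2 + 2 * X * (n + 2) * ((n + 2) * h2) + 2 * X ^ 2 * (((n + 2) * h2) ^ 2 + (n + 2) ^ 2 * a2)"
    by (simp add: algebra_simps power2_eq_square)
  moreover have "(n + 1) ^ 2 * (1 + 2 * X * h0 + 2 * X ^ 2 * (h0 ^ 2 + a0)) =
      (n + 1) ^ 2 + 2 * X * (n + 1) * ((n + 1) * h0) + 2 * X ^ 2 * (((n + 1) * h0) ^ 2 + (n + 1) ^ 2 * a0)"
    by (simp add: algebra_simps power2_eq_square)
  ultimately show ?thesis
    unfolding assms by (simp only:) (simp add: algebra_simps power2_eq_square power3_eq_cube)
qed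

context local_ring
begin

lemma harm_zloc:
  assumes "n < p"
  shows "harm1 n \<in> zloc p" "harm2 n \<in> zloc p" "altharm2 n \<in> zloc p"
proof -
  have i: "1 / of_nat i \<in> zloc p" if "i \<in> {1..n}" for i
    using that assms by (intro zloc_inverse_less) auto
  have i2: "1 / of_nat i ^ 2 \<in> zloc p" "(- 1) ^ i / of_nat i ^ 2 \<in> zloc p" if "i \<in> {1..n}" for i
  proof -
    show "1 / of_nat i ^ 2 \<in> zloc p"
      using zloc_power[OF i[OF that], of 2] by (simp add: power_divide)
    then have "(-1) ^ i * (1 / of_nat i ^ 2) \<in> zloc p"
      by (intro zloc_mult zloc_power zloc_minus zloc_numeral)
    then show "(- 1) ^ i / of_nat i ^ 2 \<in> zloc p"
      by simp
  qed
  show "harm1 n \<in> zloc p" "harm2 n \<in> zloc p" "altharm2 n \<in> zloc p"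
    unfolding harm1_def harm2_def altharm2_def using i i2 by (blast intro: zloc_sum)+
qed

text \<open>Induction along the three-term recurrence: its leading coefficient (n + 2)^2 is a unit
  as long as n + 2 < p, so it can be divided out without losing precision.\<close>

lemma legQ_pcong:
  "n < p \<Longrightarrow> pcong 3 (legQ n P) (1 + 2 * P * harm1 n + 2 * P ^ 2 * (harm1 n ^ 2 + altharm2 n))"
proof (induction n rule: induct_nat_012)
  case 0
  then show ?case by (simp add: legQ_def legW_def harm1_def altharm2_def)
next
  case 1
  have "legQ 1 P = 1 + 2 * P"
    using legW_of_nat[of _ 1] by (simp add: legQ_def)
  then show ?case by (simp add: harm1_def altharm2_def)
next
  case (ge2 n)
  let ?h = "harm1 (Suc n)" and ?A = "altharm2 (Suc n)" and ?n = "of_nat n :: rat"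
  define \<epsilon> :: rat where "\<epsilon> = (-1) ^ n"
  define R where "R n = 1 + 2 * P * harm1 n + 2 * P ^ 2 * (harm1 n ^ 2 + altharm2 n)" for n
  have nz: "?n + 1 \<noteq> 0" "?n + 2 \<noteq> 0"
    using of_nat_0_le_iff[of n, where 'a = rat] by linarith+
  have h: "?h = harm1 n + 1 / (?n + 1)" "harm1 (n + 2) = ?h + 1 / (?n + 2)"
    by (simp_all add: harm1_def add_ac)
  have A: "?A = altharm2 n - \<epsilon> / (?n + 1) ^ 2" "altharm2 (n + 2) = ?A + \<epsilon> / (?n + 2) ^ 2"
    by (simp_all add: altharm2_def add_ac \<epsilon>_def)
  have 1: "(?n + 2) * harm1 (n + 2) = (?n + 2) * ?h + 1" "(?n + 1) * harm1 n = (?n + 1) * ?h - 1"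
    unfolding h using nz by (simp_all only: distrib_left) simp_all
  have 2: "(?n + 2) ^ 2 * altharm2 (n + 2) = (?n + 2) ^ 2 * ?A + \<epsilon>"
    "(?n + 1) ^ 2 * altharm2 n = (?n + 1) ^ 2 * ?A + \<epsilon>"
    unfolding A using nz by (simp_all only: distrib_left right_diff_distrib) simp_all
  have "(?n + 2) ^ 2 * R (n + 2) = (2 * ?n + 3) * (2 * P + 1) * R (Suc n) + (?n + 1) ^ 2 * R n
      - P ^ 3 * (4 * (2 * ?n + 3) * (?h ^ 2 + ?A))"
    unfolding R_def by (rule legQ_expansion_rec[OF 1 2])
  then have R: "pcong 3 ((?n + 2) ^ 2 * R (n + 2)) ((2 * ?n + 3) * (2 * P + 1) * R (Suc n) + (?n + 1) ^ 2 * R n)"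
    using harm_zloc[of "Suc n"] ge2.prems
    by (intro pcongI[where c = "- (4 * (2 * ?n + 3) * (?h ^ 2 + ?A))"])
      (auto intro!: zloc_add zloc_mult zloc_minus zloc_power)
  have "of_nat (n + 2) ^ 2 * legQ (n + 2) P =
      of_nat (2 * n + 3) * (2 * P + 1) * legQ (n + 1) P + of_nat (n + 1) ^ 2 * legQ n P"
    by (rule legQ_rec)
  then have "(?n + 2) ^ 2 * legQ (n + 2) P = (2 * ?n + 3) * (2 * P + 1) * legQ (Suc n) P + (?n + 1) ^ 2 * legQ n P"
    by (simp add: add.commute)
  moreover have "pcong 3 ((2 * ?n + 3) * (2 * P + 1) * legQ (Suc n) P + (?n + 1) ^ 2 * legQ n P)
      ((2 * ?n + 3) * (2 * P + 1) * R (Suc n) + (?n + 1) ^ 2 * R n)"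
  proof (intro pcong_add pcong_mult_left)
    show "pcong 3 (legQ (Suc n) P) (R (Suc n))" "pcong 3 (legQ n P) (R n)"
      using ge2.IH ge2.prems by (simp_all add: R_def)
  qed (intro zloc_mult zloc_add zloc_power zloc_of_nat zloc_numeral)+
  ultimately have "pcong 3 ((?n + 2) ^ 2 * legQ (n + 2) P) ((?n + 2) ^ 2 * R (n + 2))"
    using pcong_trans[OF _ pcong_sym[OF R]] by simp
  then have "pcong 3 (legQ (n + 2) P) (R (n + 2))"
  proof (rule pcong_cancel)
    show "1 / (?n + 2) ^ 2 \<in> zloc p"
    using zloc_power[OF zloc_inverse_less, of "n + 2" 2] ge2.prems by (simp add: power_divide add.commute)
  qed (use nz in simp)
  then show ?case
    by (simp add: R_def)
qed

end

section \<open>Harmonic sums and interpolation\<close>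

locale local_ring_gt3 = local_ring +
  assumes p_gt_3: "p > 3"

context local_ring
begin

lemma pcong_inverse:
  assumes "pcong k a b" "1 / a \<in> zloc p" "1 / b \<in> zloc p" "a \<noteq> 0" "b \<noteq> 0"
  shows "pcong k (1 / a) (1 / b)"
proof -
  obtain c where c: "c \<in> zloc p" "a = b + P ^ k * c"
    using assms(1) by (rule pcongE)
  have "1 / a - 1 / b = (b - a) * (1 / a) * (1 / b)"
    using assms by (simp add: field_simps)
  also have "b - a = P ^ k * (- c)"
    using c by simp
  finally have "1 / a = 1 / b + P ^ k * (- c * (1 / a) * (1 / b))"
    by (simp add: algebra_simps)
  then show ?thesis
    by (rule pcongI) (intro zloc_mult zloc_minus c assms)
qed

lemma zloc_inverse_power:
  assumes "\<not> p dvd i"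
  shows "1 / of_nat i ^ n \<in> zloc p"
  using zloc_power[OF zloc_inverse_nat[OF assms], of n] by (simp add: power_divide)

lemma pcong_times_P:
  assumes "pcong k a b" "l = j + k"
  shows "pcong l (P ^ j * a) (P ^ j * b)"
  using assms pcong_shift by simp

lemma pcong_scaled_0D:
  assumes "pcong k (of_nat c * h) 0" "\<not> p dvd c"
  shows "pcong k h 0"
proof (rule pcong_cancel)
  show "pcong k (of_nat c * h) (of_nat c * 0)"
    using assms by simp
  show "of_nat c \<noteq> (0 :: rat)"
    using assms(2) by (metis dvd_0_right of_nat_eq_0_iff)
  show "1 / of_nat c \<in> zloc p"
    using assms(2) by (rule zloc_inverse_nat)
qed

lemma harm_Suc:
  "harm1 (Suc n) = harm1 n + 1 / of_nat (Suc n)"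
  "harm2 (Suc n) = harm2 n + 1 / of_nat (Suc n) ^ 2"
  "altharm2 (Suc n) = altharm2 n + (-1) ^ Suc n / of_nat (Suc n) ^ 2"
  by (simp_all add: harm1_def harm2_def altharm2_def)

lemma harm_0: "harm1 0 = 0" "harm2 0 = 0" "altharm2 0 = 0"
  by (simp_all add: harm1_def harm2_def altharm2_def)

text \<open>The first-order Taylor expansion at \<open>a\<close>, valid because a quadratic term
  would carry P^2. Stated as a property closed under sums and products, it needs no derivatives: the
  slope \<open>c\<close> is only asserted to exist.\<close>

definition affine_mod :: "rat \<Rightarrow> (rat \<Rightarrow> rat) \<Rightarrow> bool" where
  "affine_mod a f \<longleftrightarrow> (\<forall>t\<in>zloc p. f (a + P * t) \<in> zloc p) \<and>
     (\<exists>c\<in>zloc p. \<forall>t\<in>zloc p. pcong 2 (f (a + P * t)) (f a + P * t * c))"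

lemma affine_mod_const: "c \<in> zloc p \<Longrightarrow> affine_mod a (\<lambda>_. c)"
  unfolding affine_mod_def by (auto intro!: bexI[of _ 0])

lemma affine_mod_ident: "a \<in> zloc p \<Longrightarrow> affine_mod a (\<lambda>x. x)"
  unfolding affine_mod_def by (auto intro!: bexI[of _ 1])

lemma affine_mod_add:
  assumes "affine_mod a f" "affine_mod a g"
  shows "affine_mod a (\<lambda>x. f x + g x)"
proof -
  obtain c d where c: "c \<in> zloc p" "\<And>t. t \<in> zloc p \<Longrightarrow> pcong 2 (f (a + P * t)) (f a + P * t * c)"
    and d: "d \<in> zloc p" "\<And>t. t \<in> zloc p \<Longrightarrow> pcong 2 (g (a + P * t)) (g a + P * t * d)"
    using assms unfolding affine_mod_def by blast
  have "pcong 2 (f (a + P * t) + g (a + P * t)) (f a + g a + P * t * (c + d))" if "t \<in> zloc p" for t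
    using pcong_add[OF c(2)[OF that] d(2)[OF that]] by (simp add: algebra_simps)
  then show ?thesis
    using assms c(1) d(1) unfolding affine_mod_def by (blast intro: zloc_add)
qed

lemma affine_mod_mult:
  assumes "affine_mod a f" "affine_mod a g"
  shows "affine_mod a (\<lambda>x. f x * g x)"
proof -
  obtain c d where c: "c \<in> zloc p" "\<And>t. t \<in> zloc p \<Longrightarrow> pcong 2 (f (a + P * t)) (f a + P * t * c)"
    and d: "d \<in> zloc p" "\<And>t. t \<in> zloc p \<Longrightarrow> pcong 2 (g (a + P * t)) (g a + P * t * d)"
    using assms unfolding affine_mod_def by blast
  have "f (a + P * 0) \<in> zloc p" "g (a + P * 0) \<in> zloc p"
    using assms zloc_numeral unfolding affine_mod_def by blast+
  then have fg: "f a \<in> zloc p" "g a \<in> zloc p"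
    by simp_all
  have "pcong 2 (f (a + P * t) * g (a + P * t)) (f a * g a + P * t * (f a * d + c * g a))"
    if "t \<in> zloc p" for t
  proof -
    have "pcong 2 (f (a + P * t) * g (a + P * t)) ((f a + P * t * c) * (g a + P * t * d))"
      using c d fg that by (intro pcong_mult) auto
    also have "pcong 2 \<dots> (f a * g a + P * t * (f a * d + c * g a))"
      using c d that
      by (intro pcongI[where c = "t * t * c * d"]) (simp add: algebra_simps power2_eq_square, auto)
    finally show ?thesis .
  qed
  moreover have "f a * d + c * g a \<in> zloc p"
    using c d fg by auto
  ultimately show ?thesis
    using assms unfolding affine_mod_def by (blast intro: zloc_mult)
qed

lemma affine_mod_sum:
  "(\<And>i. i \<in> I \<Longrightarrow> affine_mod a (f i)) \<Longrightarrow> affine_mod a (\<lambda>x. \<Sum>i\<in>I. f i x)"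
  by (induction I rule: infinite_finite_induct) (auto intro: affine_mod_const affine_mod_add)

lemma affine_mod_prod:
  "(\<And>i. i \<in> I \<Longrightarrow> affine_mod a (f i)) \<Longrightarrow> affine_mod a (\<lambda>x. \<Prod>i\<in>I. f i x)"
  by (induction I rule: infinite_finite_induct) (auto intro: affine_mod_const affine_mod_mult)

text \<open>Two values determine an affine function. The second one is taken at
  \<open>a - P\<close>, that is at t = -1, since this is the point that the reflection makes
  accessible.\<close>

lemma affine_mod_interpolate:
  assumes "affine_mod a f" "t \<in> zloc p"
  shows "pcong 2 (f (a + P * t)) (f a + t * (f a - f (a - P)))"
proof -
  obtain c where c: "c \<in> zloc p" "\<And>t. t \<in> zloc p \<Longrightarrow> pcong 2 (f (a + P * t)) (f a + P * t * c)"
    using assms unfolding affine_mod_def by blast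
  have "pcong 2 (f (a + P * (- 1))) (f a + P * (- 1) * c)"
    by (rule c) auto
  then have "pcong 2 (f a - f (a - P)) (f a - (f a - P * c))"
    by (intro pcong_diff) simp_all
  then have "pcong 2 (f a + t * (f a - f (a - P))) (f a + t * (f a - (f a - P * c)))"
    using assms(2) by (intro pcong_add pcong_mult_left) auto
  also have "f a + t * (f a - (f a - P * c)) = f a + P * t * c"
    by (simp add: algebra_simps)
  finally show ?thesis
    using c(2)[OF assms(2)] pcong_sym pcong_trans by blast
qed

lemma affine_mod_legW:
  assumes "a \<in> zloc p" "k < p"
  shows "affine_mod a (legW k)"
proof -
  have "\<not> p dvd fact k"
    using assms prime_p by (simp add: prime_dvd_fact_iff)
  then have "1 / of_nat (fact k) ^ 2 \<in> zloc p"
    by (rule zloc_inverse_power)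
  then have "affine_mod a (\<lambda>x. (\<Prod>i=0..<k. (-1 * (x + - of_nat i)) * (- of_nat (Suc i) + -1 * x)) *
      (1 / of_nat (fact k) ^ 2))"
    using assms by (intro affine_mod_mult affine_mod_prod affine_mod_add affine_mod_const affine_mod_ident) auto
  moreover have "legW k = (\<lambda>x. (\<Prod>i=0..<k. (-1 * (x + - of_nat i)) * (- of_nat (Suc i) + -1 * x)) *
      (1 / of_nat (fact k) ^ 2))"
    unfolding legW_prod[abs_def] fun_eq_iff by (simp add: algebra_simps)
  ultimately show ?thesis
    by simp
qed

text \<open>The term \<open>k = p\<close> left out here is the only one with a denominator divisible by \<open>p\<close>.\<close>

definition truncG :: "rat \<Rightarrow> rat" where
  "truncG x = (\<Sum>k=0..p - 1. of_nat (p choose k) * legW k x)"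

lemma G_truncG: "G p x = truncG x + legW p x"
proof -
  have "{0..p} = insert p {0..p - 1}" "p \<notin> {0..p - 1}"
    using prime_gt_1_nat[OF prime_p] by auto
  then show ?thesis
    unfolding G_legW truncG_def by simp
qed

lemma truncG_reflect: "truncG (-1 - x) = truncG x"
  by (simp add: truncG_def legW_reflect)

lemma truncG_of_nat:
  assumes "n < p"
  shows "truncG (of_nat n) = legQ n P"
proof -
  have "n \<le> p - 1"
    using assms by simp
  from legQ_extend[OF this, of P] show ?thesis
    unfolding truncG_def by (simp add: binomial_gbinomial atLeast0AtMost)
qed

lemma truncG_interpolate:
  assumes "a \<in> zloc p" "t \<in> zloc p"
  shows "pcong 3 (truncG (a + P * t)) (truncG a + t * (truncG a - truncG (a - P)))"
proof -
  define f where "f x = (\<Sum>k=1..p - 1. of_nat ((p choose k) div p) * legW k x)" for x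
  have S: "truncG x = 1 + P * f x" for x
  proof -
    have "{0..p - 1} = insert 0 {1..p - 1}"
      by auto
    then have "truncG x = 1 + (\<Sum>k=1..p - 1. of_nat (p choose k) * legW k x)"
      by (simp add: truncG_def legW_def)
    also have "(\<Sum>k=1..p - 1. of_nat (p choose k) * legW k x) = P * f x"
      unfolding f_def sum_distrib_left
    proof (intro sum.cong refl)
      fix k assume "k \<in> {1..p - 1}"
      then have "p dvd p choose k"
        using prime_p by (intro dvd_choose_prime) auto
      then have "p choose k = p * ((p choose k) div p)"
        by simp
      then have "(of_nat (p choose k) :: rat) = P * of_nat ((p choose k) div p)"
        by (metis of_nat_mult)
      then show "of_nat (p choose k) * legW k x = P * (of_nat ((p choose k) div p) * legW k x)"
        by simp
    qed
    finally show ?thesis .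
  qed
  have "affine_mod a f"
    unfolding f_def[abs_def] using assms p_pos
    by (intro affine_mod_sum affine_mod_mult affine_mod_const affine_mod_legW) auto
  then have "pcong 2 (f (a + P * t)) (f a + t * (f a - f (a - P)))"
    using assms(2) by (rule affine_mod_interpolate)
  then have "pcong 3 (P ^ 1 * f (a + P * t)) (P ^ 1 * (f a + t * (f a - f (a - P))))"
    by (rule pcong_times_P) simp
  then have "pcong 3 (1 + P * f (a + P * t)) (1 + P * (f a + t * (f a - f (a - P))))"
    by (intro pcong_add) simp_all
  then show ?thesis
    unfolding S by (simp add: algebra_simps)
qed

end

section \<open>Wolstenholme-type congruences and the reflection of harmonic sums\<close>

context local_ring_gt3
begin

lemma odd_p: "odd p"
  using prime_p p_gt_3 prime_odd_nat by auto

lemma not_dvd_2_3: "\<not> p dvd 2" "\<not> p dvd 3"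
  using p_gt_3 by (auto dest: dvd_imp_le)

text \<open>Doubling permutes the nonzero residues, so modulo p the sum equals a quarter of itself;
  three times the sum is then 0, and 3 is invertible.\<close>

lemma harm2_pcong_0: "pcong 1 (harm2 (p - 1)) 0"
proof -
  define \<sigma> where "\<sigma> i = 2 * i mod p" for i
  have nd: "\<not> p dvd i" if "i \<in> {1..p - 1}" for i
    using that by (intro not_dvd_less) auto
  have sub: "\<sigma> ` {1..p - 1} \<subseteq> {1..p - 1}"
  proof
    fix j assume "j \<in> \<sigma> ` {1..p - 1}"
    then obtain i where i: "i \<in> {1..p - 1}" "j = 2 * i mod p"
      by (auto simp: \<sigma>_def)
    then have "\<not> p dvd 2 * i"
      using nd[OF i(1)] not_dvd_2_3(1) prime_dvd_mult_iff[OF prime_p] by blast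
    then have "j \<noteq> 0"
      using i by (simp add: dvd_eq_mod_eq_0)
    moreover have "j < p"
      using i p_pos by simp
    ultimately show "j \<in> {1..p - 1}"
      by auto
  qed
  have "inj_on \<sigma> {1..p - 1}"
  proof (rule inj_onI)
    fix i j assume ij: "i \<in> {1..p - 1}" "j \<in> {1..p - 1}" "\<sigma> i = \<sigma> j"
    have "coprime 2 p"
      using odd_p by simp
    then have "[i = j] (mod p)"
      using ij(3) unfolding \<sigma>_def by (simp add: cong_def[symmetric] cong_mult_lcancel_nat)
    then show "i = j"
      using ij by (intro cong_less_modulus_unique_nat) auto
  qed
  then have bij: "bij_betw \<sigma> {1..p - 1} {1..p - 1}"
    using endo_inj_surj[OF finite_atLeastAtMost sub] by (simp add: bij_betw_def)
  have *: "pcong 1 (1 / of_nat (\<sigma> i) ^ 2) (1 / of_nat (2 * i) ^ 2)" if "i \<in> {1..p - 1}" for i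
  proof -
    have "\<sigma> i \<in> {1..p - 1}"
      using sub that by blast
    then have nd': "\<not> p dvd \<sigma> i" "\<not> p dvd 2 * i"
      using nd that not_dvd_2_3(1) prime_dvd_mult_iff[OF prime_p] by blast+
    then have "\<sigma> i \<noteq> 0" "2 * i \<noteq> 0"
      by (metis dvd_0_right)+
    have "pcong 1 (of_nat (\<sigma> i)) (of_nat (2 * i))"
      by (rule pcong_of_nat) (simp add: \<sigma>_def cong_def)
    then have "pcong 1 (of_nat (\<sigma> i) ^ 2) (of_nat (2 * i) ^ 2)"
      by (intro pcong_power) auto
    then show ?thesis
      using nd' \<open>\<sigma> i \<noteq> 0\<close> \<open>2 * i \<noteq> 0\<close> by (intro pcong_inverse zloc_inverse_power) auto
  qed
  have "harm2 (p - 1) = (\<Sum>i=1..p - 1. 1 / of_nat (\<sigma> i) ^ 2)"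
    unfolding harm2_def by (rule sum.reindex_bij_betw[OF bij, symmetric])
  then have "pcong 1 (harm2 (p - 1)) (\<Sum>i=1..p - 1. 1 / of_nat (2 * i) ^ 2)"
    using * by (simp only:) (rule pcong_sum)
  also have "(\<Sum>i=1..p - 1. 1 / of_nat (2 * i) ^ 2) = harm2 (p - 1) / 4"
    unfolding harm2_def sum_divide_distrib by (intro sum.cong) (auto simp: power_mult_distrib)
  finally have "pcong 1 (4 * harm2 (p - 1)) (4 * (harm2 (p - 1) / 4))"
    by (rule pcong_mult_left) auto
  then have "pcong 1 (4 * harm2 (p - 1) - harm2 (p - 1)) (harm2 (p - 1) - harm2 (p - 1))"
    by (intro pcong_diff) simp_all
  then have "pcong 1 (of_nat 3 * harm2 (p - 1)) 0"
    by simp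
  then show ?thesis
    using not_dvd_2_3(2) by (rule pcong_scaled_0D)
qed

text \<open>The geometric series 1/(p - j) = - (1/j) (1 + p/j + ...), cut off at p^2 or at p. In the
  alternating version the minus sign comes from p being odd.\<close>

lemma
  assumes "0 < j" "j < p"
  shows inverse_reflect: "pcong 2 (1 / of_nat (p - j)) (- (1 / of_nat j + P * (1 / of_nat j ^ 2)))"
    and inverse_reflect_1: "pcong 1 (1 / of_nat (p - j)) (- (1 / of_nat j))"
    and alt_inverse_reflect: "pcong 1 ((-1) ^ (p - j) / of_nat (p - j) ^ 2) (- ((-1) ^ j / of_nat j ^ 2))"
proof -
  have Pj: "of_nat (p - j) = P - of_nat j"
    using assms by (simp add: of_nat_diff)
  have nz: "P - of_nat j \<noteq> 0" "of_nat j \<noteq> (0 :: rat)"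
    using assms by simp_all
  have nd: "\<not> p dvd j" "\<not> p dvd (p - j)"
    using assms by (intro not_dvd_less; simp)+
  note z = zloc_inverse_nat[OF nd(1)] zloc_inverse_nat[OF nd(2)] zloc_inverse_power[OF nd(1), of 2]
  have "1 / (P - of_nat j) = - (1 / of_nat j + P * (1 / of_nat j ^ 2)) + P ^ 2 * (1 / of_nat j ^ 2 * (1 / (P - of_nat j)))"
    using nz by (simp add: field_simps power2_eq_square)
  then show 2: "pcong 2 (1 / of_nat (p - j)) (- (1 / of_nat j + P * (1 / of_nat j ^ 2)))"
    unfolding Pj[symmetric] by (rule pcongI) (intro zloc_mult z)
  have "pcong 1 (1 / of_nat (p - j)) (- (1 / of_nat j + P * (1 / of_nat j ^ 2)))"
    using 2 by (rule pcong_mono) simp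
  also have "pcong 1 (- (1 / of_nat j + P * (1 / of_nat j ^ 2))) (- (1 / of_nat j))"
    by (rule pcongI[where c = "- (1 / of_nat j ^ 2)"]) (simp, intro zloc_minus z)
  finally show 1: "pcong 1 (1 / of_nat (p - j)) (- (1 / of_nat j))" .
  have sgn: "(-1) ^ (p - j) = - ((-1) ^ j :: rat)"
    using odd_p assms by (cases "even j") simp_all
  have "pcong 1 ((1 / of_nat (p - j)) ^ 2) ((- (1 / of_nat j)) ^ 2)"
    using 1 z by (intro pcong_power zloc_minus)
  then have "pcong 1 (- ((-1) ^ j) * (1 / of_nat (p - j)) ^ 2) (- ((-1) ^ j) * (- (1 / of_nat j)) ^ 2)"
    by (rule pcong_mult_left) (intro zloc_minus zloc_power zloc_numeral)
  then show "pcong 1 ((-1) ^ (p - j) / of_nat (p - j) ^ 2) (- ((-1) ^ j / of_nat j ^ 2))"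
    unfolding sgn by (simp add: power_divide)
qed

text \<open>Wolstenholme's congruence. Adding the terms for i and p - i pulls out one factor p; what
  remains is - \<open>harm2 (p - 1)\<close> modulo p, which supplies the second.\<close>

lemma harm1_pcong_0: "pcong 2 (harm1 (p - 1)) 0"
proof -
  have "2 * harm1 (p - 1) = (\<Sum>i=1..p - 1. 1 / of_nat i) + (\<Sum>i=1..p - 1. 1 / of_nat (p - 1 + 1 - i))"
    unfolding harm1_def by (subst sum.atLeastAtMost_rev[symmetric]) simp
  also have "\<dots> = (\<Sum>i=1..p - 1. P * (1 / of_nat i * (1 / of_nat (p - i))))"
    unfolding sum.distrib[symmetric]
  proof (intro sum.cong refl)
    fix i assume "i \<in> {1..p - 1}"
    then have "0 < i" "i < p"
      by auto
    then have "of_nat (p - i) = P - of_nat i" "P - of_nat i \<noteq> 0"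
      by (simp_all add: of_nat_diff)
    then show "1 / of_nat i + 1 / of_nat (p - 1 + 1 - i) = P * (1 / of_nat i * (1 / of_nat (p - i)))"
      using \<open>0 < i\<close> p_pos by (simp add: field_simps)
  qed
  finally have *: "2 * harm1 (p - 1) = P ^ 1 * (\<Sum>i=1..p - 1. 1 / of_nat i * (1 / of_nat (p - i)))"
    by (simp add: sum_distrib_left)
  have "pcong 1 (\<Sum>i=1..p - 1. 1 / of_nat i * (1 / of_nat (p - i))) (\<Sum>i=1..p - 1. 1 / of_nat i * (- (1 / of_nat i)))"
  proof (intro pcong_sum pcong_mult_left)
    fix i assume "i \<in> {1..p - 1}"
    then have "0 < i" "i < p"
      by auto
    then show "pcong 1 (1 / of_nat (p - i)) (- (1 / of_nat i))" "1 / of_nat i \<in> zloc p"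
      by (rule inverse_reflect_1, intro zloc_inverse_less)
  qed
  also have "(\<Sum>i=1..p - 1. 1 / of_nat i * (- (1 / of_nat i))) = - harm2 (p - 1)"
    by (simp add: harm2_def sum_negf power2_eq_square)
  also have "pcong 1 (- harm2 (p - 1)) (- 0)"
    using harm2_pcong_0 by (rule pcong_minus)
  finally have "pcong 2 (2 * harm1 (p - 1)) (P ^ 1 * (- 0))"
    unfolding * by (rule pcong_times_P) simp
  then have "pcong 2 (of_nat 2 * harm1 (p - 1)) 0"
    by simp
  then show ?thesis
    using not_dvd_2_3(1) by (rule pcong_scaled_0D)
qed

text \<open>Starting from Wolstenholme's congruence at a = 0, the terms 1/(p - j) are taken off the
  top one by one; their second-order parts p/j^2 accumulate to \<open>P * harm2 a\<close>.\<close>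

lemma harm1_reflect: "a < p \<Longrightarrow> pcong 2 (harm1 (p - 1 - a)) (harm1 a + P * harm2 a)"
proof (induction a)
  case 0
  then show ?case using harm1_pcong_0 by (simp add: harm_0)
next
  case (Suc a)
  have "p - 1 - a = Suc (p - 1 - Suc a)" "Suc (p - 1 - Suc a) = p - Suc a"
    using Suc.prems by auto
  then have "harm1 (p - 1 - Suc a) = harm1 (p - 1 - a) - 1 / of_nat (p - Suc a)"
    using harm_Suc(1)[of "p - 1 - Suc a"] by simp
  also have "pcong 2 \<dots> (harm1 a + P * harm2 a - - (1 / of_nat (Suc a) + P * (1 / of_nat (Suc a) ^ 2)))"
    using Suc by (intro pcong_diff inverse_reflect) auto
  also have "\<dots> = harm1 (Suc a) + P * harm2 (Suc a)"
    unfolding harm_Suc by (simp only: algebra_simps minus_minus diff_minus_eq_add)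
  finally show ?case .
qed

text \<open>As p is odd, i and p - i have opposite parity, so modulo p the reversed sum is the
  negative of the sum.\<close>

lemma altharm2_pcong_0: "pcong 1 (altharm2 (p - 1)) 0"
proof -
  have "altharm2 (p - 1) = (\<Sum>i=1..p - 1. (-1) ^ (p - i) / of_nat (p - i) ^ 2)"
    unfolding altharm2_def using p_pos by (subst sum.atLeastAtMost_rev) simp
  moreover have "pcong 1 \<dots> (\<Sum>i=1..p - 1. - ((-1) ^ i / of_nat i ^ 2))"
    by (intro pcong_sum alt_inverse_reflect) auto
  ultimately have "pcong 1 (altharm2 (p - 1)) (- altharm2 (p - 1))"
    by (simp add: altharm2_def sum_negf)
  then have "pcong 1 (altharm2 (p - 1) + altharm2 (p - 1)) (- altharm2 (p - 1) + altharm2 (p - 1))"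
    by (intro pcong_add) simp_all
  then have "pcong 1 (of_nat 2 * altharm2 (p - 1)) 0"
    by simp
  then show ?thesis
    using not_dvd_2_3(1) by (rule pcong_scaled_0D)
qed

lemma altharm2_reflect: "a < p \<Longrightarrow> pcong 1 (altharm2 (p - 1 - a)) (altharm2 a)"
proof (induction a)
  case 0
  then show ?case using altharm2_pcong_0 by (simp add: harm_0)
next
  case (Suc a)
  have "p - 1 - a = Suc (p - 1 - Suc a)" "Suc (p - 1 - Suc a) = p - Suc a"
    using Suc.prems by auto
  then have "altharm2 (p - 1 - Suc a) = altharm2 (p - 1 - a) - (-1) ^ (p - Suc a) / of_nat (p - Suc a) ^ 2"
    using harm_Suc(3)[of "p - 1 - Suc a"] by simp
  moreover have "pcong 1 \<dots> (altharm2 a - - ((-1) ^ Suc a / of_nat (Suc a) ^ 2))"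
    using Suc by (intro pcong_diff alt_inverse_reflect) auto
  ultimately show ?case
    by (simp only: harm_Suc diff_minus_eq_add)
qed

text \<open>Modulo \<open>p ^ 3\<close> the function \<open>t \<mapsto> truncG (a + P * t)\<close> is affine, and it is known at \<open>t = 0\<close>
  and, by the reflection \<open>x \<mapsto> -1 - x\<close>, at \<open>t = -1\<close>.\<close>

lemma truncG_pcong:
  assumes a: "a < p" and t: "t \<in> zloc p"
  shows "pcong 3 (truncG (of_nat a + P * t))
    (1 + 2 * P * (harm1 a - P * t * harm2 a) + 2 * P ^ 2 * (harm1 a ^ 2 + altharm2 a))"
proof -
  define R where "R = 1 + 2 * P * harm1 a + 2 * P ^ 2 * (harm1 a ^ 2 + altharm2 a)"
  have R: "pcong 3 (truncG (of_nat a)) R"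
    unfolding truncG_of_nat[OF a] R_def by (rule legQ_pcong[OF a])
  let ?b = "p - 1 - a"
  have b: "?b < p"
    using p_pos by simp
  have "of_nat ?b = -1 - (of_nat a - P)"
    using a by (simp add: of_nat_diff)
  then have "truncG (of_nat a - P) = legQ ?b P"
    using truncG_reflect[of "of_nat a - P"] truncG_of_nat[OF b] by simp
  also have "pcong 3 (legQ ?b P) (1 + 2 * P * harm1 ?b + 2 * P ^ 2 * (harm1 ?b ^ 2 + altharm2 ?b))"
    by (rule legQ_pcong[OF b])
  also have "pcong 3 \<dots> (1 + 2 * P * (harm1 a + P * harm2 a) + 2 * P ^ 2 * (harm1 a ^ 2 + altharm2 a))"
  proof -
    note z = harm_zloc[OF a] harm_zloc[OF b]
    have "pcong 3 (P ^ 1 * harm1 ?b) (P ^ 1 * (harm1 a + P * harm2 a))"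
      by (rule pcong_times_P[OF harm1_reflect[OF a]]) simp
    then have "pcong 3 (2 * (P ^ 1 * harm1 ?b)) (2 * (P ^ 1 * (harm1 a + P * harm2 a)))"
      by (rule pcong_mult_left) simp
    then have 1: "pcong 3 (2 * (P * harm1 ?b)) (2 * (P * (harm1 a + P * harm2 a)))"
      by (simp only: power_one_right)
    have "pcong 1 (harm1 ?b) (harm1 a + P * harm2 a)"
      using harm1_reflect[OF a] by (rule pcong_mono) simp
    also have "pcong 1 \<dots> (harm1 a)"
      by (rule pcongI[where c = "harm2 a"]) (simp, rule z)
    finally have "pcong 1 (harm1 ?b ^ 2 + altharm2 ?b) (harm1 a ^ 2 + altharm2 a)"
      using altharm2_reflect[OF a] z by (intro pcong_add pcong_power) auto
    then have "pcong 3 (P ^ 2 * (harm1 ?b ^ 2 + altharm2 ?b)) (P ^ 2 * (harm1 a ^ 2 + altharm2 a))"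
      by (rule pcong_times_P) simp
    then have 2: "pcong 3 (2 * (P ^ 2 * (harm1 ?b ^ 2 + altharm2 ?b))) (2 * (P ^ 2 * (harm1 a ^ 2 + altharm2 a)))"
      by (rule pcong_mult_left) simp
    show ?thesis
      using pcong_add[OF pcong_add[OF pcong_refl[of 3 1] 1] 2] by (simp only: mult.assoc)
  qed
  also have "1 + 2 * P * (harm1 a + P * harm2 a) + 2 * P ^ 2 * (harm1 a ^ 2 + altharm2 a) = R + 2 * P ^ 2 * harm2 a"
    by (simp add: R_def algebra_simps power2_eq_square)
  finally have R': "pcong 3 (truncG (of_nat a - P)) (R + 2 * P ^ 2 * harm2 a)" .
  have "pcong 3 (truncG (of_nat a + P * t)) (truncG (of_nat a) + t * (truncG (of_nat a) - truncG (of_nat a - P)))"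
    using t by (intro truncG_interpolate) auto
  also have "pcong 3 \<dots> (R + t * (R - (R + 2 * P ^ 2 * harm2 a)))"
    using R R' t by (intro pcong_add pcong_mult_left pcong_diff)
  also have "R + t * (R - (R + 2 * P ^ 2 * harm2 a)) =
      1 + 2 * P * (harm1 a - P * t * harm2 a) + 2 * P ^ 2 * (harm1 a ^ 2 + altharm2 a)"
    by (simp add: R_def algebra_simps power2_eq_square)
  finally show ?thesis .
qed

end

section \<open>Bernoulli and Euler polynomials\<close>

definition egf :: "(nat \<Rightarrow> rat) \<Rightarrow> rat fps" where
  "egf f = Abs_fps (\<lambda>n. f n / fact n)"

lemma egf_inject: "egf f = egf g \<longleftrightarrow> f = g"
  by (auto simp: egf_def fps_eq_iff)

lemma egf_add: "egf f + egf g = egf (\<lambda>n. f n + g n)"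
  by (simp add: egf_def fps_eq_iff add_divide_distrib)

lemma egf_diff: "egf f - egf g = egf (\<lambda>n. f n - g n)"
  by (simp add: egf_def fps_eq_iff diff_divide_distrib)

lemma egf_cmult: "fps_const c * egf f = egf (\<lambda>n. c * f n)"
  by (simp add: egf_def fps_eq_iff)

lemma egf_sum: "(\<Sum>i\<in>I. egf (f i)) = egf (\<lambda>n. \<Sum>i\<in>I. f i n)"
  by (simp add: egf_def fps_eq_iff fps_sum_nth sum_divide_distrib)

lemma egf_mult: "egf f * egf g = egf (\<lambda>n. \<Sum>k=0..n. of_nat (n choose k) * f k * g (n - k))"
  unfolding fps_eq_iff
proof
  fix n
  have "f k / fact k * (g (n - k) / fact (n - k)) = of_nat (n choose k) * f k * g (n - k) / fact n"
    if "k \<in> {0..n}" for k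
    using that by (simp add: binomial_fact)
  then show "fps_nth (egf f * egf g) n = fps_nth (egf (\<lambda>n. \<Sum>k=0..n. of_nat (n choose k) * f k * g (n - k))) n"
    by (simp add: egf_def fps_mult_nth sum_divide_distrib)
qed

lemma fps_exp_egf: "fps_exp c = egf (\<lambda>n. c ^ n)"
  by (simp add: egf_def fps_eq_iff)

lemma one_egf: "1 = egf (\<lambda>n. if n = 0 then 1 else 0)"
  by (simp add: egf_def fps_eq_iff)

lemma fps_X_egf: "fps_X = egf (\<lambda>n. if n = 1 then 1 else 0)"
  by (simp add: egf_def fps_eq_iff fps_X_def)

lemma fps_X_mult_egf: "fps_X * egf f = egf (\<lambda>n. of_nat n * f (n - 1))"
  unfolding fps_eq_iff
proof
  fix n
  show "fps_nth (fps_X * egf f) n = fps_nth (egf (\<lambda>n. of_nat n * f (n - 1))) n"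
    by (cases n) (simp_all add: egf_def del: of_nat_Suc)
qed

lemma egf_scale: "egf f oo (fps_const c * fps_X) = egf (\<lambda>n. c ^ n * f n)"
  by (simp add: egf_def fps_compose_linear fps_eq_iff)

lemmas fps_scale_distribs =
  fps_compose_mult_distrib[where c = "fps_const c * fps_X" for c]
  fps_compose_add_distrib[where c = "fps_const c * fps_X" for c]
  fps_compose_sub_distrib[where c = "fps_const c * fps_X" for c]

lemma egf_bernoulli: "egf bernoulli * (fps_exp 1 - 1) = fps_X"
proof -
  have "(\<Sum>k=0..n. of_nat (n choose k) * bernoulli k * (1 ^ (n - k) - (if n - k = 0 then 1 else 0)))
      = (if n = 1 then 1 else 0)" for n
  proof (cases n)
    case (Suc m)
    have "(\<Sum>k=0..n. of_nat (n choose k) * bernoulli k * (1 ^ (n - k) - (if n - k = 0 then 1 else 0)))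
      = (\<Sum>k=0..m. of_nat (n choose k) * bernoulli k)"
      unfolding Suc by (simp add: sum.atLeast0_atMost_Suc)
    also have "\<dots> = (if n = 1 then 1 else 0)"
      using bernoulli_rec[of n] Suc by (cases "m = 0") (auto simp: bernoulli_0)
    finally show ?thesis .
  qed simp
  then show ?thesis
    by (simp only: fps_exp_egf one_egf fps_X_egf egf_diff egf_mult)
qed

lemma egf_bernpoly: "egf (\<lambda>n. bernpoly n x) = egf bernoulli * fps_exp x"
  by (simp only: fps_exp_egf egf_mult bernpoly_def)

lemma fps_exp_minus_1_nonzero: "c \<noteq> 0 \<Longrightarrow> fps_exp c - (1 :: rat fps) \<noteq> 0"
  by simp

lemma bernpoly_add_one: "bernpoly n (x + 1) - bernpoly n x = of_nat n * x ^ (n - 1)"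
proof -
  have "egf (\<lambda>n. bernpoly n (x + 1)) - egf (\<lambda>n. bernpoly n x) =
      (egf bernoulli * (fps_exp 1 - 1)) * fps_exp x"
    unfolding egf_bernpoly fps_exp_add_mult by (simp add: algebra_simps)
  also have "\<dots> = egf (\<lambda>n. of_nat n * x ^ (n - 1))"
    unfolding egf_bernoulli by (simp only: fps_exp_egf fps_X_mult_egf)
  finally show ?thesis
    unfolding egf_diff egf_inject by meson
qed

text \<open>Replacing X by -X in the generating function X / (exp X - 1) multiplies it by exp
  X.\<close>

lemma bernpoly_reflect: "bernpoly n (1 - x) = (-1) ^ n * bernpoly n x"
proof -
  let ?B = "egf bernoulli" and ?c = "fps_const (-1) * fps_X :: rat fps"
  have "(?B * (fps_exp 1 - 1)) oo ?c = ?c"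
    unfolding egf_bernoulli by (simp add: fps_X_fps_compose_startby0)
  then have "(?B oo ?c) * (fps_exp (-1) - 1) = ?c"
    by (simp add: fps_scale_distribs)
  moreover have "?c = - fps_X"
    by (simp flip: fps_const_neg)
  ultimately have "(?B oo ?c) * (fps_exp (-1) - 1) = - fps_X"
    by simp
  moreover have "(fps_exp (-1) - 1) * fps_exp 1 = 1 - (fps_exp 1 :: rat fps)"
    by (simp add: left_diff_distrib fps_exp_add_mult[symmetric])
  ultimately have "(?B oo ?c) * (1 - fps_exp 1) = - fps_X * fps_exp 1"
    by (metis mult.assoc)
  then have "(?B oo ?c) * (fps_exp 1 - 1) = fps_X * fps_exp 1"
    by (simp add: right_diff_distrib algebra_simps)
  also have "\<dots> = (?B * fps_exp 1) * (fps_exp 1 - 1)"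
    unfolding egf_bernoulli[symmetric] by (simp add: algebra_simps)
  finally have B: "?B oo ?c = ?B * fps_exp 1"
    using fps_exp_minus_1_nonzero[of 1] by simp
  have "egf (\<lambda>n. (-1) ^ n * bernpoly n x) = (?B oo ?c) * fps_exp (- x)"
    unfolding egf_scale[symmetric] egf_bernpoly by (simp add: fps_scale_distribs)
  also have "\<dots> = egf (\<lambda>n. bernpoly n (1 - x))"
    unfolding B egf_bernpoly diff_conv_add_uminus fps_exp_add_mult by (simp add: mult.assoc)
  finally show ?thesis
    unfolding egf_inject by metis
qed

text \<open>After scaling the variable by m, the shifts by j/m become the powers exp(j X). Their
  geometric sum turns the denominator exp(m X) - 1 into exp X - 1.\<close>

lemma bernpoly_multiplication:
  assumes "m > 0"
  shows "(\<Sum>j<m. bernpoly n (of_nat j / of_nat m)) * of_nat m ^ n = of_nat m * bernoulli n"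
proof -
  let ?B = "egf bernoulli" and ?c = "fps_const (of_nat m) * fps_X :: rat fps"
  have "(?B * (fps_exp 1 - 1)) oo ?c = ?c"
    unfolding egf_bernoulli by (simp add: fps_X_fps_compose_startby0)
  then have Bm: "(?B oo ?c) * (fps_exp (of_nat m) - 1) = ?c"
    by (simp add: fps_scale_distribs)
  have j: "egf (\<lambda>n. of_nat m ^ n * bernpoly n (of_nat j / of_nat m)) = (?B oo ?c) * fps_exp 1 ^ j" for j
    unfolding egf_scale[symmetric] egf_bernpoly using assms
    by (simp add: fps_scale_distribs fps_exp_power_mult)
  have "(\<Sum>j<m. egf (\<lambda>n. of_nat m ^ n * bernpoly n (of_nat j / of_nat m))) * (fps_exp 1 - 1) =
      (?B oo ?c) * ((fps_exp 1 - 1) * (\<Sum>j<m. fps_exp 1 ^ j))"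
    unfolding j by (simp add: sum_distrib_left algebra_simps)
  also have "(fps_exp 1 - 1) * (\<Sum>j<m. fps_exp 1 ^ j) = fps_exp (of_nat m) - (1 :: rat fps)"
    by (simp only: power_diff_1_eq[symmetric]) (simp add: fps_exp_power_mult)
  also have "(?B oo ?c) * \<dots> = (fps_const (of_nat m) * ?B) * (fps_exp 1 - 1)"
    unfolding Bm using egf_bernoulli by (simp add: mult.assoc)
  finally have "(\<Sum>j<m. egf (\<lambda>n. of_nat m ^ n * bernpoly n (of_nat j / of_nat m))) = fps_const (of_nat m) * ?B"
    using fps_exp_minus_1_nonzero[of 1] by simp
  then have "(\<lambda>n. \<Sum>j<m. of_nat m ^ n * bernpoly n (of_nat j / of_nat m)) = (\<lambda>n. of_nat m * bernoulli n)"
    unfolding egf_sum egf_cmult egf_inject .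
  from fun_cong[OF this, of n] show ?thesis
    by (simp only: sum_distrib_left mult.commute[of _ "of_nat m ^ n"])
qed

text \<open>The recurrences of \<open>euler_num\<close> and \<open>U\<close> sum over even shifts
  only, which is multiplication by the hyperbolic cosine; this treats both at once. The generating
  functions are 1 / cosh X and 1 / (2 cosh X - 1).\<close>

lemma egf_even_times_cosh:
  fixes f :: "nat \<Rightarrow> int"
  assumes "\<And>k. odd k \<Longrightarrow> f k = 0"
  shows "egf (\<lambda>n. of_int (f n)) * (fps_exp 1 + fps_exp (-1)) =
    egf (\<lambda>n. if odd n then 0 else of_int (2 * (\<Sum>j=0..n div 2. int (n choose (2 * j)) * f (n - 2 * j))))"
proof -
  have "(\<Sum>k=0..n. of_nat (n choose k) * of_int (f k) * (1 ^ (n - k) + (-1) ^ (n - k)))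
      = (if odd n then 0 else of_int (2 * (\<Sum>j=0..n div 2. int (n choose (2 * j)) * f (n - 2 * j))) :: rat)"
    (is "sum ?g _ = _") for n
  proof (cases "even n")
    case False
    then have "?g k = 0" if "k \<in> {0..n}" for k
      using that assms by (cases "even k") simp_all
    then show ?thesis
      using False by (auto intro: sum.neutral)
  next
    case True
    then obtain m where n: "n = 2 * m"
      by blast
    have "sum ?g {0..n} = sum ?g ((\<lambda>j. 2 * j) ` {0..m})"
    proof (rule sum.mono_neutral_right)
      show "\<forall>k\<in>{0..n} - (\<lambda>j. 2 * j) ` {0..m}. ?g k = 0"
      proof
        fix k assume "k \<in> {0..n} - (\<lambda>j. 2 * j) ` {0..m}"
        then have "odd k"
          using n by (auto elim!: evenE)
        then show "?g k = 0"
          by (simp add: assms)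
      qed
    qed (auto simp: n)
    also have "\<dots> = (\<Sum>j=0..m. 2 * of_int (int (n choose (2 * j)) * f (2 * j)))"
      by (subst sum.reindex) (auto simp: n inj_on_def intro!: sum.cong)
    also have "\<dots> = 2 * of_int (\<Sum>j=0..m. int ((2 * m) choose (2 * j)) * f (2 * j))"
      by (simp add: sum_distrib_left n)
    also have "(\<Sum>j=0..m. int ((2 * m) choose (2 * j)) * f (2 * j)) =
        (\<Sum>j=0..m. int ((2 * m) choose (2 * j)) * f (2 * m - 2 * j))"
    proof (subst sum.atLeastAtMost_rev, intro sum.cong refl)
      fix j assume "j \<in> {0..m}"
      then show "int ((2 * m) choose (2 * (m + 0 - j))) * f (2 * (m + 0 - j)) =
          int ((2 * m) choose (2 * j)) * f (2 * m - 2 * j)"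
        using binomial_symmetric[of "2 * j" "2 * m"] by (simp add: diff_mult_distrib2)
    qed
    finally show ?thesis
      using n by simp
  qed
  then show ?thesis
    by (simp only: fps_exp_egf egf_add egf_mult)
qed

lemma egf_euler_num: "egf (\<lambda>n. of_int (euler_num n)) * (fps_exp 2 + 1) = 2 * fps_exp 1"
proof -
  have *: "(if odd n then 0 else of_int (2 * (\<Sum>j=0..n div 2. int (n choose (2 * j)) * euler_num (n - 2 * j)))) =
      (if n = 0 then 2 else (0 :: rat))" for n
    using euler_num_rec(1) euler_num_rec(3)[of "n div 2"]
    by (cases "n = 0") (auto simp: sum.atLeast_Suc_atMost elim!: evenE)
  have "egf (\<lambda>n. of_int (euler_num n)) * (fps_exp 1 + fps_exp (-1)) = egf (\<lambda>n. if n = 0 then 2 else 0)"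
    by (subst egf_even_times_cosh) (simp_all add: euler_num.simps *)
  also have "\<dots> = 2"
    by (simp add: egf_def fps_eq_iff fps_numeral_nth)
  finally have "egf (\<lambda>n. of_int (euler_num n)) * (fps_exp 1 + fps_exp (-1)) * fps_exp 1 = 2 * fps_exp 1"
    by simp
  moreover have "(fps_exp 1 + fps_exp (-1)) * fps_exp 1 = fps_exp 2 + (1 :: rat fps)"
    by (simp add: distrib_right fps_exp_add_mult[symmetric])
  ultimately show ?thesis
    by (simp only: mult.assoc)
qed

lemma egf_U: "egf (\<lambda>n. of_int (U n)) * (fps_exp 1 + fps_exp (-1) - 1) = 1"
proof -
  have *: "(if odd n then 0 else of_int (2 * (\<Sum>j=0..n div 2. int (n choose (2 * j)) * U (n - 2 * j)))) =
      of_int (U n) + (if n = 0 then 1 else (0 :: rat))" for n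
    using U_rec(1) U_rec(3)[of "n div 2"] U.simps[of n]
    by (cases "n = 0") (auto simp: sum.atLeast_Suc_atMost elim!: evenE)
  have "egf (\<lambda>n. of_int (U n)) * (fps_exp 1 + fps_exp (-1)) = egf (\<lambda>n. of_int (U n)) + 1"
    unfolding one_egf egf_add by (subst egf_even_times_cosh) (simp_all add: U.simps[of _] *)
  then show ?thesis
    by (simp add: right_diff_distrib)
qed

lemma egf_s: "egf (\<lambda>n. of_int (s n)) * (fps_exp 4 + 1) = 2 * fps_exp 1"
proof -
  have "(\<Sum>k=0..n. of_nat (n choose k) * of_int (s k) * (4 ^ (n - k) + (if n - k = 0 then 1 else 0)))
      = (2 :: rat) * 1 ^ n" for n
  proof (cases n)
    case 0
    then show ?thesis by (simp add: s_rec)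
  next
    case (Suc m)
    \<comment> \<open>The recurrence of \<open>s\<close> contains half of this power of 4. The
      halving matches the last index k = n, which is counted twice in the sum.\<close>
    have "(4 :: int) ^ (n - k) = 2 * 2 ^ (2 * n - 1 - 2 * k)" if "k \<in> {0..m}" for k
    proof -
      have "2 * (n - k) = Suc (2 * n - 1 - 2 * k)"
        using that Suc by auto
      then show ?thesis
        by (metis power_Suc power_mult numeral_Bit0_eq_double power2_eq_square mult_2 numeral_Bit0)
    qed
    then have "(\<Sum>k=0..m. int (n choose k) * s k * 4 ^ (n - k)) =
        2 * (\<Sum>k=0..m. int (n choose k) * 2 ^ (2 * n - 1 - 2 * k) * s k)"
      by (simp add: sum_distrib_left mult_ac)
    also have "\<dots> = 2 * (1 - s n)"
      using s_rec(2)[of n] Suc by simp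
    finally have "rat_of_int (\<Sum>k=0..m. int (n choose k) * s k * 4 ^ (n - k)) = of_int (2 * (1 - s n))"
      by (rule arg_cong)
    then have "(\<Sum>k=0..m. of_nat (n choose k) * of_int (s k) * 4 ^ (n - k)) = (2 * (1 - of_int (s n)) :: rat)"
      by simp
    moreover have "(\<Sum>k=0..m. of_nat (n choose k) * of_int (s k) * (4 ^ (n - k) + (if n - k = 0 then 1 else 0)))
        = (\<Sum>k=0..m. of_nat (n choose k) * of_int (s k) * 4 ^ (n - k) :: rat)"
      using Suc by (intro sum.cong) auto
    ultimately show ?thesis
      unfolding Suc sum.atLeast0_atMost_Suc by simp
  qed
  then have "egf (\<lambda>n. of_int (s n)) * (fps_exp 4 + 1) = fps_const 2 * fps_exp 1"
    by (simp only: one_egf fps_exp_egf egf_add egf_mult egf_cmult)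
  then show ?thesis
    by (simp add: numeral_fps_const)
qed

text \<open>The free scale \<open>c\<close> serves to make the exponents \<open>2 * c * x\<close>
  convenient at fractional x, so that the exponentials become powers of a single one.\<close>

lemma egf_eulerpoly:
  "egf (\<lambda>n. (2 * c) ^ n * eulerpoly n x) * (fps_exp (2 * c) + 1) = 2 * fps_exp (2 * c * x)"
proof -
  let ?c = "fps_const c * fps_X :: rat fps"
  have "egf (\<lambda>n. 2 ^ n * eulerpoly n x) = egf (\<lambda>n. of_int (euler_num n)) * fps_exp (2 * x - 1)"
    unfolding fps_exp_egf egf_mult eulerpoly_def by (simp add: mult_ac)
  then have "egf (\<lambda>n. 2 ^ n * eulerpoly n x) * (fps_exp 2 + 1) = (2 * fps_exp 1) * fps_exp (2 * x - 1)"
    unfolding egf_euler_num[symmetric] by (simp add: mult_ac)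
  also have "\<dots> = fps_const 2 * fps_exp (2 * x)"
    by (simp add: mult.assoc fps_exp_add_mult[symmetric] numeral_fps_const)
  finally have "(egf (\<lambda>n. 2 ^ n * eulerpoly n x) * (fps_exp 2 + 1)) oo ?c = (fps_const 2 * fps_exp (2 * x)) oo ?c"
    by (rule arg_cong)
  then have "(egf (\<lambda>n. 2 ^ n * eulerpoly n x) oo ?c) * (fps_exp (c * 2) + 1) = fps_const 2 * fps_exp (c * (2 * x))"
    by (simp add: fps_scale_distribs)
  then show ?thesis
    unfolding egf_scale by (simp add: numeral_fps_const power_mult_distrib mult_ac)
qed

lemma fps_exp_plus_1_nonzero: "fps_exp c + (1 :: rat fps) \<noteq> 0"
proof
  assume "fps_exp c + (1 :: rat fps) = 0"
  then have "fps_nth (fps_exp c + 1) 0 = (0 :: rat)"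
    by simp
  then show False
    by simp
qed

lemma eulerpoly_add_one: "eulerpoly n (x + 1) + eulerpoly n x = 2 * x ^ n"
proof -
  let ?A = "\<lambda>x. egf (\<lambda>n. (2 * 1) ^ n * eulerpoly n x)"
  have "(?A (x + 1) + ?A x) * (fps_exp (2 * 1) + 1) = (2 * fps_exp (2 * x)) * (fps_exp (2 * 1) + 1)"
    unfolding distrib_right[of "?A _"] egf_eulerpoly
    by (simp add: algebra_simps fps_exp_add_mult)
  then have "?A (x + 1) + ?A x = fps_const 2 * fps_exp (2 * x)"
    using fps_exp_plus_1_nonzero[of "2 * 1"] by (simp add: numeral_fps_const)
  then have "(\<lambda>n. (2 * 1) ^ n * eulerpoly n (x + 1) + (2 * 1) ^ n * eulerpoly n x) = (\<lambda>n. 2 * (2 * x) ^ n)"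
    unfolding fps_exp_egf egf_add egf_cmult egf_inject .
  from fun_cong[OF this, of n] show ?thesis
    by (simp add: power_mult_distrib flip: distrib_left)
qed

lemma eulerpoly_reflect:
  assumes "even n"
  shows "eulerpoly n (1 - x) = eulerpoly n x"
proof -
  have "of_nat (n choose k) * (2 * (1 - x) - 1) ^ (n - k) * of_int (euler_num k) =
      of_nat (n choose k) * (2 * x - 1) ^ (n - k) * of_int (euler_num k)" if "k \<in> {0..n}" for k
  proof (cases "even k")
    case True
    then have "even (n - k)"
      using assms by simp
    then have "(- (2 * x - 1)) ^ (n - k) = (2 * x - 1) ^ (n - k)"
      by (rule power_minus_even)
    then show ?thesis
      by (simp add: algebra_simps)
  qed (simp add: euler_num.simps[of k])
  then show ?thesis
    unfolding eulerpoly_def by (intro arg_cong2[where f = "(/)"] sum.cong refl)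
qed

lemma eulerpoly_half: "eulerpoly n (1/2) = of_int (euler_num n) / 2 ^ n"
proof -
  have "(\<Sum>k=0..n. of_nat (n choose k) * (2 * (1/2) - 1) ^ (n - k) * of_int (euler_num k)) =
      (\<Sum>k=0..n. if k = n then of_int (euler_num k) else (0 :: rat))"
    by (intro sum.cong refl) (auto simp: power_0_left)
  then show ?thesis
    unfolding eulerpoly_def by simp
qed

text \<open>The values at 0 and 1 add up to 0 by the difference equation and coincide by
  reflection.\<close>

lemma eulerpoly_zero:
  assumes "even n" "n > 0"
  shows "eulerpoly n 0 = 0"
  using eulerpoly_add_one[of n 0] eulerpoly_reflect[OF assms(1), of 0] assms(2) by simp

lemma s_eq_eulerpoly: "of_int (s n) = 4 ^ n * eulerpoly n (1/4)"
proof -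
  have "egf (\<lambda>n. (2 * 2) ^ n * eulerpoly n (1/4)) * (fps_exp 4 + 1) = egf (\<lambda>n. of_int (s n)) * (fps_exp 4 + 1)"
    unfolding egf_s using egf_eulerpoly[of 2 "1/4"] by simp
  then have "(\<lambda>n. (2 * 2) ^ n * eulerpoly n (1/4)) = (\<lambda>n. of_int (s n))"
    using fps_exp_plus_1_nonzero[of 4] by (simp add: egf_inject)
  from fun_cong[OF this, of n] show ?thesis
    by simp
qed

text \<open>With e = exp X, the factorization e^3 + 1 = (e + 1) (e^2 - e + 1) gives 1 / (e + 1/e -
  1) = (e^2 + e) / (e^3 + 1). This is the mean of the generating functions belonging to 1/3 and 2/3,
  which agree in even degree by reflection.\<close>

lemma U_eq_eulerpoly:
  assumes "even n"
  shows "of_int (U n) = 3 ^ n * eulerpoly n (1/3)"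
proof -
  define A where "A x = egf (\<lambda>n. 3 ^ n * eulerpoly n x)" for x
  have A: "A x * (fps_exp 3 + 1) = 2 * fps_exp (3 * x)" for x
    using egf_eulerpoly[of "3/2" x] by (simp add: A_def)
  define V where "V = egf (\<lambda>n. of_int (U n))"
  define e where "e = (fps_exp 1 :: rat fps)"
  have e: "fps_exp 3 = e ^ 3" "fps_exp 2 = e ^ 2" "fps_exp (-1) * e = 1"
    unfolding e_def by (simp_all add: fps_exp_power_mult fps_exp_add_mult[symmetric])
  have V: "V * (e + fps_exp (-1) - 1) = 1"
    using egf_U by (simp add: V_def e_def)
  have "V * (e ^ 2 - e + 1) = V * (e + fps_exp (-1) - 1) * e"
    using e(3) by (simp add: algebra_simps power2_eq_square)
  then have V': "V * (e ^ 2 - e + 1) = e"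
    unfolding V by simp
  have "2 * V * (e ^ 3 + 1) = 2 * (V * (e ^ 2 - e + 1)) * (e + 1)"
    by (simp add: algebra_simps power2_eq_square power3_eq_cube)
  also have "\<dots> = (A (1/3) + A (2/3)) * (e ^ 3 + 1)"
    using A[of "1/3"] A[of "2/3"] unfolding V' e(1,2)
    by (simp add: distrib_right e e_def[symmetric]) (simp add: algebra_simps power2_eq_square)
  finally have "(2 * V) * (fps_exp 3 + 1) = (A (1/3) + A (2/3)) * (fps_exp 3 + 1)"
    unfolding e(1) .
  then have "fps_const 2 * V = A (1/3) + A (2/3)"
    using fps_exp_plus_1_nonzero[of 3] by (simp add: numeral_fps_const)
  then have "(\<lambda>n. 2 * of_int (U n)) = (\<lambda>n. 3 ^ n * eulerpoly n (1/3) + 3 ^ n * eulerpoly n (2/3))"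
    unfolding V_def A_def egf_cmult egf_add egf_inject .
  from fun_cong[OF this, of n] show ?thesis
    using eulerpoly_reflect[OF assms, of "1/3"] by simp
qed

text \<open>The multiplication formula with factor 3, coming from e^6 + 1 = (e^2 + 1) (e^4 - e^2 +
  1) with e = exp(X/2). It expresses the value at 1/2 by those at 1/6, 1/2 and 5/6, and the outer
  two agree by reflection.\<close>

lemma eulerpoly_sixth:
  assumes "even n"
  shows "2 * 3 ^ n * eulerpoly n (1/6) = (1 + 3 ^ n) * eulerpoly n (1/2)"
proof -
  define A where "A x = egf (\<lambda>n. 3 ^ n * eulerpoly n x)" for x
  have A: "A x * (fps_exp 3 + 1) = 2 * fps_exp (3 * x)" for x
    using egf_eulerpoly[of "3/2" x] by (simp add: A_def)
  define V where "V = egf (\<lambda>n. 1 ^ n * eulerpoly n (1/2))"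
  have V: "V * (fps_exp 1 + 1) = 2 * fps_exp (1/2)"
    using egf_eulerpoly[of "1/2" "1/2"] by (simp add: V_def)
  define e where "e = (fps_exp (1/2) :: rat fps)"
  have e: "fps_exp 3 = e ^ 6" "fps_exp 1 = e ^ 2" "fps_exp (1/2) = e" "fps_exp (3/2) = e ^ 3" "fps_exp (5/2) = e ^ 5"
    unfolding e_def by (simp_all add: fps_exp_power_mult)
  have "V * (e ^ 6 + 1) = V * (e ^ 2 + 1) * (e ^ 4 - e ^ 2 + 1)"
    by (simp add: algebra_simps eval_nat_numeral)
  also have "\<dots> = 2 * e * (e ^ 4 - e ^ 2 + 1)"
    using V unfolding e by simp
  also have "\<dots> = 2 * e - 2 * e ^ 3 + 2 * e ^ 5"
    by (simp add: algebra_simps eval_nat_numeral)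
  also have "\<dots> = (A (1/6) - A (1/2) + A (5/6)) * (e ^ 6 + 1)"
    using A[of "1/6"] A[of "1/2"] A[of "5/6"] unfolding e(1)
    by (simp add: distrib_right left_diff_distrib e)
  finally have "V * (fps_exp 3 + 1) = (A (1/6) - A (1/2) + A (5/6)) * (fps_exp 3 + 1)"
    unfolding e(1) .
  then have "V = A (1/6) - A (1/2) + A (5/6)"
    using fps_exp_plus_1_nonzero[of 3] by simp
  then have "(\<lambda>n. 1 ^ n * eulerpoly n (1/2)) =
      (\<lambda>n. 3 ^ n * eulerpoly n (1/6) - 3 ^ n * eulerpoly n (1/2) + 3 ^ n * eulerpoly n (5/6))"
    unfolding V_def A_def egf_diff egf_add egf_inject .
  from fun_cong[OF this, of n] show ?thesis
    using eulerpoly_reflect[OF assms, of "1/6"] by (simp add: algebra_simps)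
qed

section \<open>The general congruence\<close>

lemma bernpoly_at_0: "bernpoly n 0 = bernoulli n"
proof -
  have "bernpoly n 0 = (\<Sum>k=0..n. if k = n then bernoulli k else 0)"
    unfolding bernpoly_def by (intro sum.cong refl) (auto simp: power_0_left)
  then show ?thesis
    by simp
qed

lemma inverse_add_expand:
  fixes a q :: rat
  assumes "q + a \<noteq> 0" "a \<noteq> 0"
  shows "1 / (q + a) = 1 / a - q * (1 / a ^ 2) + q ^ 2 * ((1 / a ^ 2) * (1 / (q + a)))"
proof -
  have *: "v = u - q * u ^ 2 + q ^ 2 * (u ^ 2 * v)" if "u * a = 1" "v * (q + a) = 1" for u v
  proof -
    have "v = u * (v * (q + a)) - q * u * v + v * (1 - u * a)"
      by (simp add: algebra_simps)
    then have v: "v = u - q * u * v"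
      unfolding that by simp
    have "u - q * u ^ 2 + q ^ 2 * (u ^ 2 * v) = u - q * u * (u - q * u * v)"
      by (simp add: algebra_simps power2_eq_square)
    then show ?thesis
      unfolding v[symmetric] by simp
  qed
  have "1 / a * a = 1" "1 / (q + a) * (q + a) = 1"
    using assms by simp_all
  from *[OF this] show ?thesis
    unfolding power_one_over .
qed

section \<open>p-adic continuity of \<open>T p\<close>\<close>

context local_ring
begin

definition NN :: nat where "NN = p\<^sup>2 * (p - 1)"

lemma zloc_scaled_rat:
  obtains e where "P ^ e * c \<in> zloc p"
proof -
  obtain u v where uv: "c = of_int u / of_int v" "v > 0"
    by (cases c rule: Rat_cases) (auto simp: Fract_of_int_quotient)
  have "\<not> is_unit (int p)"
    using prime_gt_1_nat[OF prime_p] by simp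
  then obtain w where w: "v = int p ^ multiplicity (int p) v * w" "\<not> int p dvd w"
    using multiplicity_decompose'[of v "int p"] uv(2) by (metis less_irrefl)
  have "P ^ multiplicity (int p) v * c = of_int u / of_int w"
  proof -
    have "(of_int v :: rat) = P ^ multiplicity (int p) v * of_int w"
      using arg_cong[OF w(1), of "of_int :: int \<Rightarrow> rat"] by simp
    then show ?thesis
      unfolding uv(1) by simp
  qed
  then show thesis
    using that zloc_divideI[OF w(2), of u] by metis
qed

lemma poly_approx:
  fixes c :: "nat \<Rightarrow> rat"
  assumes "finite I"
  shows "\<exists>K. \<forall>x\<in>zloc p. \<forall>y\<in>zloc p. pcong K x y \<longrightarrow>
    pcong M (\<Sum>k\<in>I. c k * x ^ e k) (\<Sum>k\<in>I. c k * y ^ e k)"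
  using assms
proof induction
  case (insert j I)
  obtain K where K: "\<And>x y. x \<in> zloc p \<Longrightarrow> y \<in> zloc p \<Longrightarrow> pcong K x y \<Longrightarrow>
    pcong M (\<Sum>k\<in>I. c k * x ^ e k) (\<Sum>k\<in>I. c k * y ^ e k)"
    using insert by blast
  obtain d where d: "P ^ d * c j \<in> zloc p"
    by (rule zloc_scaled_rat)
  have "pcong M (c j * x ^ e j + (\<Sum>k\<in>I. c k * x ^ e k)) (c j * y ^ e j + (\<Sum>k\<in>I. c k * y ^ e k))"
    if xy: "x \<in> zloc p" "y \<in> zloc p" "pcong (K + (M + d)) x y" for x y
  proof (rule pcong_add)
    have "pcong (M + d) x y"
      using xy(3) by (rule pcong_mono) simp
    then have "pcong (M + d) (x ^ e j) (y ^ e j)"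
      using xy by (intro pcong_power)
    then obtain z where z: "z \<in> zloc p" "x ^ e j = y ^ e j + P ^ (M + d) * z"
      by (rule pcongE)
    then have "c j * x ^ e j = c j * y ^ e j + P ^ M * ((P ^ d * c j) * z)"
      by (simp add: power_add algebra_simps)
    then show "pcong M (c j * x ^ e j) (c j * y ^ e j)"
      by (rule pcongI) (intro zloc_mult d z)
    have "pcong K x y"
      using xy(3) by (rule pcong_mono) simp
    then show "pcong M (\<Sum>k\<in>I. c k * x ^ e k) (\<Sum>k\<in>I. c k * y ^ e k)"
      using xy by (intro K)
  qed
  then show ?case
    using insert by auto
qed auto

lemma T_approx:
  obtains K where "\<And>x y. x \<in> zloc p \<Longrightarrow> y \<in> zloc p \<Longrightarrow> pcong K x y \<Longrightarrow> pcong M (T p x) (T p y)"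
proof -
  define c where "c k = of_nat (NN choose k) * bernoulli k / of_nat NN" for k
  have T: "T p x = (\<Sum>k\<in>{0..NN}. c k * (- x) ^ (NN - k)) - bernoulli NN / of_nat NN" for x
    unfolding T_def bernpoly_def NN_def[symmetric] c_def diff_divide_distrib
    by (simp add: sum_divide_distrib)
  obtain K where K: "\<And>x y. x \<in> zloc p \<Longrightarrow> y \<in> zloc p \<Longrightarrow> pcong K x y \<Longrightarrow>
      pcong M (\<Sum>k\<in>{0..NN}. c k * x ^ (NN - k)) (\<Sum>k\<in>{0..NN}. c k * y ^ (NN - k))"
    using poly_approx[of "{0..NN}" M c "\<lambda>k. NN - k"] by blast
  have "pcong M (T p x) (T p y)" if "x \<in> zloc p" "y \<in> zloc p" "pcong K x y" for x y
    unfolding T using that by (intro pcong_diff K zloc_minus pcong_minus pcong_refl)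
  then show thesis
    by (rule that)
qed

lemma pcong_power_totient:
  assumes "\<not> p dvd k"
  shows "pcong 3 (of_nat k ^ NN) 1"
proof -
  have "coprime k (p ^ 3)"
    using prime_imp_coprime[OF prime_p assms] by (simp add: coprime_commute[of k p])
  then have "[k ^ totient (p ^ 3) = 1] (mod (p ^ 3))"
    by (rule euler_theorem)
  moreover have "totient (p ^ 3) = NN"
    using prime_p by (simp add: totient_prime_power NN_def)
  ultimately show ?thesis
    using pcong_of_nat[of "k ^ NN" 1 3] by simp
qed

end

section \<open>\<open>T p\<close> and the Euler polynomial on residue classes\<close>

context local_ring_gt3
begin

lemma NN_ge: "NN \<ge> 100"
proof -
  have "5 \<le> p"
    using p_gt_3 odd_p by (cases "p = 4") auto
  then have "5 ^ 2 * 4 \<le> p ^ 2 * (p - 1)"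
    by (intro mult_le_mono power_mono) auto
  then show ?thesis
    by (simp add: NN_def)
qed

lemma even_NN: "even NN"
  using odd_p by (simp add: NN_def)

text \<open>Iterates the difference equation of the Bernoulli polynomial at negative arguments; the
  terms come out positive because NN - 1 is odd.\<close>

lemma T_add_nat: "T p (of_nat (n + q)) = T p (of_nat n) + (\<Sum>i=1..q. of_nat (n + i) ^ (NN - 1))"
proof (induction q)
  case (Suc q)
  have "odd (NN - 1)"
    using even_NN NN_ge by simp
  let ?y = "of_nat (n + Suc q) :: rat"
  have "bernpoly NN (- ?y + 1) - bernpoly NN (- ?y) = of_nat NN * (- ?y) ^ (NN - 1)"
    by (rule bernpoly_add_one)
  also have "(- ?y) ^ (NN - 1) = - (?y ^ (NN - 1))"
    using \<open>odd (NN - 1)\<close> by (rule power_minus_odd)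
  also have "- ?y + 1 = - of_nat (n + q)"
    by simp
  finally have "bernpoly NN (- ?y) = bernpoly NN (- of_nat (n + q)) + of_nat NN * ?y ^ (NN - 1)"
    by (simp only: algebra_simps)
  moreover have "of_nat NN \<noteq> (0 :: rat)"
    using NN_ge by simp
  ultimately have e: "T p ?y = T p (of_nat (n + q)) + ?y ^ (NN - 1)"
    unfolding T_def NN_def[symmetric] by (simp add: field_simps)
  show ?case
    unfolding e Suc by (simp del: of_nat_add of_nat_Suc add_Suc_right)
qed simp

lemma pcong_power_NN_minus_1:
  assumes "\<not> p dvd k"
  shows "pcong 3 (of_nat k ^ (NN - 1)) (1 / of_nat k)"
proof (rule pcong_cancel)
  have "k \<noteq> 0"
    using assms by (metis dvd_0_right)
  have "NN = Suc (NN - 1)"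
    using NN_ge by simp
  then have "of_nat k * of_nat k ^ (NN - 1) = (of_nat k ^ NN :: rat)"
    by (metis power_Suc)
  then show "pcong 3 (of_nat k * of_nat k ^ (NN - 1)) (of_nat k * (1 / of_nat k))"
    using pcong_power_totient[OF assms] \<open>k \<noteq> 0\<close> by simp
  show "of_nat k \<noteq> (0 :: rat)" "1 / of_nat k \<in> zloc p"
    using \<open>k \<noteq> 0\<close> zloc_inverse_nat[OF assms] by auto
qed

lemma pcong_power_NN_minus_1_multiple: "pcong 3 (of_nat (p * c) ^ (NN - 1)) 0"
proof -
  have "NN - 1 = 3 + (NN - 4)"
    using NN_ge by simp
  then have "P ^ (NN - 1) = P ^ 3 * P ^ (NN - 4)"
    by (simp only: power_add)
  then have "of_nat (p * c) ^ (NN - 1) = 0 + P ^ 3 * (P ^ (NN - 4) * of_nat c ^ (NN - 1))"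
    by (simp only: of_nat_mult power_mult_distrib mult.assoc add_0)
  then show ?thesis
    by (rule pcongI) (intro zloc_mult zloc_power zloc_of_nat)
qed

lemma pcong_power_NN_shift:
  assumes "0 < i" "i < p"
  shows "pcong 2 (of_nat (p * m + i) ^ (NN - 1)) (1 / of_nat i - P * of_nat m * (1 / of_nat i ^ 2))"
proof -
  have nd: "\<not> p dvd i" "\<not> p dvd (p * m + i)"
    using not_dvd_less[OF assms] by (simp_all add: mult.commute[of p] dvd_add_times_triv_left_iff)
  have nz: "P * of_nat m + of_nat i \<noteq> 0" "of_nat i \<noteq> (0 :: rat)"
    using assms by (simp_all flip: of_nat_mult of_nat_add)
  have "pcong 2 (of_nat (p * m + i) ^ (NN - 1)) (1 / of_nat (p * m + i))"
    using pcong_power_NN_minus_1[OF nd(2)] by (rule pcong_mono) simp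
  also have "1 / of_nat (p * m + i) = 1 / of_nat i - P * of_nat m * (1 / of_nat i ^ 2) +
      P ^ 2 * (of_nat m ^ 2 * (1 / of_nat i ^ 2) * (1 / of_nat (p * m + i)))"
    using inverse_add_expand[OF nz] unfolding power_mult_distrib of_nat_add of_nat_mult mult.assoc .
  also have "pcong 2 \<dots> (1 / of_nat i - P * of_nat m * (1 / of_nat i ^ 2))"
    by (rule pcongI[OF refl])
      (intro zloc_mult zloc_power zloc_of_nat zloc_inverse_power zloc_inverse_nat nd)
  finally show ?thesis .
qed

lemma sum_power_NN_shift:
  assumes "a < p"
  shows "pcong 2 (\<Sum>i=1..a. of_nat (p * m + i) ^ (NN - 1)) (harm1 a - P * of_nat m * harm2 a)"
proof -
  have "pcong 2 (\<Sum>i=1..a. of_nat (p * m + i) ^ (NN - 1))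
      (\<Sum>i=1..a. 1 / of_nat i - P * of_nat m * (1 / of_nat i ^ 2))"
    using assms by (intro pcong_sum pcong_power_NN_shift) auto
  then show ?thesis
    unfolding harm1_def harm2_def sum_distrib_left sum_subtractf .
qed

text \<open>Each block of p consecutive terms consists of a multiple of p, whose power vanishes, and
  a full harmonic sum up to p - 1, which vanishes modulo p^2 by Wolstenholme; its correction
  \<open>P * of_nat m * harm2 (p - 1)\<close> does so as well.\<close>

lemma T_multiple: "pcong 2 (T p (of_nat (p * m))) 0"
proof (induction m)
  case 0
  have "T p 0 = 0"
    by (simp add: T_def bernpoly_at_0)
  then show ?case
    by simp
next
  case (Suc m)
  have "{1..p} = insert p {1..p - 1}" "p \<notin> {1..p - 1}"
    using p_gt_3 by auto
  then have "(\<Sum>i=1..p. of_nat (p * m + i) ^ (NN - 1)) =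
      of_nat (p * Suc m) ^ (NN - 1) + (\<Sum>i=1..p - 1. of_nat (p * m + i) ^ (NN - 1) :: rat)"
    by (simp add: add.commute)
  then have "T p (of_nat (p * Suc m)) = T p (of_nat (p * m)) +
      (of_nat (p * Suc m) ^ (NN - 1) + (\<Sum>i=1..p - 1. of_nat (p * m + i) ^ (NN - 1)))"
    using T_add_nat[of "p * m" p] by (simp add: add.commute)
  also have "pcong 2 \<dots> (0 + (0 + (harm1 (p - 1) - P * of_nat m * harm2 (p - 1))))"
    using p_gt_3 pcong_mono[OF pcong_power_NN_minus_1_multiple[of "Suc m"], of 2]
    by (intro pcong_add Suc sum_power_NN_shift) simp_all
  also have "pcong 2 \<dots> (0 + (0 + (0 - of_nat m * (P ^ 1 * 0))))"
  proof -
    have "pcong 2 (P ^ 1 * harm2 (p - 1)) (P ^ 1 * 0)"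
      by (rule pcong_times_P[OF harm2_pcong_0]) simp
    then have "pcong 2 (of_nat m * (P ^ 1 * harm2 (p - 1))) (of_nat m * (P ^ 1 * 0))"
      by (rule pcong_mult_left) simp
    then have "pcong 2 (P * of_nat m * harm2 (p - 1)) (of_nat m * (P ^ 1 * 0))"
      by (simp add: mult_ac)
    then show ?thesis
      by (intro pcong_add pcong_diff harm1_pcong_0 pcong_refl)
  qed
  finally show ?case
    by simp
qed

lemma T_pcong:
  assumes a: "a < p" and t: "t \<in> zloc p"
  shows "pcong 2 (T p (of_nat a + P * t)) (harm1 a - P * t * harm2 a)"
proof -
  obtain K where K: "\<And>x y. x \<in> zloc p \<Longrightarrow> y \<in> zloc p \<Longrightarrow> pcong K x y \<Longrightarrow> pcong 2 (T p x) (T p y)"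
    using T_approx by blast
  \<comment> \<open>\<open>Suc K\<close> guarantees that m and t agree at least modulo p, even if
    \<open>K\<close> is 0; this is used when m is replaced by t at the end.\<close>
  obtain m where m: "pcong (Suc K) t (of_nat m)"
    using zloc_approx_nat[OF t] by blast
  have "pcong K (of_nat a + P * t) (of_nat a + P * of_nat m)"
    using pcong_mono[OF m, of K] by (intro pcong_add pcong_mult_left) simp_all
  then have "pcong 2 (T p (of_nat a + P * t)) (T p (of_nat a + P * of_nat m))"
    using t by (intro K) auto
  also have "of_nat a + P * of_nat m = of_nat (p * m + a)"
    by simp
  also have "T p (of_nat (p * m + a)) = T p (of_nat (p * m)) + (\<Sum>i=1..a. of_nat (p * m + i) ^ (NN - 1))"
    by (rule T_add_nat)
  also have "pcong 2 \<dots> (0 + (harm1 a - P * of_nat m * harm2 a))"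
    by (intro pcong_add T_multiple sum_power_NN_shift a)
  also have "pcong 2 \<dots> (0 + (harm1 a - P * t * harm2 a))"
  proof -
    have "pcong 1 (of_nat m) t"
      using pcong_mono[OF m, of 1] pcong_sym by simp
    then have "pcong 2 (P ^ 1 * of_nat m) (P ^ 1 * t)"
      by (rule pcong_times_P) simp
    then have "pcong 2 (P * of_nat m * harm2 a) (P * t * harm2 a)"
      using harm_zloc[OF a] by (intro pcong_mult_right) simp_all
    then show ?thesis
      by (intro pcong_add pcong_diff pcong_refl)
  qed
  finally show ?thesis
    by simp
qed

text \<open>With the sign (-1)^a attached, the difference equation telescopes. The sum starts at the
  value at 0, which vanishes for even n > 0 but is 1 for n = 0.\<close>

lemma eulerpoly_neg_nat:
  assumes "even n" "n > 0"
  shows "(-1) ^ a * eulerpoly n (- of_nat a) = 2 * (\<Sum>i=1..a. (-1) ^ i * of_nat i ^ n)"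
proof (induction a)
  case 0
  then show ?case by (simp add: eulerpoly_zero[OF assms])
next
  case (Suc a)
  have "eulerpoly n (- of_nat (Suc a) + 1) + eulerpoly n (- of_nat (Suc a)) = 2 * (- of_nat (Suc a)) ^ n"
    by (rule eulerpoly_add_one)
  also have "(- of_nat (Suc a)) ^ n = (of_nat (Suc a) ^ n :: rat)"
    using assms(1) by (rule power_minus_even)
  also have "- of_nat (Suc a) + 1 = (- of_nat a :: rat)"
    by simp
  finally have e: "eulerpoly n (- of_nat (Suc a)) = 2 * of_nat (Suc a) ^ n - eulerpoly n (- of_nat a)"
    by (simp only: eq_diff_eq add.commute)
  have "(-1) ^ Suc a * eulerpoly n (- of_nat (Suc a)) =
      2 * ((-1) ^ Suc a * of_nat (Suc a) ^ n) + (-1) ^ a * eulerpoly n (- of_nat a)"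
    unfolding e by (simp add: algebra_simps del: of_nat_Suc)
  then show ?case
    using Suc by (simp add: algebra_simps del: of_nat_Suc)
qed

lemma eulerpoly_pcong:
  assumes "pcong 1 x y" "y \<in> zloc p"
  shows "pcong 1 (eulerpoly n x) (eulerpoly n y)"
proof -
  have z: "1 / 2 ^ n \<in> zloc p"
    using zloc_inverse_power[OF not_dvd_2_3(1), of n] by simp
  have "pcong 1 ((\<Sum>k=0..n. of_nat (n choose k) * (2 * x - 1) ^ (n - k) * of_int (euler_num k)) * (1 / 2 ^ n))
     ((\<Sum>k=0..n. of_nat (n choose k) * (2 * y - 1) ^ (n - k) * of_int (euler_num k)) * (1 / 2 ^ n))"
    using assms z
    by (intro pcong_mult_right pcong_sum pcong_mult_left pcong_power pcong_diff) auto
  then show ?thesis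
    by (simp add: eulerpoly_def)
qed

lemma pcong_power_p_minus_3:
  assumes "\<not> p dvd i"
  shows "pcong 1 (of_nat i ^ (p - 3)) (1 / of_nat i ^ 2)"
proof (rule pcong_cancel)
  have "i \<noteq> 0"
    using assms by (metis dvd_0_right)
  have "pcong 1 (of_nat (i ^ (p - 1))) (of_nat 1)"
    using fermat_theorem[OF prime_p assms] by (intro pcong_of_nat) simp
  moreover have "p - 1 = 2 + (p - 3)"
    using p_gt_3 by simp
  then have "of_nat (i ^ (p - 1)) = (of_nat i ^ 2 * of_nat i ^ (p - 3) :: rat)"
    by (simp only: of_nat_power of_nat_mult power_add)
  ultimately show "pcong 1 (of_nat i ^ 2 * of_nat i ^ (p - 3)) (of_nat i ^ 2 * (1 / of_nat i ^ 2))"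
    using \<open>i \<noteq> 0\<close> by simp
  show "of_nat i ^ 2 \<noteq> (0 :: rat)" "1 / of_nat i ^ 2 \<in> zloc p"
    using \<open>i \<noteq> 0\<close> zloc_inverse_power[OF assms] by auto
qed

lemma eulerpoly_altharm2:
  assumes a: "a < p" and x: "pcong 1 x (of_nat a)"
  shows "pcong 1 ((-1) ^ a * eulerpoly (p - 3) (- x)) (2 * altharm2 a)"
proof -
  have n: "even (p - 3)" "p - 3 > 0"
    using odd_p p_gt_3 by auto
  have "pcong 1 (eulerpoly (p - 3) (- x)) (eulerpoly (p - 3) (- of_nat a))"
    using x by (intro eulerpoly_pcong pcong_minus) auto
  then have "pcong 1 ((-1) ^ a * eulerpoly (p - 3) (- x)) ((-1) ^ a * eulerpoly (p - 3) (- of_nat a))"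
    by (rule pcong_mult_left) auto
  also have "(-1) ^ a * eulerpoly (p - 3) (- of_nat a) = 2 * (\<Sum>i=1..a. (-1) ^ i * of_nat i ^ (p - 3))"
    by (rule eulerpoly_neg_nat[OF n])
  also have "pcong 1 \<dots> (2 * (\<Sum>i=1..a. (-1) ^ i * (1 / of_nat i ^ 2)))"
  proof (intro pcong_mult_left pcong_sum pcong_power_p_minus_3)
    fix i assume "i \<in> {1..a}"
    then show "\<not> p dvd i"
      using a by (intro not_dvd_less) auto
  qed auto
  finally show ?thesis
    by (simp add: altharm2_def)
qed

text \<open>Among the p factors of the numerator, the one belonging to the residue of x is divisible
  by p, and p! contains only one factor p.\<close>

lemma zloc_gbinomial_p:
  assumes "x \<in> zloc p"
  shows "x gchoose p \<in> zloc p"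
proof -
  let ?a = "residue p x"
  obtain t where t: "t \<in> zloc p" "x = of_nat ?a + P ^ 1 * t"
    using residue(2)[OF assms] by (rule pcongE)
  have "\<not> p dvd fact (p - 1)"
    using prime_p p_gt_3 by (simp add: prime_dvd_fact_iff)
  then have f: "1 / of_nat (fact (p - 1)) \<in> zloc p"
    by (rule zloc_inverse_nat)
  have "p = Suc (p - 1)"
    using p_gt_3 by simp
  then have pf: "(fact p :: rat) = P * fact (p - 1)"
    by (metis fact_Suc)
  have "(\<Prod>i=0..<p. x - of_nat i) = (x - of_nat ?a) * (\<Prod>i\<in>{0..<p} - {?a}. x - of_nat i)"
    using residue(1)[OF assms] by (intro prod.remove) auto
  also have "x - of_nat ?a = P * t"
    using t(2) by simp
  finally have "x gchoose p = t * (\<Prod>i\<in>{0..<p} - {?a}. x - of_nat i) * (1 / of_nat (fact (p - 1)))"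
    unfolding gbinomial_prod_rev pf by simp
  then show ?thesis
    using t f assms by (simp only:) (intro zloc_mult zloc_prod zloc_diff zloc_of_nat)
qed

theorem G_pcong:
  assumes x: "x \<in> zloc p"
  shows "loc_cong p (G p x)
    (1 - (x gchoose p) * ((-1 - x) gchoose p)
      + 2 * of_nat p * T p x + 2 * of_nat p ^ 2 * T p x ^ 2
      + of_nat p ^ 2 * (-1) ^ residue p x * eulerpoly (p - 3) (- x)) (p ^ 3)"
proof -
  define a where "a = residue p x"
  have a: "a < p" and xa: "pcong 1 x (of_nat a)"
    using residue[OF x] by (simp_all add: a_def)
  obtain t where t: "t \<in> zloc p" and x_eq: "x = of_nat a + P * t"
    using xa by (auto elim: pcongE)
  note z = harm_zloc[OF a]
  define g where "g = (x gchoose p) * ((-1 - x) gchoose p)"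
  have g: "g \<in> zloc p"
    unfolding g_def using x by (intro zloc_mult zloc_gbinomial_p zloc_diff) auto
  have G: "G p x = truncG x - g"
    unfolding G_truncG legW_def g_def using odd_p by simp
  define h where "h = harm1 a - P * t * harm2 a"
  have h: "h \<in> zloc p"
    unfolding h_def using z t by (intro zloc_mult zloc_diff) auto
  have T: "pcong 2 (T p x) h"
    unfolding x_eq h_def by (rule T_pcong[OF a t])
  have T1: "pcong 1 (T p x) (harm1 a)"
  proof -
    have "pcong 1 (T p x) h"
      using T by (rule pcong_mono) simp
    also have "pcong 1 h (harm1 a)"
      unfolding h_def using z t by (intro pcongI[where c = "- (t * harm2 a)"]) auto
    finally show ?thesis .
  qed
  have 1: "pcong 3 (2 * (P ^ 1 * T p x)) (2 * (P ^ 1 * h))"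
    by (intro pcong_mult_left pcong_times_P[OF T]) auto
  have 2: "pcong 3 (P ^ 2 * (2 * T p x ^ 2 + (-1) ^ a * eulerpoly (p - 3) (- x)))
      (P ^ 2 * (2 * harm1 a ^ 2 + 2 * altharm2 a))"
  proof (rule pcong_times_P)
    show "pcong 1 (2 * T p x ^ 2 + (-1) ^ a * eulerpoly (p - 3) (- x)) (2 * harm1 a ^ 2 + 2 * altharm2 a)"
      using z by (intro pcong_add pcong_mult_left pcong_power T1 eulerpoly_altharm2[OF a xa]) auto
  qed simp
  define R where "R = 1 - g + 2 * (P ^ 1 * h) + P ^ 2 * (2 * harm1 a ^ 2 + 2 * altharm2 a)"
  have R: "R \<in> zloc p"
    unfolding R_def using g h z by (intro zloc_add zloc_diff zloc_mult zloc_power) auto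
  have "pcong 3 (1 - g + 2 * (P ^ 1 * T p x) + P ^ 2 * (2 * T p x ^ 2 + (-1) ^ a * eulerpoly (p - 3) (- x))) R"
    unfolding R_def by (intro pcong_add[OF _ 2] pcong_add[OF _ 1] pcong_refl)
  then have rhs: "pcong 3 (1 - g + 2 * P * T p x + 2 * P ^ 2 * T p x ^ 2 + P ^ 2 * (-1) ^ a * eulerpoly (p - 3) (- x)) R"
    by (simp add: algebra_simps)
  have "pcong 3 (truncG x - g) (1 + 2 * P * h + 2 * P ^ 2 * (harm1 a ^ 2 + altharm2 a) - g)"
    using truncG_pcong[OF a t] unfolding x_eq h_def by (intro pcong_diff pcong_refl)
  also have "1 + 2 * P * h + 2 * P ^ 2 * (harm1 a ^ 2 + altharm2 a) - g = R"
    by (simp add: R_def algebra_simps)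
  finally have lhs: "pcong 3 (G p x) R"
    unfolding G .
  show ?thesis
    unfolding loc_cong_iff a_def[symmetric] g_def[symmetric]
    using pcong_zloc[OF lhs R] pcong_zloc[OF rhs R] pcong_trans[OF lhs pcong_sym[OF rhs]] by blast
qed

end

section \<open>Multinomial coefficients and Fermat quotients\<close>

lemma gbinomial_Suc_times: "of_nat (Suc n) * (a gchoose Suc n) = (a - of_nat n) * (a gchoose n)"
  for a :: rat
  using gbinomial_absorption[of n a] gbinomial_absorb_comp[of a n] by simp

lemma gbinomial_Suc_divide: "a gchoose Suc n = (a gchoose n) * (a - of_nat n) / of_nat (Suc n)"
  for a :: rat
  using gbinomial_Suc_times[of n a] by (simp add: field_simps del: of_nat_Suc)

text \<open>At x = -1/2 the arguments x and -1 - x coincide, so a single binomial coefficient is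
  treated here; its factor (-4)^n squares to 16^n. The following lemmas treat the products for -1/3,
  -1/4 and -1/6, where the signs cancel.\<close>

lemma fact_double_gbinomial:
  "fact (2 * n) = (-4) ^ n * fact n ^ 2 * ((-1/2 :: rat) gchoose n)"
proof (induction n)
  case (Suc n)
  have *: "(of_nat n + 1 :: rat) \<noteq> 0"
    using of_nat_0_le_iff[of n, where 'a = rat] by linarith
  have "2 * Suc n = Suc (Suc (2 * n))"
    by simp
  then have "(fact (2 * Suc n) :: rat) = (2 * of_nat n + 2) * ((2 * of_nat n + 1) * fact (2 * n))"
    by (simp only: fact_Suc) (simp add: add_ac)
  also have "\<dots> = (2 * of_nat n + 2) * ((2 * of_nat n + 1) * ((-4) ^ n * fact n ^ 2 * ((-1/2 :: rat) gchoose n)))"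
    unfolding Suc ..
  also have "\<dots> = (-4) ^ Suc n * fact (Suc n) ^ 2 * ((-1/2 :: rat) gchoose Suc n)"
    unfolding gbinomial_Suc_divide fact_Suc power_Suc of_nat_Suc add.commute[of 1]
    using * by (simp add: divide_simps power2_eq_square) (simp add: algebra_simps)
  finally show ?case .
qed simp

lemma fact_triple_gbinomial:
  "fact (3 * n) = 27 ^ n * fact n ^ 3 * (((-1/3 :: rat) gchoose n) * ((-2/3) gchoose n))"
proof (induction n)
  case (Suc n)
  have *: "(of_nat n + 1 :: rat) \<noteq> 0"
    using of_nat_0_le_iff[of n, where 'a = rat] by linarith
  have "3 * Suc n = Suc (Suc (Suc (3 * n)))"
    by simp
  then have "(fact (3 * Suc n) :: rat) = (3 * of_nat n + 3) * ((3 * of_nat n + 2) * ((3 * of_nat n + 1) * fact (3 * n)))"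
    by (simp only: fact_Suc) (simp add: add_ac)
  also have "\<dots> = (3 * of_nat n + 3) * ((3 * of_nat n + 2) * ((3 * of_nat n + 1) *
      (27 ^ n * fact n ^ 3 * (((-1/3 :: rat) gchoose n) * ((-2/3) gchoose n)))))"
    unfolding Suc ..
  also have "\<dots> = 27 ^ Suc n * fact (Suc n) ^ 3 * (((-1/3 :: rat) gchoose Suc n) * ((-2/3) gchoose Suc n))"
    unfolding gbinomial_Suc_divide fact_Suc power_Suc of_nat_Suc add.commute[of 1]
    using * by (simp add: divide_simps power3_eq_cube) (simp add: algebra_simps)
  finally show ?case .
qed simp

lemma fact_quadruple_gbinomial:
  "fact (4 * n) = 64 ^ n * (fact (2 * n) * fact n ^ 2) * (((-1/4 :: rat) gchoose n) * ((-3/4) gchoose n))"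
proof (induction n)
  case (Suc n)
  have *: "(of_nat n + 1 :: rat) \<noteq> 0"
    using of_nat_0_le_iff[of n, where 'a = rat] by linarith
  have "2 * Suc n = Suc (Suc (2 * n))"
    by simp
  then have 2: "(fact (2 * Suc n) :: rat) = (2 * of_nat n + 2) * ((2 * of_nat n + 1) * fact (2 * n))"
    by (simp only: fact_Suc) (simp add: add_ac)
  have "4 * Suc n = Suc (Suc (Suc (Suc (4 * n))))"
    by simp
  then have "(fact (4 * Suc n) :: rat) = (4 * of_nat n + 4) * ((4 * of_nat n + 3) * ((4 * of_nat n + 2) *
      ((4 * of_nat n + 1) * fact (4 * n))))"
    by (simp only: fact_Suc) (simp add: add_ac)
  also have "\<dots> = (4 * of_nat n + 4) * ((4 * of_nat n + 3) * ((4 * of_nat n + 2) * ((4 * of_nat n + 1) *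
      (64 ^ n * (fact (2 * n) * fact n ^ 2) * (((-1/4 :: rat) gchoose n) * ((-3/4) gchoose n))))))"
    unfolding Suc ..
  also have "\<dots> = 64 ^ Suc n * (fact (2 * Suc n) * fact (Suc n) ^ 2) *
      (((-1/4 :: rat) gchoose Suc n) * ((-3/4) gchoose Suc n))"
    unfolding 2 unfolding gbinomial_Suc_divide fact_Suc power_Suc of_nat_Suc add.commute[of 1]
    using * by (simp add: divide_simps power2_eq_square) (simp add: algebra_simps)
  finally show ?case .
qed simp

lemma fact_sextuple_gbinomial:
  "fact (6 * n) = 432 ^ n * (fact (3 * n) * fact (2 * n) * fact n) *
    (((-1/6 :: rat) gchoose n) * ((-5/6) gchoose n))"
proof (induction n)
  case (Suc n)
  have *: "(of_nat n + 1 :: rat) \<noteq> 0"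
    using of_nat_0_le_iff[of n, where 'a = rat] by linarith
  have "2 * Suc n = Suc (Suc (2 * n))"
    by simp
  then have 2: "(fact (2 * Suc n) :: rat) = (2 * of_nat n + 2) * ((2 * of_nat n + 1) * fact (2 * n))"
    by (simp only: fact_Suc) (simp add: add_ac)
  have "3 * Suc n = Suc (Suc (Suc (3 * n)))"
    by simp
  then have 3: "(fact (3 * Suc n) :: rat) = (3 * of_nat n + 3) * ((3 * of_nat n + 2) * ((3 * of_nat n + 1) * fact (3 * n)))"
    by (simp only: fact_Suc) (simp add: add_ac)
  have "6 * Suc n = Suc (Suc (Suc (Suc (Suc (Suc (6 * n))))))"
    by simp
  then have "(fact (6 * Suc n) :: rat) = (6 * of_nat n + 6) * ((6 * of_nat n + 5) * ((6 * of_nat n + 4) *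
      ((6 * of_nat n + 3) * ((6 * of_nat n + 2) * ((6 * of_nat n + 1) * fact (6 * n))))))"
    by (simp only: fact_Suc) (simp add: add_ac)
  also have "\<dots> = (6 * of_nat n + 6) * ((6 * of_nat n + 5) * ((6 * of_nat n + 4) *
      ((6 * of_nat n + 3) * ((6 * of_nat n + 2) * ((6 * of_nat n + 1) *
      (432 ^ n * (fact (3 * n) * fact (2 * n) * fact n) * (((-1/6 :: rat) gchoose n) * ((-5/6) gchoose n))))))))"
    unfolding Suc ..
  also have "\<dots> = 432 ^ Suc n * (fact (3 * Suc n) * fact (2 * Suc n) * fact (Suc n)) *
      (((-1/6 :: rat) gchoose Suc n) * ((-5/6) gchoose Suc n))"
    unfolding 2 3 unfolding gbinomial_Suc_divide fact_Suc power_Suc of_nat_Suc add.commute[of 1]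
    using * by (simp add: divide_simps) (simp add: algebra_simps)
  finally show ?case .
qed simp

lemma bernpoly_of_nat: "bernpoly n (of_nat m) = bernoulli n + of_nat n * (\<Sum>k<m. of_nat k ^ (n - 1))"
proof (induction m)
  case 0
  then show ?case by (simp add: bernpoly_at_0)
next
  case (Suc m)
  then show ?case
    using bernpoly_add_one[of n "of_nat m"] by (simp add: algebra_simps)
qed

lemma lt_power_5: "i \<ge> 2 \<Longrightarrow> i + 1 < 5 ^ (i - 1)"
proof (induction i rule: dec_induct)
  case (step i)
  then have "(5 :: nat) ^ (Suc i - 1) = 5 * 5 ^ (i - 1)"
    by (cases i) simp_all
  then show ?case
    using step by simp
qed simp

section \<open>p-integrality of p times the Bernoulli numbers\<close>

context local_ring_gt3
begin

lemma p_ge_5: "p \<ge> 5"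
  using p_gt_3 odd_p by (cases "p = 4") auto

text \<open>If v is the exponent of p in i + 1, then p^v is at most i + 1, hence v is at most i. For
  i at least 2, i + 1 < 5^(i - 1) and p at least 5 improve this to i - 2.\<close>

lemma power_divide_Suc:
  assumes "e = 0 \<or> e = 2 \<and> i \<ge> 2"
  obtains z where "z \<in> zloc p" "P ^ i / of_nat (i + 1) = P ^ e * z"
proof -
  have "\<not> is_unit p"
    using prime_gt_1_nat[OF prime_p] by simp
  then obtain w where w: "i + 1 = p ^ multiplicity p (i + 1) * w" "\<not> p dvd w"
    using multiplicity_decompose'[of "i + 1" p] by auto
  define v where "v = multiplicity p (i + 1)"
  have "w > 0"
    using w(2) by (cases "w = 0") auto
  then have "p ^ v * 1 \<le> p ^ v * w"
    by (intro mult_le_mono) auto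
  then have v: "p ^ v \<le> i + 1"
    using w(1) unfolding v_def[symmetric] by simp
  have "v + e \<le> i"
  proof (cases "e = 0")
    case True
    have "v < 2 ^ v"
      by (rule less_exp)
    also have "(2 :: nat) ^ v \<le> p ^ v"
      using p_gt_3 by (intro power_mono) auto
    finally show ?thesis
      using v True by simp
  next
    case False
    then have i: "i \<ge> 2" "e = 2"
      using assms by auto
    show ?thesis
    proof (rule ccontr)
      assume "\<not> v + e \<le> i"
      then have "i - 1 \<le> v"
        using i by simp
      then have "(5 :: nat) ^ (i - 1) \<le> 5 ^ v"
        by (intro power_increasing) auto
      also have "(5 :: nat) ^ v \<le> p ^ v"
        using p_ge_5 by (intro power_mono) auto
      finally show False
        using v lt_power_5[OF i(1)] by simp
    qed
  qed
  then have "P ^ i = P ^ v * (P ^ e * P ^ (i - v - e))"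
    by (simp flip: power_add)
  moreover have "of_nat (i + 1) = P ^ v * of_nat w"
    using arg_cong[OF w(1), of "of_nat :: nat \<Rightarrow> rat"] unfolding v_def[symmetric] by simp
  ultimately have "P ^ i / of_nat (i + 1) = P ^ e * (P ^ (i - v - e) * (1 / of_nat w))"
    by simp
  then show thesis
    by (rule that[rotated]) (intro zloc_mult zloc_power zloc_of_nat zloc_inverse_nat w)
qed

text \<open>The power sum \<Sum>k^n over k < p is (B_{n+1}(p) - B_{n+1}) / (n + 1); expanded in
  powers of p, its linear term is p B_n. Everything else is grouped so that only p B_j and p^i / (i
  + 1) occur.\<close>

lemma p_bernoulli_eq:
  "P * bernoulli n = (\<Sum>k<p. of_nat k ^ n) -
    (\<Sum>j<n. of_nat (n choose j) * (P * bernoulli j) * (P ^ (n - j) / of_nat (n - j + 1)))"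
proof -
  have eq: "{0..Suc n} = insert (Suc n) (insert n {..<n})"
    by auto
  have "of_nat (Suc n) * (\<Sum>k<p. of_nat k ^ n) = bernpoly (Suc n) P - bernoulli (Suc n)"
    by (simp add: bernpoly_of_nat)
  also have "\<dots> = of_nat (Suc n) * (P * bernoulli n) + (\<Sum>j<n. of_nat (Suc n choose j) * bernoulli j * P ^ (Suc n - j))"
    unfolding bernpoly_def eq by simp
  also have "(\<Sum>j<n. of_nat (Suc n choose j) * bernoulli j * P ^ (Suc n - j)) =
      of_nat (Suc n) * (\<Sum>j<n. of_nat (n choose j) * (P * bernoulli j) * (P ^ (n - j) / of_nat (n - j + 1)))"
    unfolding sum_distrib_left
  proof (intro sum.cong refl)
    fix j assume "j \<in> {..<n}"
    then have j: "Suc n - j = Suc (n - j)"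
      by auto
    have "Suc (n - j) * (Suc n choose j) = Suc n * (n choose j)"
      using binomial_absorb_comp[of "Suc n" j] unfolding j by simp
    then have "of_nat (Suc (n - j)) * of_nat (Suc n choose j) = (of_nat (Suc n) * of_nat (n choose j) :: rat)"
      by (metis of_nat_mult)
    moreover have "of_nat (Suc (n - j)) \<noteq> (0 :: rat)"
      by (simp only: of_nat_eq_0_iff)
    ultimately have "of_nat (Suc n choose j) = of_nat (Suc n) * of_nat (n choose j) / (of_nat (Suc (n - j)) :: rat)"
      by (simp add: eq_divide_eq mult.commute del: of_nat_Suc)
    then show "of_nat (Suc n choose j) * bernoulli j * P ^ (Suc n - j) =
        of_nat (Suc n) * (of_nat (n choose j) * (P * bernoulli j) * (P ^ (n - j) / of_nat (n - j + 1)))"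
      unfolding j by (simp del: of_nat_Suc)
  qed
  finally have "of_nat (Suc n) * (\<Sum>k<p. of_nat k ^ n) = of_nat (Suc n) * (P * bernoulli n +
      (\<Sum>j<n. of_nat (n choose j) * (P * bernoulli j) * (P ^ (n - j) / of_nat (n - j + 1))))"
    by (simp only: distrib_left)
  moreover have "of_nat (Suc n) \<noteq> (0 :: rat)"
    by (simp only: of_nat_eq_0_iff)
  ultimately show ?thesis
    by (simp only: mult_cancel_left) simp
qed

text \<open>A weak form of the von Staudt-Clausen theorem.\<close>

lemma zloc_p_bernoulli: "P * bernoulli n \<in> zloc p"
proof (induction n rule: less_induct)
  case (less n)
  have z: "P ^ i / of_nat (i + 1) \<in> zloc p" for i
    by (rule power_divide_Suc[of 0 i]) auto
  show ?case
    unfolding p_bernoulli_eq[of n]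
    by (intro zloc_diff zloc_sum zloc_mult zloc_power zloc_of_nat z less) auto
qed

lemma p_bernoulli_NN: "pcong 2 (P * bernoulli NN) (P - 1)"
proof -
  have 1: "pcong 2 (of_nat (NN choose j) * (P * bernoulli j) * (P ^ (NN - j) / of_nat (NN - j + 1))) 0"
    if j: "j \<in> {..<NN}" for j
  \<comment> \<open>For j = NN - 1 the quotient is only p/2, and the factor p^2 comes from the
    binomial coefficient, which is NN. For smaller j the quotient itself provides p^2.\<close>
  proof (cases "j = NN - 1")
    case True
    then have "NN choose j = NN" "NN - j = 1"
      using NN_ge binomial_symmetric[of j NN] by auto
    moreover obtain z where z: "z \<in> zloc p" "P ^ 1 / of_nat (1 + 1) = P ^ 0 * z"
      using power_divide_Suc[of 0 1] by auto
    ultimately have "of_nat (NN choose j) * (P * bernoulli j) * (P ^ (NN - j) / of_nat (NN - j + 1)) =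
        0 + P ^ 2 * (of_nat (p - 1) * (P * bernoulli j) * z)"
      by (simp only:) (simp add: NN_def)
    then show ?thesis
      by (rule pcongI) (intro zloc_mult zloc_of_nat zloc_p_bernoulli z)
  next
    case False
    then have "NN - j \<ge> 2"
      using j by auto
    then obtain z where z: "z \<in> zloc p" "P ^ (NN - j) / of_nat (NN - j + 1) = P ^ 2 * z"
      using power_divide_Suc[of 2 "NN - j"] by blast
    have "of_nat (NN choose j) * (P * bernoulli j) * (P ^ (NN - j) / of_nat (NN - j + 1)) =
        0 + P ^ 2 * (of_nat (NN choose j) * (P * bernoulli j) * z)"
      unfolding z(2) by simp
    then show ?thesis
      by (rule pcongI) (intro zloc_mult zloc_of_nat zloc_p_bernoulli z)
  qed
  have "{..<p} = insert 0 {1..p - 1}"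
    using p_gt_3 by auto
  then have "(\<Sum>k<p. of_nat k ^ NN) = (\<Sum>k=1..p - 1. of_nat k ^ NN :: rat)"
    using NN_ge by simp
  also have "pcong 2 \<dots> (\<Sum>k=1..p - 1. 1)"
  proof (rule pcong_sum)
    fix k assume "k \<in> {1..p - 1}"
    then have "\<not> p dvd k"
      by (intro not_dvd_less) auto
    from pcong_power_totient[OF this] show "pcong 2 (of_nat k ^ NN) 1"
      by (rule pcong_mono) simp
  qed
  finally have "pcong 2 ((\<Sum>k<p. of_nat k ^ NN) -
      (\<Sum>j<NN. of_nat (NN choose j) * (P * bernoulli j) * (P ^ (NN - j) / of_nat (NN - j + 1))))
     ((\<Sum>k=1..p - 1. 1) - (\<Sum>j<NN. 0))"
    by (intro pcong_diff pcong_sum 1)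
  then show ?thesis
    using p_gt_3 unfolding p_bernoulli_eq[symmetric] by (simp add: of_nat_diff)
qed

end

text \<open>Order 4 is what is needed for y divisible by p: the remainder y^5 then vanishes modulo
  p^5, the precision at which m^NN = 1 + p^3 l determines l modulo p^2.\<close>

lemma binomial_expansion_upto_4_Suc:
  fixes y :: rat
  assumes "(1 + y) ^ n = 1 + of_nat n * y + of_nat (n choose 2) * y ^ 2 + of_nat (n choose 3) * y ^ 3
    + of_nat (n choose 4) * y ^ 4 + y ^ 5 * w"
  shows "(1 + y) ^ Suc n = 1 + of_nat (Suc n) * y + of_nat (Suc n choose 2) * y ^ 2 + of_nat (Suc n choose 3) * y ^ 3
    + of_nat (Suc n choose 4) * y ^ 4 + y ^ 5 * (w * (1 + y) + of_nat (n choose 4))"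
proof -
  have b: "Suc n choose 2 = n + (n choose 2)" "Suc n choose 3 = (n choose 2) + (n choose 3)"
    "Suc n choose 4 = (n choose 3) + (n choose 4)"
    by (simp_all add: eval_nat_numeral)
  show ?thesis
    unfolding power_Suc assms b of_nat_add of_nat_Suc by (simp add: algebra_simps eval_nat_numeral)
qed

section \<open>Fermat quotients and \<open>T p\<close> at -1/m\<close>

context local_ring_gt3
begin

text \<open>\<open>plog m L\<close>: modulo \<open>p\<^sup>2\<close>, \<open>L\<close> is the \<open>p\<close>-adic number \<open>log (m ^ (p - 1)) / p\<close>.\<close>

definition plog :: "nat \<Rightarrow> rat \<Rightarrow> bool" where
  "plog m L \<longleftrightarrow> (\<exists>q\<in>zloc p. of_nat m ^ (p - 1) = 1 + P * q \<and> pcong 2 L (q - P * (q ^ 2 / 2)))"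

lemma half_zloc: "x \<in> zloc p \<Longrightarrow> x / 2 \<in> zloc p"
  using zloc_divide_nat[of x 2] not_dvd_2_3(1) by simp

lemma plog_exists:
  assumes "\<not> p dvd m"
  obtains L where "plog m L"
proof -
  have "pcong 1 (of_nat (m ^ (p - 1))) (of_nat 1)"
    using fermat_theorem[OF prime_p assms] by (intro pcong_of_nat) simp
  then obtain q where "q \<in> zloc p" "of_nat (m ^ (p - 1)) = (of_nat 1 :: rat) + P ^ 1 * q"
    by (rule pcongE)
  then have "plog m (q - P * (q ^ 2 / 2))"
    unfolding plog_def by (intro bexI[of _ q]) auto
  then show thesis
    by (rule that)
qed

lemma plog_zloc: "plog m L \<Longrightarrow> L \<in> zloc p"
  unfolding plog_def using half_zloc pcong_zloc by (meson zloc_diff zloc_mult zloc_of_nat zloc_power)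

text \<open>Additivity of the logarithm: 1 + P w = (1 + P q) (1 + P r) determines w, and the
  truncated logarithms then agree up to a multiple of P^2.\<close>

lemma plog_mult:
  assumes "plog a K" "plog b L"
  shows "plog (a * b) (K + L)"
proof -
  obtain q r where q: "q \<in> zloc p" "of_nat a ^ (p - 1) = 1 + P * q" "pcong 2 K (q - P * (q ^ 2 / 2))"
    and r: "r \<in> zloc p" "of_nat b ^ (p - 1) = 1 + P * r" "pcong 2 L (r - P * (r ^ 2 / 2))"
    using assms unfolding plog_def by blast
  define w where "w = q + r + P * (q * r)"
  have w: "w \<in> zloc p"
    unfolding w_def using q r by auto
  have "of_nat (a * b) ^ (p - 1) = (1 + P * q) * (1 + P * r)"
    unfolding of_nat_mult power_mult_distrib q(2) r(2) ..
  then have 1: "of_nat (a * b) ^ (p - 1) = 1 + P * w"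
    by (simp add: w_def algebra_simps)
  have "pcong 2 (K + L) (q - P * (q ^ 2 / 2) + (r - P * (r ^ 2 / 2)))"
    by (intro pcong_add q r)
  also have "q - P * (q ^ 2 / 2) + (r - P * (r ^ 2 / 2)) =
      w - P * (w ^ 2 / 2) + P ^ 2 * (q * r * (q + r) + P * (q * r) ^ 2 / 2)"
    unfolding w_def by (simp add: field_simps power2_eq_square)
  also have "pcong 2 \<dots> (w - P * (w ^ 2 / 2))"
    using q r by (intro pcongI[OF refl] zloc_add zloc_mult half_zloc zloc_power zloc_of_nat)
  finally show ?thesis
    unfolding plog_def using w 1 by blast
qed

text \<open>As NN = p^2 (p - 1), m^NN is the p^2-th power of exp(p L), that is exp(p^3 L); its
  quadratic term already carries p^6.\<close>

lemma power_NN_plog: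
  assumes "plog m L"
  obtains l where "of_nat m ^ NN = 1 + P ^ 3 * l" "pcong 2 l L"
proof -
  obtain q where q: "q \<in> zloc p" "of_nat m ^ (p - 1) = 1 + P * q" "pcong 2 L (q - P * (q ^ 2 / 2))"
    using assms unfolding plog_def by blast
  define n where "n = p\<^sup>2"
  define y where "y = P * q"
  have "\<exists>w\<in>zloc p. (1 + y) ^ n = 1 + of_nat n * y + of_nat (n choose 2) * y ^ 2 + of_nat (n choose 3) * y ^ 3
     + of_nat (n choose 4) * y ^ 4 + y ^ 5 * w" for n
  proof (induction n)
    case (Suc n)
    then obtain w where "w \<in> zloc p" "(1 + y) ^ n = 1 + of_nat n * y + of_nat (n choose 2) * y ^ 2 +
        of_nat (n choose 3) * y ^ 3 + of_nat (n choose 4) * y ^ 4 + y ^ 5 * w"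
      by blast
    moreover have "y \<in> zloc p"
      unfolding y_def using q by auto
    ultimately show ?case
      using binomial_expansion_upto_4_Suc[of y n w]
      by (intro bexI[of _ "w * (1 + y) + of_nat (n choose 4)"]) (auto simp del: power_Suc of_nat_Suc)
  next
    case 0
    show ?case
      by (intro bexI[of _ 0]) (simp_all add: binomial_eq_0)
  qed
  then obtain w where w: "w \<in> zloc p" "(1 + y) ^ n = 1 + of_nat n * y + of_nat (n choose 2) * y ^ 2 +
      of_nat (n choose 3) * y ^ 3 + of_nat (n choose 4) * y ^ 4 + y ^ 5 * w"
    by blast
  \<comment> \<open>Absorption exposes the factor n = p^2; the remaining denominators k are at most
    4, hence prime to p.\<close>
  have b: "of_nat (n choose k) = P ^ 2 * (of_nat ((n - 1) choose (k - 1)) * (1 / of_nat k))" if "k > 0" for k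
  proof -
    have "k * (n choose k) = n * ((n - 1) choose (k - 1))"
      using that times_binomial_minus1_eq[of k n] by simp
    then have "of_nat k * of_nat (n choose k) = (of_nat n * of_nat ((n - 1) choose (k - 1)) :: rat)"
      by (metis of_nat_mult)
    then show ?thesis
      using that by (simp add: field_simps n_def)
  qed
  have b2: "of_nat (n choose 2) = P ^ 2 * ((P ^ 2 - 1) / 2)"
    using b[of 2] p_gt_3 by (simp add: n_def of_nat_diff)
  define b3 b4 where "b3 = of_nat ((n - 1) choose 2) * (1 / of_nat 3 :: rat)"
    and "b4 = of_nat ((n - 1) choose 3) * (1 / of_nat 4 :: rat)"
  have "\<not> p dvd 4"
    using p_ge_5 by (auto dest: dvd_imp_le)
  then have z: "b3 \<in> zloc p" "b4 \<in> zloc p"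
    unfolding b3_def b4_def using not_dvd_2_3 by (intro zloc_mult zloc_of_nat zloc_inverse_nat; simp)+
  have b34: "of_nat (n choose 3) = P ^ 2 * b3" "of_nat (n choose 4) = P ^ 2 * b4"
    using b[of 3] b[of 4] unfolding b3_def b4_def by simp_all
  define l where "l = q - P * (q ^ 2 / 2) + P ^ 2 * (P * (q ^ 2 / 2) + b3 * q ^ 3 + P * (b4 * q ^ 4) + q ^ 5 * w)"
  have "of_nat m ^ NN = (of_nat m ^ (p - 1)) ^ n"
    by (simp add: NN_def n_def mult.commute flip: power_mult)
  also have "\<dots> = (1 + y) ^ n"
    unfolding q(2) y_def ..
  also have "\<dots> = 1 + P ^ 3 * l"
    unfolding w(2) unfolding b2 b34 unfolding y_def l_def n_def
    by (simp add: field_simps eval_nat_numeral)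
  finally have 1: "of_nat m ^ NN = 1 + P ^ 3 * l" .
  have "pcong 2 l (q - P * (q ^ 2 / 2))"
    unfolding l_def using q w z
    by (intro pcongI[OF refl] zloc_add zloc_mult half_zloc zloc_power zloc_of_nat)
  then have "pcong 2 l L"
    using q(3) pcong_sym pcong_trans by blast
  with 1 show thesis
    by (rule that)
qed

text \<open>This combines the multiplication theorem for Bernoulli polynomials with the value of
  \<open>p B_N\<close> modulo \<open>p\<^sup>2\<close>.\<close>

lemma sum_T_plog:
  assumes m: "\<not> p dvd m" and L: "plog m L"
  shows "pcong 2 (\<Sum>j<m. T p (- (of_nat j / of_nat m))) (- of_nat m * L)"
proof -
  let ?S = "\<Sum>j<m. T p (- (of_nat j / of_nat m))"
  have m0: "m > 0"
    using m by (cases "m = 0") auto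
  obtain l where l: "of_nat m ^ NN = 1 + P ^ 3 * l" "pcong 2 l L"
    using L by (rule power_NN_plog)
  have NN: "of_nat NN = P ^ 2 * (P - 1)"
    using p_gt_3 by (simp add: NN_def of_nat_diff)
  have S: "of_nat NN * ?S = (\<Sum>j<m. bernpoly NN (of_nat j / of_nat m)) - of_nat m * bernoulli NN"
    using NN_ge unfolding sum_distrib_left T_def NN_def[symmetric] by (simp add: sum_subtractf)
  have "of_nat NN * ?S * of_nat m ^ NN = of_nat m * bernoulli NN * (1 - of_nat m ^ NN)"
    unfolding S using bernpoly_multiplication[OF m0, of NN] by (simp add: algebra_simps)
  \<comment> \<open>Of the factor p^3 in m^NN - 1, one p clears the denominator of the Bernoulli
    number and p^2 cancels against NN.\<close>
  then have "P ^ 2 * ((P - 1) * of_nat m ^ NN * ?S) = P ^ 2 * (- of_nat m * l * (P * bernoulli NN))"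
    unfolding NN using l(1) by (simp add: algebra_simps eval_nat_numeral)
  moreover have "P ^ 2 \<noteq> 0"
    by simp
  ultimately have *: "(P - 1) * of_nat m ^ NN * ?S = - of_nat m * l * (P * bernoulli NN)"
    using mult_left_cancel by blast
  have Lz: "L \<in> zloc p" and lz: "l \<in> zloc p"
    using plog_zloc[OF L] pcong_zloc[OF l(2)] by auto
  have mN: "pcong 2 (of_nat m ^ NN) 1"
    using pcong_power_totient[OF m] by (rule pcong_mono) simp
  have "pcong 2 (- of_nat m * l * (P * bernoulli NN)) (- of_nat m * L * (P - 1))"
    using Lz lz p_bernoulli_NN l(2) by (intro pcong_mult pcong_mult_left) auto
  also have "pcong 2 (- of_nat m * L * (P - 1)) (- of_nat m * L * ((P - 1) * of_nat m ^ NN))"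
  proof -
    have "pcong 2 ((P - 1) * 1) ((P - 1) * of_nat m ^ NN)"
      by (rule pcong_mult_left[OF pcong_sym[OF mN]]) auto
    then have "pcong 2 (P - 1) ((P - 1) * of_nat m ^ NN)"
      by simp
    then show ?thesis
      using Lz by (intro pcong_mult_left zloc_mult zloc_minus) auto
  qed
  also have "- of_nat m * L * ((P - 1) * of_nat m ^ NN) = (P - 1) * of_nat m ^ NN * (- of_nat m * L)"
    by simp
  finally have **: "pcong 2 ((P - 1) * of_nat m ^ NN * ?S) ((P - 1) * of_nat m ^ NN * (- of_nat m * L))"
    unfolding * .
  have u: "(P - 1) * of_nat m ^ NN = of_nat ((p - 1) * m ^ NN)"
    using p_gt_3 by (simp add: of_nat_diff)
  have "\<not> p dvd p - 1"
    using p_gt_3 by (intro not_dvd_less) auto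
  then have nd: "\<not> p dvd (p - 1) * m ^ NN"
    using m prime_dvd_mult_iff[OF prime_p] prime_dvd_power[OF prime_p] by blast
  then have "(p - 1) * m ^ NN \<noteq> 0"
    by (metis dvd_0_right)
  then show ?thesis
    using pcong_cancel[OF **[unfolded u]] zloc_inverse_nat[OF nd] by (simp only: of_nat_eq_0_iff simp_thms)
qed

text \<open>Identifies the summands j and m - j of the multiplication theorem, so that each fraction
  -1/m is met twice for m > 2.\<close>

lemma T_reflect: "T p (x - 1) = T p (- x)"
  unfolding T_def NN_def[symmetric] using bernpoly_reflect[of NN x] even_NN by simp

lemma T_0: "T p 0 = 0"
  by (simp add: T_def bernpoly_at_0)

lemma T_half: "plog 2 L \<Longrightarrow> pcong 2 (T p (-1/2)) (- (2 * L))"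
  using sum_T_plog[OF not_dvd_2_3(1)] by (simp add: lessThan_Suc eval_nat_numeral T_0)

lemma T_third: "plog 3 L \<Longrightarrow> pcong 2 (2 * T p (-1/3)) (- (3 * L))"
  using sum_T_plog[OF not_dvd_2_3(2)] T_reflect[of "1/3"] by (simp add: lessThan_Suc eval_nat_numeral T_0)

lemma not_dvd_4_6: "\<not> p dvd 4" "\<not> p dvd 6"
  using not_dvd_2_3 prime_dvd_mult_iff[OF prime_p, of 2 2] prime_dvd_mult_iff[OF prime_p, of 2 3] by auto

text \<open>Only j = 1 and j = 3 are primitive among the fractions j/4; removing j = 2 leaves - 8 L
  + 2 L. The 6 matches 64 = 2^6.\<close>

lemma T_fourth:
  assumes L: "plog 2 L"
  shows "pcong 2 (2 * T p (-1/4)) (- (6 * L))"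
proof -
  have "plog 4 (L + L)"
    using plog_mult[OF L L] by simp
  from sum_T_plog[OF not_dvd_4_6(1) this]
  have "pcong 2 (2 * T p (-1/4) + T p (-1/2)) (- (8 * L))"
    using T_reflect[of "1/4"] by (simp add: lessThan_Suc lessThan_nat_numeral T_0)
  then have "pcong 2 (2 * T p (-1/4) + T p (-1/2) - T p (-1/2)) (- (8 * L) - - (2 * L))"
    by (intro pcong_diff T_half L)
  then show ?thesis
    by simp
qed

text \<open>Removing the halves and thirds from the sum over j/6 leaves 6 (L + K) - 2 L - 3 K = 4 L
  + 3 K, which matches 432 = 2^4 3^3.\<close>

lemma T_sixth:
  assumes L: "plog 2 L" and K: "plog 3 K"
  shows "pcong 2 (2 * T p (-1/6)) (- (4 * L + 3 * K))"
proof -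
  have "plog 6 (L + K)"
    using plog_mult[OF L K] by simp
  from sum_T_plog[OF not_dvd_4_6(2) this]
  have "pcong 2 (2 * T p (-1/6) + 2 * T p (-1/3) + T p (-1/2)) (- (6 * (L + K)))"
    using T_reflect[of "1/6"] T_reflect[of "1/3"]
    by (simp add: lessThan_Suc lessThan_nat_numeral T_0 algebra_simps)
  then have "pcong 2 (2 * T p (-1/6) + 2 * T p (-1/3) + T p (-1/2) - 2 * T p (-1/3) - T p (-1/2))
      (- (6 * (L + K)) - - (3 * K) - - (2 * L))"
    by (intro pcong_diff T_half T_third L K)
  then show ?thesis
    by (simp add: algebra_simps)
qed

text \<open>The bracket is exp(2 P \<tau>) = exp(- P L) to the required order, while M^(p - 1) =
  exp(P L).\<close>

lemma power_p_plog:
  assumes M: "plog M L" and \<tau>: "pcong 2 (2 * \<tau>) (- L)"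
  shows "pcong 3 (of_nat M ^ p * (1 + 2 * P * \<tau> + 2 * P ^ 2 * \<tau> ^ 2)) (of_nat M)"
proof -
  obtain q where q: "q \<in> zloc p" "of_nat M ^ (p - 1) = 1 + P * q" "pcong 2 L (q - P * (q ^ 2 / 2))"
    using M unfolding plog_def by blast
  have "pcong 2 (2 * \<tau>) (- (q - P * (q ^ 2 / 2)))"
    using \<tau> pcong_minus[OF q(3)] by (rule pcong_trans)
  then obtain e where e: "e \<in> zloc p" "2 * \<tau> = - (q - P * (q ^ 2 / 2)) + P ^ 2 * e"
    by (rule pcongE)
  define f where "f = (q ^ 2 / 2 + P * e)"
  have f: "f \<in> zloc p"
    unfolding f_def using e q by (intro zloc_add zloc_mult half_zloc zloc_power zloc_of_nat)
  have \<tau>f: "2 * \<tau> = - q + P * f"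
    unfolding e(2) f_def by (simp add: algebra_simps power2_eq_square)
  have "1 + 2 * P * \<tau> + 2 * P ^ 2 * \<tau> ^ 2 = 1 + P * (2 * \<tau>) + P ^ 2 * ((2 * \<tau>) ^ 2 / 2)"
    by (simp add: power2_eq_square)
  also have "\<dots> = 1 + P * (- q + P * f) + P ^ 2 * ((- q + P * f) ^ 2 / 2)"
    unfolding \<tau>f ..
  \<comment> \<open>These are the first terms of 1 / (1 + P q), so the product with M^(p - 1) = 1 +
    P q leaves only P^3 q^3 and the error term.\<close>
  also have "\<dots> = 1 - P * q + P ^ 2 * q ^ 2 + P ^ 3 * (e - q * f + P * f ^ 2 / 2)"
    unfolding f_def by (simp add: field_simps eval_nat_numeral)
  finally have 1: "1 + 2 * P * \<tau> + 2 * P ^ 2 * \<tau> ^ 2 = 1 - P * q + P ^ 2 * q ^ 2 + P ^ 3 * (e - q * f + P * f ^ 2 / 2)" .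
  have "of_nat M ^ p = of_nat M * (1 + P * q)"
    using q(2) p_gt_3 by (metis One_nat_def Suc_pred p_pos(1) power_Suc)
  then have "of_nat M ^ p * (1 + 2 * P * \<tau> + 2 * P ^ 2 * \<tau> ^ 2) =
      of_nat M + P ^ 3 * (of_nat M * (q ^ 3 + (1 + P * q) * (e - q * f + P * f ^ 2 / 2)))"
    unfolding 1 by (simp add: field_simps eval_nat_numeral)
  then show ?thesis
    by (rule pcongI)
      (intro zloc_add zloc_diff zloc_mult half_zloc zloc_power zloc_of_nat zloc_numeral f e q)
qed

section \<open>Factorials of multiples of p modulo p^3\<close>

text \<open>The order of quantifiers is essential: \<open>c\<close> is chosen before x, so that it
  can be determined at one x and used at another. Only the remainder r may vary with x.\<close>

lemma prod_one_plus_expand: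
  assumes "n < p"
  shows "\<exists>c\<in>zloc p. \<forall>x\<in>zloc p. \<exists>r\<in>zloc p. (\<Prod>i=1..n. 1 + x * (1 / of_nat i)) = 1 + harm1 n * x + c * x ^ 2 + x ^ 3 * r"
  using assms
proof (induction n)
  case 0
  show ?case
    by (intro bexI[of _ 0] ballI) (simp_all add: harm_0)
next
  case (Suc n)
  define u where "u = 1 / (of_nat (Suc n) :: rat)"
  have u: "u \<in> zloc p"
    unfolding u_def by (rule zloc_inverse_less[OF Suc.prems])
  have h: "harm1 n \<in> zloc p"
    using harm_zloc[of n] Suc.prems by simp
  obtain c where c: "c \<in> zloc p"
    "\<And>x. x \<in> zloc p \<Longrightarrow> \<exists>r\<in>zloc p. (\<Prod>i=1..n. 1 + x * (1 / of_nat i)) = 1 + harm1 n * x + c * x ^ 2 + x ^ 3 * r"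
    using Suc by auto
  show ?case
  proof (rule bexI[of _ "c + harm1 n * u"], rule ballI)
    fix x assume x: "x \<in> zloc p"
    then obtain r where r: "r \<in> zloc p" "(\<Prod>i=1..n. 1 + x * (1 / of_nat i)) = 1 + harm1 n * x + c * x ^ 2 + x ^ 3 * r"
      using c by blast
    have "(\<Prod>i=1..Suc n. 1 + x * (1 / of_nat i)) = (1 + harm1 n * x + c * x ^ 2 + x ^ 3 * r) * (1 + x * u)"
      using r(2) by (simp add: u_def)
    also have "\<dots> = 1 + harm1 (Suc n) * x + (c + harm1 n * u) * x ^ 2 + x ^ 3 * (r + c * u + x * r * u)"
      unfolding harm_Suc u_def[symmetric] by (simp add: algebra_simps eval_nat_numeral)
    finally show "\<exists>r\<in>zloc p. (\<Prod>i=1..Suc n. 1 + x * (1 / of_nat i)) = 1 + harm1 (Suc n) * x + (c + harm1 n * u) * x ^ 2 + x ^ 3 * r"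
      using r(1) c(1) u x by (intro bexI[of _ "r + c * u + x * r * u"]) (assumption, intro zloc_add zloc_mult)
  qed (intro zloc_add zloc_mult c h u)
qed

text \<open>The quadratic coefficient of \<open>\<Prod>i. 1 + x / i\<close> is read off from its value \<open>1\<close> at \<open>x = - p\<close>.\<close>

lemma prod_one_plus_pcong:
  assumes t: "t \<in> zloc p"
  shows "pcong 3 (\<Prod>i=1..p - 1. 1 + P * t * (1 / of_nat i)) 1"
proof -
  let ?f = "\<lambda>x. \<Prod>i=1..p - 1. 1 + x * (1 / of_nat i) :: rat"
  define h where "h = harm1 (p - 1)"
  have "p - 1 < p"
    using p_gt_3 by simp
  then obtain c where c: "c \<in> zloc p"
    "\<And>x. x \<in> zloc p \<Longrightarrow> \<exists>r\<in>zloc p. ?f x = 1 + h * x + c * x ^ 2 + x ^ 3 * r"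
    using prod_one_plus_expand[of "p - 1"] unfolding h_def by blast
  obtain k where k: "k \<in> zloc p" "h = 0 + P ^ 2 * k"
    using harm1_pcong_0 unfolding h_def by (rule pcongE)
  have "?f (- P) = (\<Prod>i=1..p - 1. - (of_nat (p - i) / of_nat i))"
  proof (intro prod.cong refl)
    fix i assume "i \<in> {1..p - 1}"
    then have "i > 0" "i \<le> p"
      by auto
    then show "1 + - P * (1 / of_nat i) = - (of_nat (p - i) / of_nat i)"
      by (simp add: field_simps of_nat_diff)
  qed
  also have "\<dots> = (-1) ^ (p - 1) * ((\<Prod>i=1..p - 1. of_nat (p - 1 + 1 - i)) / (\<Prod>i=1..p - 1. of_nat i))"
    using p_gt_3 by (simp add: prod_uminus prod_dividef)
  also have "(\<Prod>i=1..p - 1. of_nat (p - 1 + 1 - i)) = (\<Prod>i=1..p - 1. of_nat i :: rat)"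
    by (rule prod.atLeastAtMost_rev[symmetric])
  finally have f: "?f (- P) = 1"
    using odd_p by simp
  obtain r where r: "r \<in> zloc p" "?f (- P) = 1 + h * (- P) + c * (- P) ^ 2 + (- P) ^ 3 * r"
    using c(2)[of "- P"] by auto
  then have cP: "c * P ^ 2 = P ^ 3 * (k + r)"
    unfolding f k by (simp add: algebra_simps eval_nat_numeral)
  obtain r' where r': "r' \<in> zloc p" "?f (P * t) = 1 + h * (P * t) + c * (P * t) ^ 2 + (P * t) ^ 3 * r'"
    using c(2)[of "P * t"] t by auto
  have "?f (P * t) = 1 + h * (P * t) + (c * P ^ 2) * t ^ 2 + P ^ 3 * (t ^ 3 * r')"
    unfolding r'(2) by (simp add: power_mult_distrib)
  also have "\<dots> = 1 + P ^ 3 * (k * t + (k + r) * t ^ 2 + t ^ 3 * r')"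
    unfolding cP k by (simp add: algebra_simps eval_nat_numeral)
  finally show ?thesis
    by (rule pcongI) (intro zloc_add zloc_mult zloc_power t k r r')
qed

lemma fact_add_prod: "fact (n + q) = fact n * (\<Prod>i=1..q. of_nat (n + i) :: rat)"
  by (induction q) (simp_all add: mult_ac del: of_nat_Suc of_nat_add)

text \<open>The factors between n p and (n + 1) p contribute (n + 1) p! times the product of 1 + p n
  / i, which is 1 modulo p^3. In a multinomial coefficient the powers of p! cancel, so up to such
  units it equals the one with p replaced by 1.\<close>

lemma fact_multiple_p: "\<exists>w. pcong 3 w 1 \<and> fact (n * p) = fact n * fact p ^ n * w"
proof (induction n)
  case (Suc n)
  then obtain w where w: "pcong 3 w 1" "fact (n * p) = fact n * fact p ^ n * w"
    by blast
  define v where "v = (\<Prod>i=1..p - 1. 1 + P * of_nat n * (1 / of_nat i))"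
  have v: "pcong 3 v 1"
    unfolding v_def by (rule prod_one_plus_pcong) auto
  have p: "p = Suc (p - 1)"
    using p_gt_3 by simp
  have fp: "(fact p :: rat) = P * (\<Prod>i=1..p - 1. of_nat i)"
    by (subst p, subst fact_Suc) (simp add: fact_prod flip: p)
  have "(\<Prod>i=1..p. of_nat (n * p + i) :: rat) = of_nat (n * p + p) * (\<Prod>i=1..p - 1. of_nat (n * p + i))"
  proof -
    have "{1..p} = insert p {1..p - 1}" "p \<notin> {1..p - 1}"
      using p_gt_3 by auto
    then show ?thesis
      by simp
  qed
  also have "(\<Prod>i=1..p - 1. of_nat (n * p + i) :: rat) = (\<Prod>i=1..p - 1. of_nat i * (1 + P * of_nat n * (1 / of_nat i)))"
    by (intro prod.cong) (auto simp: field_simps)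
  also have "\<dots> = (\<Prod>i=1..p - 1. of_nat i) * v"
    unfolding v_def by (rule prod.distrib)
  also have "of_nat (n * p + p) * \<dots> = of_nat (Suc n) * fact p * v"
    unfolding fp by (simp add: algebra_simps)
  finally have "fact (n * p + p) = fact (n * p) * (of_nat (Suc n) * fact p * v)"
    unfolding fact_add_prod by simp
  also have "\<dots> = fact (Suc n) * fact p ^ Suc n * (w * v)"
    unfolding w(2) by (simp add: mult_ac del: of_nat_Suc)
  finally have "fact (Suc n * p) = fact (Suc n) * fact p ^ Suc n * (w * v)"
    by (simp add: add.commute)
  moreover have "pcong 3 (w * v) (1 * 1)"
    using w v by (intro pcong_mult) auto
  ultimately show ?case
    by auto
qed (auto intro: exI[of _ 1])

text \<open>For -1/4 and -1/6 factorials of 2 p and 3 p stay in the denominator and leave a factor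
  near 1 beside g. Removing it requires that g be integral, which is not evident from the factorials
  but follows from \<open>zloc_gbinomial_p\<close>.\<close>

lemma pcong_of_unit_mult:
  assumes "c * w = g * v" "pcong 3 w 1" "pcong 3 v 1" "c \<in> zloc p" "g \<in> zloc p"
  shows "pcong 3 g c"
proof -
  have "pcong 3 (g * 1) (g * v)"
    using assms(5) by (rule pcong_mult_left[OF pcong_sym[OF assms(3)]])
  also have "pcong 3 (g * v) (c * 1)"
    unfolding assms(1)[symmetric] using assms(2,4) by (rule pcong_mult_left)
  finally show ?thesis
    by simp
qed

lemma neg_inverse_zloc: "\<not> p dvd m \<Longrightarrow> - (of_nat j / of_nat m) \<in> zloc p"
  by (intro zloc_minus zloc_divide_nat) auto

lemma gbinomials_half: "pcong 3 (16 ^ p * (((-1/2) gchoose p) * ((-1 - (-1/2)) gchoose p))) 4"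
proof -
  define b where "b = (-1/2 :: rat) gchoose p"
  obtain w where w: "pcong 3 w 1" "fact (2 * p) = fact 2 * fact p ^ 2 * w"
    using fact_multiple_p[of 2] by blast
  have "(- 4) ^ p * fact p ^ 2 * b = fact (2 * p)"
    unfolding b_def by (rule fact_double_gbinomial[symmetric])
  then have "fact p ^ 2 * ((- 4) ^ p * b) = fact p ^ 2 * (2 * w)"
    unfolding w(2) by (simp add: mult_ac)
  then have b: "(- 4) ^ p * b = 2 * w"
    by simp
  have "16 ^ p * (((-1/2) gchoose p) * ((-1 - (-1/2)) gchoose p)) = ((- 4) ^ p * b) * ((- 4) ^ p * b)"
    by (simp add: b_def flip: power_mult_distrib mult.assoc)
  moreover have "pcong 3 ((2 * w) * (2 * w)) ((2 * 1) * (2 * 1))"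
    using w(1) by (intro pcong_mult pcong_mult_left) auto
  ultimately show ?thesis
    unfolding b by simp
qed

lemma gbinomials_third: "pcong 3 (27 ^ p * (((-1/3) gchoose p) * ((-1 - (-1/3)) gchoose p))) 6"
proof -
  define g where "g = 27 ^ p * (((-1/3 :: rat) gchoose p) * ((-2/3) gchoose p))"
  obtain w where w: "pcong 3 w 1" "fact (3 * p) = fact 3 * fact p ^ 3 * w"
    using fact_multiple_p[of 3] by blast
  have "fact p ^ 3 * g = fact (3 * p)"
    unfolding g_def fact_triple_gbinomial by simp
  then have "fact p ^ 3 * g = fact p ^ 3 * (6 * w)"
    unfolding w(2) by (simp add: mult_ac fact_numeral)
  then have "g = 6 * w"
    by simp
  moreover have "pcong 3 (6 * w) (6 * 1)"
    using w(1) by (intro pcong_mult_left) auto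
  ultimately show ?thesis
    by (simp add: g_def)
qed

lemma gbinomials_fourth: "pcong 3 (64 ^ p * (((-1/4) gchoose p) * ((-1 - (-1/4)) gchoose p))) 12"
proof -
  define g where "g = 64 ^ p * (((-1/4 :: rat) gchoose p) * ((-3/4) gchoose p))"
  have "(-1/4 :: rat) \<in> zloc p" "(-3/4 :: rat) \<in> zloc p"
    using neg_inverse_zloc[OF not_dvd_4_6(1), of 1] neg_inverse_zloc[OF not_dvd_4_6(1), of 3] by simp_all
  then have gz: "g \<in> zloc p"
    unfolding g_def by (intro zloc_mult zloc_power zloc_numeral zloc_gbinomial_p)
  obtain w where w: "pcong 3 w 1" "fact (4 * p) = fact 4 * fact p ^ 4 * w"
    using fact_multiple_p[of 4] by blast
  obtain v where v: "pcong 3 v 1" "fact (2 * p) = fact 2 * fact p ^ 2 * v"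
    using fact_multiple_p[of 2] by blast
  have "g * (fact (2 * p) * fact p ^ 2) = fact (4 * p)"
    unfolding g_def fact_quadruple_gbinomial by simp
  then have "(2 * fact p ^ 4) * (g * v) = (2 * fact p ^ 4) * (12 * w)"
    unfolding w(2) v(2) by (simp add: fact_numeral eval_nat_numeral mult_ac)
  then have "12 * w = g * v"
    by simp
  then have "pcong 3 g 12"
    using w v gz by (intro pcong_of_unit_mult[of 12 w g v]) auto
  then show ?thesis
    by (simp add: g_def)
qed

lemma gbinomials_sixth: "pcong 3 (432 ^ p * (((-1/6) gchoose p) * ((-1 - (-1/6)) gchoose p))) 60"
proof -
  define g where "g = 432 ^ p * (((-1/6 :: rat) gchoose p) * ((-5/6) gchoose p))"
  have "(-1/6 :: rat) \<in> zloc p" "(-5/6 :: rat) \<in> zloc p"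
    using neg_inverse_zloc[OF not_dvd_4_6(2), of 1] neg_inverse_zloc[OF not_dvd_4_6(2), of 5] by simp_all
  then have gz: "g \<in> zloc p"
    unfolding g_def by (intro zloc_mult zloc_power zloc_numeral zloc_gbinomial_p)
  obtain w where w: "pcong 3 w 1" "fact (6 * p) = fact 6 * fact p ^ 6 * w"
    using fact_multiple_p[of 6] by blast
  obtain v where v: "pcong 3 v 1" "fact (2 * p) = fact 2 * fact p ^ 2 * v"
    using fact_multiple_p[of 2] by blast
  obtain u where u: "pcong 3 u 1" "fact (3 * p) = fact 3 * fact p ^ 3 * u"
    using fact_multiple_p[of 3] by blast
  have "g * (fact (3 * p) * fact (2 * p) * fact p) = fact (6 * p)"
    unfolding g_def fact_sextuple_gbinomial by simp
  then have "(12 * fact p ^ 6) * (g * (u * v)) = (12 * fact p ^ 6) * (60 * w)"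
    unfolding w(2) v(2) u(2) by (simp add: fact_numeral eval_nat_numeral mult_ac)
  then have "60 * w = g * (u * v)"
    by simp
  moreover have "pcong 3 (u * v) (1 * 1)"
    using u v by (intro pcong_mult) auto
  ultimately have "pcong 3 g 60"
    using w gz by (intro pcong_of_unit_mult[of 60 w g "u * v"]) auto
  then show ?thesis
    by (simp add: g_def)
qed

section \<open>The four special values\<close>

lemma inverse_power_p_minus_3:
  assumes "\<not> p dvd m"
  shows "pcong 1 (1 / of_nat m ^ (p - 3)) (of_nat m ^ 2)"
proof -
  have "m \<noteq> 0"
    using assms by (metis dvd_0_right)
  have "pcong 1 (1 / of_nat m ^ (p - 3)) (1 / (1 / of_nat m ^ 2))"
    using assms \<open>m \<noteq> 0\<close> by (intro pcong_inverse pcong_power_p_minus_3 zloc_inverse_power) auto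
  then show ?thesis
    by simp
qed

lemma residue_neg_inverse:
  assumes "\<not> p dvd m" "m * a + 1 = p * r" "a < p"
  shows "residue p (- (1 / of_nat m)) = a"
proof (rule residueI)
  show "- (1 / of_nat m) \<in> zloc p"
    using neg_inverse_zloc[OF assms(1), of 1] by simp
  have "m \<noteq> 0"
    using assms by (metis dvd_0_right)
  moreover have "of_nat m * of_nat a + 1 = P * of_nat r"
    using arg_cong[OF assms(2), of "of_nat :: nat \<Rightarrow> rat"] by simp
  ultimately have "- (1 / of_nat m) = of_nat a + P ^ 1 * (- (of_nat r / of_nat m))"
    by (simp add: field_simps)
  then show "pcong 1 (- (1 / of_nat m)) (of_nat a)"
    by (rule pcongI) (rule neg_inverse_zloc[OF assms(1)])
qed fact

text \<open>The common last step: multiplied by M^p, the exponential part becomes M, the binomial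
  part becomes c, and in the Euler term, which carries p^2, M^p may be replaced by M according to
  Fermat.\<close>

lemma scaled_G_pcong:
  assumes x: "x \<in> zloc p" and L: "plog M L" and T: "pcong 2 (2 * T p x) (- L)"
    and g: "pcong 3 (of_nat M ^ p * ((x gchoose p) * ((-1 - x) gchoose p))) (of_nat c)"
    and a: "(-1 :: rat) ^ residue p x = (-1) ^ b"
    and e: "pcong 1 (of_nat M * eulerpoly (p - 3) (- x)) (of_nat k * of_int e)"
  shows "loc_cong p (of_nat M ^ p * G p x) (of_nat M - of_nat c + of_nat k * (-1) ^ b * P ^ 2 * of_int e) (p ^ 3)"
proof -
  let ?E = "eulerpoly (p - 3) (- x)" and ?g = "(x gchoose p) * ((-1 - x) gchoose p)"
  have "pcong 3 (G p x) (1 - ?g + 2 * P * T p x + 2 * P ^ 2 * T p x ^ 2 + P ^ 2 * (-1) ^ residue p x * ?E)"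
    using G_pcong[OF x] unfolding loc_cong_iff by blast
  then have "pcong 3 (of_nat M ^ p * G p x)
      (of_nat M ^ p * (1 - ?g + 2 * P * T p x + 2 * P ^ 2 * T p x ^ 2 + P ^ 2 * (-1) ^ residue p x * ?E))"
    by (rule pcong_mult_left) auto
  also have "\<dots> = of_nat M ^ p * (1 + 2 * P * T p x + 2 * P ^ 2 * T p x ^ 2) - of_nat M ^ p * ?g +
      (-1) ^ b * (P ^ 2 * (of_nat M ^ p * ?E))"
    unfolding a by (simp add: algebra_simps)
  also have "pcong 3 \<dots> (of_nat M - of_nat c + (-1) ^ b * (P ^ 2 * (of_nat k * of_int e)))"
  proof -
    obtain q where q: "q \<in> zloc p" "of_nat M ^ (p - 1) = 1 + P * q"
      using L unfolding plog_def by blast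
    have "of_nat M ^ p = of_nat M * (1 + P * q)"
      using q(2) p_gt_3 by (metis One_nat_def Suc_pred p_pos(1) power_Suc)
    then have "pcong 1 (of_nat M ^ p) (of_nat M)"
      using q(1) by (intro pcongI[where c = "of_nat M * q"]) (auto simp: algebra_simps)
    moreover have "?E \<in> zloc p"
    proof -
      have "1 / of_nat 2 ^ (p - 3) \<in> zloc p"
        by (rule zloc_inverse_power[OF not_dvd_2_3(1)])
      then have "(\<Sum>k=0..p - 3. of_nat (p - 3 choose k) * (2 * - x - 1) ^ (p - 3 - k) * of_int (euler_num k)) *
          (1 / of_nat 2 ^ (p - 3)) \<in> zloc p"
        using x by (intro zloc_mult zloc_sum) auto
      then show ?thesis
        by (simp add: eulerpoly_def)
    qed
    ultimately have "pcong 1 (of_nat M ^ p * ?E) (of_nat M * ?E)"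
      by (rule pcong_mult_right)
    then have "pcong 3 (P ^ 2 * (of_nat M ^ p * ?E)) (P ^ 2 * (of_nat k * of_int e))"
      by (intro pcong_times_P[OF pcong_trans[OF _ e]]) auto
    then have "pcong 3 ((-1) ^ b * (P ^ 2 * (of_nat M ^ p * ?E))) ((-1) ^ b * (P ^ 2 * (of_nat k * of_int e)))"
      by (rule pcong_mult_left) auto
    then show ?thesis
      by (intro pcong_add pcong_diff power_p_plog[OF L T] g)
  qed
  also have "of_nat M - of_nat c + (-1) ^ b * (P ^ 2 * (of_nat k * of_int e)) =
      of_nat M - of_nat c + of_nat k * (-1) ^ b * P ^ 2 * of_int e"
    by simp
  finally have *: "pcong 3 (of_nat M ^ p * G p x) (of_nat M - of_nat c + of_nat k * (-1) ^ b * P ^ 2 * of_int e)" .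
  moreover have "of_nat M - of_nat c + of_nat k * (-1) ^ b * P ^ 2 * of_int e \<in> zloc p"
    by (intro zloc_add zloc_diff zloc_mult zloc_power zloc_minus zloc_of_nat zloc_of_int zloc_numeral)
  ultimately show ?thesis
    unfolding loc_cong_iff using pcong_zloc by blast
qed

lemma even_p_minus_3: "even (p - 3)"
  using odd_p p_gt_3 by simp

lemma p_mod_3: "p mod 3 \<noteq> 0"
proof
  assume "p mod 3 = 0"
  then have "3 dvd p"
    by (simp add: dvd_eq_mod_eq_0)
  then have "3 = p"
    using prime_p by (auto simp: prime_nat_iff)
  then show False
    using p_gt_3 by simp
qed

lemma minus_one_power_cong: "even (a + b) \<Longrightarrow> (-1 :: rat) ^ a = (-1) ^ b"
  by (cases "even a") auto

lemma pcong_mult_inverse_power: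
  assumes "\<not> p dvd m"
  shows "pcong 1 (of_nat M * (of_int e / of_nat m ^ (p - 3))) (of_nat (M * m ^ 2) * of_int e)"
proof -
  have "pcong 1 (of_nat M * of_int e * (1 / of_nat m ^ (p - 3))) (of_nat M * of_int e * of_nat m ^ 2)"
    using inverse_power_p_minus_3[OF assms] by (rule pcong_mult_left) auto
  then show ?thesis
    by (simp add: mult_ac)
qed

theorem G2_pcong:
  "loc_cong p (G2 p) (12 + 64 * (-1) ^ ((p - 1) div 2) * P ^ 2 * of_int (euler_num (p - 3))) (p ^ 3)"
proof -
  obtain L where L: "plog 2 L"
    using plog_exists[OF not_dvd_2_3(1)] .
  have L16: "plog 16 (4 * L)"
    using plog_mult[OF plog_mult[OF L L] plog_mult[OF L L]] by simp
  have "pcong 2 (2 * T p (-1/2)) (2 * - (2 * L))"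
    using T_half[OF L] by (rule pcong_mult_left) auto
  then have T: "pcong 2 (2 * T p (-1/2)) (- (4 * L))"
    by simp
  have "2 * ((p - 1) div 2) + 1 = p * 1"
    using odd_p by (simp add: odd_two_times_div_two_nat)
  then have "residue p (- (1 / of_nat 2)) = (p - 1) div 2"
    using p_gt_3 by (intro residue_neg_inverse[OF not_dvd_2_3(1)]) auto
  then have r: "(-1 :: rat) ^ residue p (-1/2) = (-1) ^ ((p - 1) div 2)"
    by simp
  have e: "pcong 1 (of_nat 16 * eulerpoly (p - 3) (- (-1/2))) (of_nat 64 * of_int (euler_num (p - 3)))"
    using pcong_mult_inverse_power[OF not_dvd_2_3(1), of 16 "euler_num (p - 3)"] by (simp add: eulerpoly_half)
  have "(-1/2 :: rat) \<in> zloc p"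
    using neg_inverse_zloc[OF not_dvd_2_3(1), of 1] by simp
  from scaled_G_pcong[OF this L16 T _ r e, of 4]
  show ?thesis
    using gbinomials_half by (simp add: G2_def)
qed

theorem G3_pcong:
  "loc_cong p (G3 p) (21 + 243 * (-1) ^ (p div 3) * P ^ 2 * of_int (U (p - 3))) (p ^ 3)"
proof -
  obtain L where L: "plog 3 L"
    using plog_exists[OF not_dvd_2_3(2)] .
  have L27: "plog 27 (3 * L)"
    using plog_mult[OF L plog_mult[OF L L]] by simp
  have r: "(-1 :: rat) ^ residue p (-1/3) = (-1) ^ (p div 3)"
  proof -
    define k where "k = p div 3"
    have pk: "p = 3 * k + 1 \<or> p = 3 * k + 2"
      using p_mod_3 unfolding k_def by presburger
    then show ?thesis
    proof
      assume "p = 3 * k + 1"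
      then have "residue p (- (1 / of_nat 3)) = k"
        by (intro residue_neg_inverse[OF not_dvd_2_3(2), of _ 1]) auto
      then show ?thesis
        by (simp add: k_def)
    next
      \<comment> \<open>The residue is 2 k + 1 because 3 (2 k + 1) + 1 = 2 p; as p is odd, so is k,
        and the two exponents have equal parity.\<close>
      assume p: "p = 3 * k + 2"
      then have "residue p (- (1 / of_nat 3)) = 2 * k + 1"
        by (intro residue_neg_inverse[OF not_dvd_2_3(2), of _ 2]) auto
      moreover have "odd k"
        using odd_p p by auto
      ultimately show ?thesis
        by (simp add: k_def)
    qed
  qed
  have U: "eulerpoly (p - 3) (1/3) = of_int (U (p - 3)) / of_nat 3 ^ (p - 3)"
    using U_eq_eulerpoly[OF even_p_minus_3] by simp
  have e: "pcong 1 (of_nat 27 * eulerpoly (p - 3) (- (-1/3))) (of_nat 243 * of_int (U (p - 3)))"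
    using pcong_mult_inverse_power[OF not_dvd_2_3(2), of 27 "U (p - 3)"] U by simp
  have "(-1/3 :: rat) \<in> zloc p"
    using neg_inverse_zloc[OF not_dvd_2_3(2), of 1] by simp
  from scaled_G_pcong[OF this L27 T_third[OF L] _ r e, of 6]
  show ?thesis
    using gbinomials_third by (simp add: G3_def)
qed

theorem G4_pcong:
  "loc_cong p (G4 p) (52 + 1024 * (-1) ^ (p div 4) * P ^ 2 * of_int (s (p - 3))) (p ^ 3)"
proof -
  obtain L where L: "plog 2 L"
    using plog_exists[OF not_dvd_2_3(1)] .
  have L64: "plog 64 (6 * L)"
    using plog_mult[OF plog_mult[OF L L] plog_mult[OF plog_mult[OF L L] plog_mult[OF L L]]] by simp
  have r: "(-1 :: rat) ^ residue p (-1/4) = (-1) ^ (p div 4)"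
  proof -
    define k where "k = p div 4"
    have "p = 4 * k + 1 \<or> p = 4 * k + 3"
      using odd_p unfolding k_def by presburger
    then show ?thesis
    proof
      assume "p = 4 * k + 1"
      then have "residue p (- (1 / of_nat 4)) = k"
        by (intro residue_neg_inverse[OF not_dvd_4_6(1), of _ 1]) auto
      then show ?thesis
        by (simp add: k_def)
    next
      assume p: "p = 4 * k + 3"
      then have "residue p (- (1 / of_nat 4)) = 3 * k + 2"
        by (intro residue_neg_inverse[OF not_dvd_4_6(1), of _ 3]) auto
      then show ?thesis
        using minus_one_power_cong[of "3 * k + 2" k] by (simp add: k_def)
    qed
  qed
  have s: "eulerpoly (p - 3) (1/4) = of_int (s (p - 3)) / of_nat 4 ^ (p - 3)"
    using s_eq_eulerpoly[of "p - 3"] by simp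
  have e: "pcong 1 (of_nat 64 * eulerpoly (p - 3) (- (-1/4))) (of_nat 1024 * of_int (s (p - 3)))"
    using pcong_mult_inverse_power[OF not_dvd_4_6(1), of 64 "s (p - 3)"] s by simp
  have "(-1/4 :: rat) \<in> zloc p"
    using neg_inverse_zloc[OF not_dvd_4_6(1), of 1] by simp
  from scaled_G_pcong[OF this L64 T_fourth[OF L] _ r e, of 12]
  show ?thesis
    using gbinomials_fourth by (simp add: G4_def)
qed

theorem G6_pcong:
  "loc_cong p (G6 p) (372 + 8640 * (-1) ^ ((p - 1) div 2) * P ^ 2 * of_int (euler_num (p - 3))) (p ^ 3)"
proof -
  obtain L where L: "plog 2 L"
    using plog_exists[OF not_dvd_2_3(1)] .
  obtain K where K: "plog 3 K"
    using plog_exists[OF not_dvd_2_3(2)] .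
  have LK: "plog 432 (4 * L + 3 * K)"
    using plog_mult[OF plog_mult[OF plog_mult[OF L L] plog_mult[OF L L]] plog_mult[OF K plog_mult[OF K K]]]
    by (simp add: algebra_simps)
  have r: "(-1 :: rat) ^ residue p (-1/6) = (-1) ^ ((p - 1) div 2)"
  proof -
    define k where "k = p div 6"
    have "p = 6 * k + 1 \<or> p = 6 * k + 5"
      using p_mod_3 odd_p unfolding k_def by presburger
    then show ?thesis
    proof
      assume p: "p = 6 * k + 1"
      then have "residue p (- (1 / of_nat 6)) = k"
        by (intro residue_neg_inverse[OF not_dvd_4_6(2), of _ 1]) auto
      moreover have "(p - 1) div 2 = 3 * k"
        using p by simp
      ultimately show ?thesis
        using minus_one_power_cong[of k "3 * k"] by simp
    next
      assume p: "p = 6 * k + 5"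
      then have "residue p (- (1 / of_nat 6)) = 5 * k + 4"
        by (intro residue_neg_inverse[OF not_dvd_4_6(2), of _ 5]) auto
      moreover have "(p - 1) div 2 = 3 * k + 2"
        using p by simp
      ultimately show ?thesis
        using minus_one_power_cong[of "5 * k + 4" "3 * k + 2"] by simp
    qed
  qed
  let ?n = "p - 3"
  have E: "eulerpoly ?n (1/6) = (1 / of_nat 3 ^ ?n + 1) * (1 / of_nat 2 ^ ?n) * (1 / of_nat 2) * of_int (euler_num ?n)"
    using eulerpoly_sixth[OF even_p_minus_3] unfolding eulerpoly_half by (simp add: field_simps)
  \<comment> \<open>The right-hand factor is (9 + 1) 4 / 2 = 20, and 432 times 20 is the constant
    8640.\<close>
  have "pcong 1 ((1 / of_nat 3 ^ ?n + 1) * (1 / of_nat 2 ^ ?n) * (1 / of_nat 2) * of_int (euler_num ?n))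
      ((of_nat 3 ^ 2 + 1) * of_nat 2 ^ 2 * (1 / of_nat 2) * of_int (euler_num ?n))"
    using not_dvd_2_3
    by (intro pcong_mult_right pcong_mult pcong_add inverse_power_p_minus_3 pcong_refl
        zloc_of_int zloc_inverse_nat zloc_add zloc_power zloc_of_nat zloc_numeral)
  then have "pcong 1 (of_nat 432 * eulerpoly ?n (1/6))
      (of_nat 432 * ((of_nat 3 ^ 2 + 1) * of_nat 2 ^ 2 * (1 / of_nat 2) * of_int (euler_num ?n)))"
    unfolding E by (rule pcong_mult_left) auto
  then have e: "pcong 1 (of_nat 432 * eulerpoly ?n (- (-1/6))) (of_nat 8640 * of_int (euler_num ?n))"
    by simp
  have "(-1/6 :: rat) \<in> zloc p"
    using neg_inverse_zloc[OF not_dvd_4_6(2), of 1] by simp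
  from scaled_G_pcong[OF this LK T_sixth[OF L K] _ r e, of 60]
  show ?thesis
    using gbinomials_sixth by (simp add: G6_def)
qed

end

theorem theorem3p5:
  fixes p :: nat
  assumes "prime p"
  shows "(odd p \<and> p \<noteq> 3 \<longrightarrow>
            (\<forall>x\<in>zloc p. \<not> loc_cong p x 0 p \<longrightarrow>
               loc_cong p (G p x)
                 (1 - (x gchoose p) * ((-1 - x) gchoose p)
                  + 2 * of_nat p * T p x + 2 * of_nat p ^ 2 * T p x ^ 2
                  + of_nat p ^ 2 * (-1) ^ residue p x * eulerpoly (p - 3) (- x))
                 (p ^ 3))) \<and>
         (p > 3 \<longrightarrow>
            loc_cong p (G2 p)
              (12 + 64 * (-1) ^ ((p - 1) div 2) * of_nat p ^ 2 * of_int (euler_num (p - 3)))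
              (p ^ 3) \<and>
            loc_cong p (G3 p)
              (21 + 243 * (-1) ^ (p div 3) * of_nat p ^ 2 * of_int (U (p - 3)))
              (p ^ 3) \<and>
            loc_cong p (G4 p)
              (52 + 1024 * (-1) ^ (p div 4) * of_nat p ^ 2 * of_int (s (p - 3)))
              (p ^ 3) \<and>
            loc_cong p (G6 p)
              (372 + 8640 * (-1) ^ ((p - 1) div 2) * of_nat p ^ 2 * of_int (euler_num (p - 3)))
              (p ^ 3))"
proof (cases "p > 3")
  case True
  then interpret local_ring_gt3 p
    using assms by unfold_locales
  show ?thesis
    using G_pcong G2_pcong G3_pcong G4_pcong G6_pcong by blast
next
  case False
  then have "\<not> (odd p \<and> p \<noteq> 3)"
    using prime_ge_2_nat[OF assms] by (cases "p = 2") auto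
  then show ?thesis
    using False by blast
qed

end
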